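(* Let $p\in(0,1)$ be fixed, and let $d=d(n)$ (integers $\ge 2$) and $q=q(n)\in[0,1]$ be sequences indexed by $n$. All limits are as $n\to\infty$. (a) (Impossibility) If $nq\to 0$ or $n^3q^2/d\to 0$, then $\mathrm{TV}(\mathcal{G}(n,p),\mathcal{G}(n,p,d,q))\to 0$. (b) (Possibility) If $n^3q^6/d\to\infty$, then $\mathrm{TV}(\mathcal{G}(n,p),\mathcal{G}(n,p,d,q))\to 1$.
   Context: $\mathcal{G}(n,p)$ denotes the Erdős–Rényi random graph on vertex set $[n]=\{1,\dots,n\}$ in which each pair is an edge independently with probability $p$. $\mathcal{G}(n,p,d,q)$ denotes the following random graph on $[n]$: let $\mathbf{x}_1,\dots,\mathbf{x}_n$ be independent and uniformly distributed on the unit sphere $\mathbb{S}^{d-1}\subset\mathbb{R}^d$, and let $t_{p,d}$ be the threshold determined by $\mathbb{P}(\langle\mathbf{x}_1,\mathbf{x}_2\rangle\ge t_{p,d})=p$ for two independent uniform points. Conditionally on $\mathbf{x}_1,\dots,\mathbf{x}_n$, the pairs $\{i,j\}$, $i\neq j$, are edges independently with probability $\phi_q(\langle\mathbf{x}_i,\mathbf{x}_j\rangle)$, where $\phi_q(x)=(1-q)p+q\,\mathbf{1}\{x\ge t_{p,d}\}$. $\mathrm{TV}(\mathcal P,\mathcal Q)=\sup_A|\mathcal P(A)-\mathcal Q(A)|$ is the total variation distance between the laws of the two random graphs. *)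

theory Defs
  imports "HOL-Probability.Probability"
begin

text \<open>
  Since the dimension varies with the number of vertices, points of \<open>\<real>\<^sup>d\<close> are the elements of the
  product space \<open>PiM {..<d} (\<lambda>_. lborel)\<close>, i.e. extensional functions on \<open>{..<d}\<close>.
\<close>

definition inner_prod :: "nat \<Rightarrow> (nat \<Rightarrow> real) \<Rightarrow> (nat \<Rightarrow> real) \<Rightarrow> real" where
  "inner_prod d x y = (\<Sum>k<d. x k * y k)"

definition euclidean_space_measure :: "nat \<Rightarrow> (nat \<Rightarrow> real) measure" where
  "euclidean_space_measure d = PiM {..<d} (\<lambda>_. lborel)"

definition unit_ball :: "nat \<Rightarrow> (nat \<Rightarrow> real) set" where
  "unit_ball d = {x \<in> space (euclidean_space_measure d). inner_prod d x x \<le> 1}"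

definition radial_projection :: "nat \<Rightarrow> (nat \<Rightarrow> real) \<Rightarrow> (nat \<Rightarrow> real)" where
  "radial_projection d x = (\<lambda>k\<in>{..<d}. x k / sqrt (inner_prod d x x))"

text \<open>
  The uniform distribution on the unit sphere of \<open>\<real>\<^sup>d\<close> is realised as the cone measure, i.e. the
  law of \<open>x / |x|\<close> for \<open>x\<close> uniform in the unit ball: a set \<open>A\<close> of directions gets the mass
  \<open>vol {r a | 0 < r \<le> 1, a \<in> A} / vol (unit ball)\<close>. This is the normalised surface measure. The
  origin, which \<open>radial_projection\<close> does not send to the sphere, is a null set for \<open>d \<ge> 1\<close>.
\<close>
definition sphere_uniform :: "nat \<Rightarrow> (nat \<Rightarrow> real) measure" where
  "sphere_uniform d =
     distr (uniform_measure (euclidean_space_measure d) (unit_ball d))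
       (euclidean_space_measure d) (radial_projection d)"

text \<open>
  For \<open>d \<ge> 2\<close> the inner product of two independent uniform points has a density that is positive
  on \<open>(-1, 1)\<close> and vanishes outside, so that the threshold exists and is unique for \<open>0 < p < 1\<close>.
\<close>
definition threshold :: "real \<Rightarrow> nat \<Rightarrow> real" where
  "threshold p d =
     (THE t. measure (sphere_uniform d \<Otimes>\<^sub>M sphere_uniform d)
        {(x, y) \<in> space (sphere_uniform d \<Otimes>\<^sub>M sphere_uniform d). inner_prod d x y \<ge> t} = p)"

definition connection_prob :: "real \<Rightarrow> nat \<Rightarrow> real \<Rightarrow> real \<Rightarrow> real" where
  "connection_prob p d q s = (1 - q) * p + q * indicat_real {threshold p d..} s"

text \<open>
  A graph on the vertex set \<open>{1..n}\<close> is identified with its set of edges, each of which is a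
  two-element set of vertices. The pairs \<open>(i, j)\<close> with \<open>i < j\<close> enumerate the potential edges
  \<open>{i, j}\<close> without repetition.
\<close>
definition vertex_pairs :: "nat \<Rightarrow> (nat \<times> nat) set" where
  "vertex_pairs n = {(i, j). 1 \<le> i \<and> i < j \<and> j \<le> n}"

definition independent_edges :: "nat \<Rightarrow> (nat \<Rightarrow> nat \<Rightarrow> real) \<Rightarrow> nat set set pmf" where
  "independent_edges n w =
     map_pmf (\<lambda>f. {{i, j} | i j. (i, j) \<in> vertex_pairs n \<and> f (i, j)})
       (Pi_pmf (vertex_pairs n) False (\<lambda>(i, j). bernoulli_pmf (w i j)))"

definition erdos_renyi :: "nat \<Rightarrow> real \<Rightarrow> nat set set measure" where
  "erdos_renyi n p = measure_pmf (independent_edges n (\<lambda>_ _. p))"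

definition latent_points :: "nat \<Rightarrow> nat \<Rightarrow> (nat \<Rightarrow> nat \<Rightarrow> real) measure" where
  "latent_points n d = PiM {1..n} (\<lambda>_. sphere_uniform d)"

definition geometric_graph :: "nat \<Rightarrow> real \<Rightarrow> nat \<Rightarrow> real \<Rightarrow> nat set set measure" where
  "geometric_graph n p d q =
     latent_points n d \<bind>
       (\<lambda>x. measure_pmf
          (independent_edges n (\<lambda>i j. connection_prob p d q (inner_prod d (x i) (x j)))))"

text \<open>Only meant for probability measures \<open>P\<close> and \<open>Q\<close> on the same \<open>\<sigma>\<close>-algebra.\<close>
definition total_variation :: "'a measure \<Rightarrow> 'a measure \<Rightarrow> real" where
  "total_variation P Q = (SUP A\<in>sets P. \<bar>measure P A - measure Q A\<bar>)"


subsection \<open>Well-definedness\<close>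

lemma space_euclidean_space_measure: "space (euclidean_space_measure d) = PiE {..<d} (\<lambda>_. UNIV)"
  by (simp add: euclidean_space_measure_def space_PiM)

lemma measurable_inner_prod [measurable]:
  assumes [measurable]: "f \<in> M \<rightarrow>\<^sub>M euclidean_space_measure d" "g \<in> M \<rightarrow>\<^sub>M euclidean_space_measure d"
  shows "(\<lambda>x. inner_prod d (f x) (g x)) \<in> borel_measurable M"
proof -
  have "(\<lambda>x. h x k) \<in> borel_measurable M"
    if "h \<in> M \<rightarrow>\<^sub>M euclidean_space_measure d" "k < d" for h and k :: nat
    using measurable_compose[OF that(1)[unfolded euclidean_space_measure_def]
        measurable_component_singleton[of k "{..<d}"]] that(2) by simp
  then show ?thesis
    unfolding inner_prod_def using assms by (intro borel_measurable_sum borel_measurable_times) auto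
qed

lemma measurable_radial_projection [measurable]:
  "radial_projection d \<in> euclidean_space_measure d \<rightarrow>\<^sub>M euclidean_space_measure d"
proof -
  have "radial_projection d \<in> euclidean_space_measure d \<rightarrow>\<^sub>M PiM {..<d} (\<lambda>_. lborel)"
    unfolding radial_projection_def
  proof (intro measurable_restrict)
    fix k assume k: "k \<in> {..<d}"
    have [measurable]: "(\<lambda>x. x k) \<in> borel_measurable (euclidean_space_measure d)"
      unfolding euclidean_space_measure_def
      using measurable_component_singleton[OF k, of "\<lambda>_. lborel"] by simp
    show "(\<lambda>x. x k / sqrt (inner_prod d x x)) \<in> euclidean_space_measure d \<rightarrow>\<^sub>M lborel"
      by simp
  qed
  then show ?thesis by (simp add: euclidean_space_measure_def)
qed

lemma sets_unit_ball [measurable]: "unit_ball d \<in> sets (euclidean_space_measure d)"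
  unfolding unit_ball_def by measurable

lemma emeasure_box:
  fixes a b :: real
  assumes "a \<le> b"
  shows "emeasure (euclidean_space_measure d) (PiE {..<d} (\<lambda>_. {a..b})) = ennreal (b - a) ^ d"
proof -
  interpret product_sigma_finite "\<lambda>_. lborel :: real measure"
    by standard
  show ?thesis
    unfolding euclidean_space_measure_def using assms by (subst emeasure_PiM) auto
qed

lemma emeasure_unit_ball:
  "emeasure (euclidean_space_measure d) (unit_ball d) \<noteq> 0"
  "emeasure (euclidean_space_measure d) (unit_ball d) \<noteq> \<infinity>"
proof -
  define c where "c = 1 / real (Suc d)"
  have c: "0 < c" "c \<le> 1" "real d * c \<le> 1"
    by (simp_all add: c_def divide_le_eq)
  have "PiE {..<d} (\<lambda>_. {0..c}) \<subseteq> unit_ball d"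
  proof
    fix x assume x: "x \<in> PiE {..<d} (\<lambda>_. {0..c})"
    have "x k * x k \<le> c" if "k < d" for k
    proof -
      have "0 \<le> x k" "x k \<le> c" using PiE_mem[OF x, of k] that by simp_all
      then have "x k * x k \<le> x k * 1" using c(2) by (intro mult_left_mono) auto
      then show ?thesis using \<open>x k \<le> c\<close> by simp
    qed
    then have "inner_prod d x x \<le> (\<Sum>k<d. c)"
      unfolding inner_prod_def by (intro sum_mono) auto
    then show "x \<in> unit_ball d"
      using x c(3) by (simp add: unit_ball_def space_euclidean_space_measure PiE_iff)
  qed
  then have "ennreal (c - 0) ^ d \<le> emeasure (euclidean_space_measure d) (unit_ball d)"
    using c(1) by (subst emeasure_box[symmetric]) (auto intro!: emeasure_mono)
  moreover have "ennreal (c - 0) ^ d \<noteq> 0"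
    using c(1) by simp
  ultimately show "emeasure (euclidean_space_measure d) (unit_ball d) \<noteq> 0"
    by auto
next
  have "unit_ball d \<subseteq> PiE {..<d} (\<lambda>_. {-1..1})"
  proof
    fix x assume x: "x \<in> unit_ball d"
    have "\<bar>x k\<bar> \<le> 1" if "k < d" for k
    proof -
      have "x k * x k \<le> (\<Sum>k<d. x k * x k)"
        using that by (intro member_le_sum) auto
      also have "\<dots> \<le> 1" using x by (simp add: unit_ball_def inner_prod_def)
      finally show ?thesis using abs_square_le_1[of "x k"] by (simp add: power2_eq_square)
    qed
    then show "x \<in> PiE {..<d} (\<lambda>_. {-1..1})"
      using x by (simp add: unit_ball_def space_euclidean_space_measure PiE_iff abs_le_iff minus_le_iff)
  qed
  moreover have "PiE {..<d} (\<lambda>_. {-1..1}) \<in> sets (euclidean_space_measure d)"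
    unfolding euclidean_space_measure_def by (intro sets_PiM_I_finite) auto
  ultimately have "emeasure (euclidean_space_measure d) (unit_ball d) \<le> ennreal (1 - (-1)) ^ d"
    by (subst emeasure_box[symmetric]) (auto intro!: emeasure_mono)
  also have "\<dots> < \<infinity>" by (simp add: power_less_top_ennreal)
  finally show "emeasure (euclidean_space_measure d) (unit_ball d) \<noteq> \<infinity>" by simp
qed

lemma sets_sphere_uniform [measurable_cong]:
  "sets (sphere_uniform d) = sets (euclidean_space_measure d)"
  by (simp add: sphere_uniform_def)

lemma prob_space_sphere_uniform: "prob_space (sphere_uniform d)"
  unfolding sphere_uniform_def
  by (intro prob_space.prob_space_distr prob_space_uniform_measure emeasure_unit_ball)
     (simp_all add: measurable_radial_projection cong: measurable_cong_sets)

lemma sphere_uniform_on_sphere: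
  assumes "d \<ge> 1"
  shows "AE x in sphere_uniform d. inner_prod d x x = 1"
proof -
  let ?E = "euclidean_space_measure d"
  have "inner_prod d (radial_projection d x) (radial_projection d x) = 1"
    if x: "x \<notin> PiE {..<d} (\<lambda>_. {0..0})" "x \<in> space ?E" for x
  proof -
    have "\<exists>k<d. x k \<noteq> 0"
    proof (rule ccontr)
      assume "\<not> (\<exists>k<d. x k \<noteq> 0)"
      then have "x \<in> PiE {..<d} (\<lambda>_. {0..0})"
        using x(2) by (simp only: space_euclidean_space_measure PiE_iff) simp
      with x(1) show False by blast
    qed
    then obtain k where "k < d" "x k \<noteq> 0" by blast
    then have pos: "inner_prod d x x > 0"
      unfolding inner_prod_def by (intro sum_pos2[of _ k]) (auto simp: zero_less_mult_iff)
    have "inner_prod d (radial_projection d x) (radial_projection d x) =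
        (\<Sum>k<d. x k * x k / inner_prod d x x)"
      unfolding inner_prod_def[of d "radial_projection d x"]
      using pos by (intro sum.cong) (auto simp: radial_projection_def)
    also have "\<dots> = 1"
      using pos by (simp add: sum_divide_distrib[symmetric] inner_prod_def)
    finally show ?thesis .
  qed
  moreover have "AE x in ?E. x \<notin> PiE {..<d} (\<lambda>_. {0..0})"
  proof (rule AE_not_in, rule null_setsI)
    show "emeasure ?E (PiE {..<d} (\<lambda>_. {0..0})) = 0"
      using assms by (subst emeasure_box) auto
    show "PiE {..<d} (\<lambda>_. {0..0}) \<in> sets ?E"
      unfolding euclidean_space_measure_def by (intro sets_PiM_I_finite) auto
  qed
  ultimately have "AE x in ?E.
      inner_prod d (radial_projection d x) (radial_projection d x) = 1"
    by (auto elim: AE_mp)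
  then have "AE x in uniform_measure ?E (unit_ball d).
      inner_prod d (radial_projection d x) (radial_projection d x) = 1"
    by (intro AE_uniform_measureI) auto
  then show ?thesis
    unfolding sphere_uniform_def
    by (subst AE_distr_iff) (simp_all cong: measurable_cong_sets)
qed

lemma finite_vertex_pairs: "finite (vertex_pairs n)"
  by (rule finite_subset[of _ "{..n} \<times> {..n}"]) (auto simp: vertex_pairs_def)

lemma prob_space_latent_points: "prob_space (latent_points n d)"
  unfolding latent_points_def by (intro prob_space_PiM prob_space_sphere_uniform)

lemma measurable_independent_edges:
  assumes w: "\<And>i j. (i, j) \<in> vertex_pairs n \<Longrightarrow> (\<lambda>x. w x i j) \<in> borel_measurable M"
  shows "(\<lambda>x. measure_pmf (independent_edges n (w x))) \<in> M \<rightarrow>\<^sub>M subprob_algebra (count_space UNIV)"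
proof (rule measurable_subprob_algebra)
  fix A :: "nat set set set"
  let ?E = "vertex_pairs n"
  define g where "g = (\<lambda>f. {{i, j} | i j. (i, j) \<in> ?E \<and> f (i, j)})"
  define S where "S = PiE_dflt ?E False (\<lambda>_. UNIV :: bool set)"
  define P where "P = (\<lambda>x. Pi_pmf ?E False (\<lambda>(i, j). bernoulli_pmf (w x i j)))"
  have fin: "finite S" unfolding S_def by (intro finite_PiE_dflt finite_vertex_pairs) simp
  have supp: "set_pmf (P x) \<subseteq> S" for x
    using set_Pi_pmf_subset[OF finite_vertex_pairs, of n False "\<lambda>(i, j). bernoulli_pmf (w x i j)"]
    by (auto simp: P_def S_def PiE_dflt_def)
  have pmf_b: "pmf (bernoulli_pmf r) b = (if b then min 1 (max 0 r) else 1 - min 1 (max 0 r))"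
    for r b by (simp add: bernoulli_pmf.rep_eq)
  have pmf_P: "(\<lambda>x. pmf (P x) f) \<in> borel_measurable M" if "f \<in> S" for f
  proof -
    have "pmf (P x) f = (\<Prod>(i, j)\<in>?E. pmf (bernoulli_pmf (w x i j)) (f (i, j)))" for x
      using that unfolding P_def S_def
      by (subst pmf_Pi'[OF finite_vertex_pairs]) (auto simp: PiE_dflt_def intro!: prod.cong)
    moreover have "(\<lambda>x. pmf (bernoulli_pmf (w x i j)) (f (i, j))) \<in> borel_measurable M"
      if "(i, j) \<in> ?E" for i j
      using w[OF that] unfolding pmf_b by (cases "f (i, j)") auto
    ultimately show ?thesis by (auto intro!: borel_measurable_prod)
  qed
  have "emeasure (measure_pmf (independent_edges n (w x))) A =
      (\<Sum>f\<in>g -` A \<inter> S. ennreal (pmf (P x) f))" for x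
  proof -
    have "emeasure (measure_pmf (independent_edges n (w x))) A = emeasure (measure_pmf (P x)) (g -` A)"
      by (simp add: independent_edges_def P_def g_def)
    also have "\<dots> = emeasure (measure_pmf (P x)) (g -` A \<inter> S)"
      using supp[of x] by (intro emeasure_eq_AE) (auto simp: AE_measure_pmf_iff)
    also have "\<dots> = (\<Sum>f\<in>g -` A \<inter> S. ennreal (pmf (P x) f))"
      using fin by (subst emeasure_measure_pmf_finite) auto
    finally show ?thesis .
  qed
  then show "(\<lambda>x. emeasure (measure_pmf (independent_edges n (w x))) A) \<in> borel_measurable M"
    using pmf_P by auto
qed (auto intro: measure_pmf.subprob_space_axioms)

lemma measurable_geometric_graph_kernel:
  "(\<lambda>x. measure_pmf
      (independent_edges n (\<lambda>i j. connection_prob p d q (inner_prod d (x i) (x j)))))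
    \<in> latent_points n d \<rightarrow>\<^sub>M subprob_algebra (count_space UNIV)"
proof (rule measurable_independent_edges)
  fix i j assume "(i, j) \<in> vertex_pairs n"
  then have ij: "i \<in> {1..n}" "j \<in> {1..n}" by (auto simp: vertex_pairs_def)
  have [measurable]: "(\<lambda>x. x k) \<in> latent_points n d \<rightarrow>\<^sub>M euclidean_space_measure d"
    if "k \<in> {1..n}" for k
    using measurable_component_singleton[OF that, of "\<lambda>_. sphere_uniform d"]
    by (simp add: latent_points_def sets_sphere_uniform cong: measurable_cong_sets)
  show "(\<lambda>x. connection_prob p d q (inner_prod d (x i) (x j))) \<in> borel_measurable (latent_points n d)"
    unfolding connection_prob_def using ij by measurable
qed

lemma prob_space_geometric_graph: "prob_space (geometric_graph n p d q)"
  unfolding geometric_graph_def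
  by (rule prob_space.prob_space_bind[OF prob_space_latent_points _ measurable_geometric_graph_kernel])
     (simp add: measure_pmf.prob_space_axioms)

lemma sets_erdos_renyi: "sets (erdos_renyi n p) = UNIV"
  by (simp add: erdos_renyi_def)

lemma sets_geometric_graph: "sets (geometric_graph n p d q) = UNIV"
  unfolding geometric_graph_def
  by (subst sets_bind[where N = "count_space UNIV"])
     (auto simp: prob_space.not_empty[OF prob_space_latent_points])

end

theory Submission
  imports Defs
begin

text \<open>
  Write the edge probability of two latent points as \<open>p + q f\<close> with the centred kernel
  \<open>f(x, y) = 1{\<langle>x, y\<rangle> \<ge> t} - p\<close>, and let \<open>g(x, z)\<close> be the integral of \<open>f(x, y) f(y, z)\<close> over \<open>y\<close>. The sphere is
  invariant under reflections, so all conditional means of \<open>f\<close> given one point vanish and \<open>g\<close> is a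
  monotone function of \<open>\<langle>x, z\<rangle>\<close>; it satisfies \<open>\<bar>g\<bar> \<le> 8 (\<bar>\<langle>x, z\<rangle>\<bar> + 1 / sqrt d)\<close>.

  Impossibility: reveal the vertices one by one. By convexity the relative entropy to the
  Erdos-Renyi graph grows in step \<open>k\<close> by at most the \<open>\<chi>\<^sup>2\<close>-divergence of the new row of the adjacency
  matrix, averaged over the previous latent points, which equals
  \<open>E (1 + q\<^sup>2 g / (p (1 - p)))\<^sup>k - 1 = O (k\<^sup>2 q\<^sup>4 / d)\<close>. So the relative entropy is \<open>O (n\<^sup>3 q\<^sup>4 / d)\<close>, which
  tends to \<open>0\<close> under either hypothesis, since \<open>n\<^sup>3 q\<^sup>4 / d\<close> is at most both \<open>(n q)\<^sup>3\<close> and \<open>n\<^sup>3 q\<^sup>2 / d\<close>.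

  Possibility: the signed triangle count has mean \<open>0\<close> in the Erdos-Renyi graph and mean of order at least
  \<open>n\<^sup>3 q\<^sup>3 / sqrt d\<close> in the geometric graph. Triangles without a common edge are uncorrelated, which leaves
  a variance of order \<open>n\<^sup>3 + n\<^sup>4 q\<^sup>4 / d\<close>; Chebyshev's inequality separates the two graphs.
\<close>

subsection \<open>Reflections\<close>

text \<open>The dimension changes with \<open>n\<close>, so the sphere is handled in coordinates.
  Reflections are the only symmetry that is established; they suffice because one of them swaps any
  two given unit vectors. Averages over many points of a great circle take its place: they exclude
  atoms, and they bound how fast \<open>g\<close> varies. In the impossibility part, adding up total
  variation distances over the steps would give n^2 q^2 / sqrt d. Relative entropies are added
  before the square root is taken, which gives n^(3/2) q^2 / sqrt d. In the possibility part, the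
  delicate point is the lower bound for the mean. Both \<open>f\<close> and \<open>g\<close> are
  non-decreasing in \<langle>x, y\<rangle>, so their correlation is at least a constant times the
  mean of \<bar>g\<bar>, and that mean is bounded below by testing \<open>g\<close> against
  \<langle>x, y\<rangle>. Relative to the squared mean, the two variance terms are of order d / (n^3
  q^6) and 1 / (n q)^2.\<close>

lemma measurable_coordinate [measurable]:
  "k < d \<Longrightarrow> (\<lambda>x. x k) \<in> borel_measurable (euclidean_space_measure d)"
  unfolding euclidean_space_measure_def
  using measurable_component_singleton[of k "{..<d}" "\<lambda>_. lborel"] by simp

lemma measurable_into_euclidean_space:
  assumes "\<And>k. k < d \<Longrightarrow> (\<lambda>x. f x k) \<in> borel_measurable M"
    and "\<And>x. x \<in> space M \<Longrightarrow> f x \<in> extensional {..<d}"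
  shows "f \<in> M \<rightarrow>\<^sub>M euclidean_space_measure d"
  unfolding euclidean_space_measure_def
  using assms by (intro measurable_PiM_single') (auto simp: PiE_def)

text \<open>Fubini isolates coordinate \<open>k\<close>, in which the map is a one-dimensional
  affine substitution; the shift may depend on the other coordinates, which is what
  \<open>h_indep\<close> expresses. Reflections are composed of such maps.\<close>

lemma nn_integral_coordinate_affine:
  fixes F :: "(nat \<Rightarrow> real) \<Rightarrow> ennreal"
  assumes k: "k < d" and a: "a \<noteq> 0"
    and F [measurable]: "F \<in> borel_measurable (euclidean_space_measure d)"
    and h [measurable]: "h \<in> borel_measurable (euclidean_space_measure d)"
    and h_indep: "\<And>x u. h (x(k := u)) = h x"
  shows "(\<integral>\<^sup>+x. F x \<partial>euclidean_space_measure d) =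
    ennreal \<bar>a\<bar> * (\<integral>\<^sup>+x. F (x(k := h x + a * x k)) \<partial>euclidean_space_measure d)"
proof -
  let ?I = "{..<d} - {k}"
  interpret product_sigma_finite "\<lambda>_. lborel :: real measure" by standard
  have ins: "insert k ?I = {..<d}" using k by auto
  have E: "euclidean_space_measure d = PiM (insert k ?I) (\<lambda>_. lborel)"
    unfolding ins euclidean_space_measure_def ..
  have m [measurable]: "(\<lambda>x. x(k := h x + a * x k)) \<in> euclidean_space_measure d \<rightarrow>\<^sub>M euclidean_space_measure d"
  proof (rule measurable_into_euclidean_space)
    fix i assume "i < d"
    then show "(\<lambda>x. (x(k := h x + a * x k)) i) \<in> borel_measurable (euclidean_space_measure d)"
      using k by (cases "i = k") auto
  qed (use k in \<open>auto simp: space_euclidean_space_measure PiE_def extensional_def\<close>)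
  have upd: "x(k := u) \<in> space (euclidean_space_measure d)" if "x \<in> space (PiM ?I (\<lambda>_. lborel))" for x u
    using that k by (auto simp: space_PiM space_euclidean_space_measure PiE_iff extensional_def)
  have mu: "(\<lambda>u. x(k := u)) \<in> borel \<rightarrow>\<^sub>M euclidean_space_measure d" if "x \<in> space (PiM ?I (\<lambda>_. lborel))" for x
  proof (rule measurable_into_euclidean_space)
    fix i show "(\<lambda>u. (x(k := u)) i) \<in> borel_measurable borel" by (cases "i = k") auto
  qed (use upd[OF that] in \<open>auto simp: space_euclidean_space_measure PiE_def\<close>)
  have FE: "F \<in> borel_measurable (PiM (insert k ?I) (\<lambda>_. lborel))"
    using F unfolding E .
  have FmE: "(\<lambda>x. F (x(k := h x + a * x k))) \<in> borel_measurable (PiM (insert k ?I) (\<lambda>_. lborel))"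
    using measurable_compose[OF m F] unfolding E .
  have "(\<integral>\<^sup>+x. F (x(k := h x + a * x k)) \<partial>euclidean_space_measure d) =
      (\<integral>\<^sup>+x. (\<integral>\<^sup>+u. F (x(k := h x + a * u)) \<partial>lborel) \<partial>PiM ?I (\<lambda>_. lborel))"
    unfolding E by (subst product_nn_integral_insert[OF _ _ FmE]) (auto simp: h_indep)
  moreover have "(\<integral>\<^sup>+x. F x \<partial>euclidean_space_measure d) =
      (\<integral>\<^sup>+x. (\<integral>\<^sup>+u. F (x(k := u)) \<partial>lborel) \<partial>PiM ?I (\<lambda>_. lborel))"
    unfolding E by (subst product_nn_integral_insert[OF _ _ FE]) auto
  moreover have "\<dots> = (\<integral>\<^sup>+x. ennreal \<bar>a\<bar> * (\<integral>\<^sup>+u. F (x(k := h x + a * u)) \<partial>lborel) \<partial>PiM ?I (\<lambda>_. lborel))"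
  proof (rule nn_integral_cong)
    fix x assume x: "x \<in> space (PiM ?I (\<lambda>_. lborel :: real measure))"
    have "(\<lambda>u. F (x(k := u))) \<in> borel_measurable borel"
      using measurable_compose[OF mu[OF x] F] .
    from nn_integral_real_affine[OF this a, of "h x"]
    show "(\<integral>\<^sup>+u. F (x(k := u)) \<partial>lborel) = ennreal \<bar>a\<bar> * (\<integral>\<^sup>+u. F (x(k := h x + a * u)) \<partial>lborel)" .
  qed
  moreover have "\<dots> = ennreal \<bar>a\<bar> * (\<integral>\<^sup>+x. (\<integral>\<^sup>+u. F (x(k := h x + a * u)) \<partial>lborel) \<partial>PiM ?I (\<lambda>_. lborel))"
  proof (rule nn_integral_cmult)
    have "(\<lambda>x. \<integral>\<^sup>+u. (F \<circ> (\<lambda>x. x(k := h x + a * x k))) (x(k := u)) \<partial>lborel) \<in> borel_measurable (PiM ?I (\<lambda>_. lborel))"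
      using measurable_comp[OF m F] unfolding E
      by measurable
    then show "(\<lambda>x. \<integral>\<^sup>+u. F (x(k := h x + a * u)) \<partial>lborel) \<in> borel_measurable (PiM ?I (\<lambda>_. lborel))"
      by (simp add: h_indep)
  qed
  ultimately show ?thesis by simp
qed

text \<open>One coordinate at a time, each with scaling factor 1: coordinate \<open>k\<close> lies
  outside \<open>S\<close> and therefore stays fixed during all the steps.\<close>

lemma nn_integral_shear:
  fixes F :: "(nat \<Rightarrow> real) \<Rightarrow> ennreal"
  assumes "finite S" "S \<subseteq> {..<d} - {k}" and k: "k < d"
    and "F \<in> borel_measurable (euclidean_space_measure d)"
  shows "(\<integral>\<^sup>+x. F (\<lambda>i. if i \<in> S then x i + c i * x k else x i) \<partial>euclidean_space_measure d) =
    (\<integral>\<^sup>+x. F x \<partial>euclidean_space_measure d)"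
  using assms(1,2,4)
proof (induction S arbitrary: F rule: finite_induct)
  case (insert j S)
  let ?sh = "\<lambda>S x i. if i \<in> S then x i + c i * x k else x i"
  have j: "j < d" "j \<noteq> k" using insert.prems by auto
  have msh: "?sh S \<in> euclidean_space_measure d \<rightarrow>\<^sub>M euclidean_space_measure d"
    if "S \<subseteq> {..<d}" for S
  proof (rule measurable_into_euclidean_space)
    fix i assume "i < d"
    then show "(\<lambda>x. ?sh S x i) \<in> borel_measurable (euclidean_space_measure d)"
      using k by (cases "i \<in> S") auto
  qed (use that in \<open>auto simp: space_euclidean_space_measure PiE_def extensional_def\<close>)
  have m: "(\<lambda>x. F (?sh S x)) \<in> borel_measurable (euclidean_space_measure d)"
    by (rule measurable_compose[OF msh insert.prems(2)]) (use insert.prems(1) in auto)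
  have "(\<integral>\<^sup>+x. F (?sh (insert j S) x) \<partial>euclidean_space_measure d) =
      (\<integral>\<^sup>+x. F (?sh S (x(j := c j * x k + 1 * x j))) \<partial>euclidean_space_measure d)"
    using j insert.hyps by (intro nn_integral_cong arg_cong[of _ _ F] ext) auto
  also have "\<dots> = (\<integral>\<^sup>+x. F (?sh S x) \<partial>euclidean_space_measure d)"
    using nn_integral_coordinate_affine[of j d 1 "\<lambda>x. F (?sh S x)" "\<lambda>x. c j * x k"] j m k by simp
  finally show ?case using insert.IH insert.prems by simp
qed simp

text \<open>Restriction to \<open>{..<d}\<close> keeps the result extensional, so that it is a point
  of \<open>euclidean_space_measure d\<close>.\<close>

definition lincomb :: "nat \<Rightarrow> real \<Rightarrow> (nat \<Rightarrow> real) \<Rightarrow> real \<Rightarrow> (nat \<Rightarrow> real) \<Rightarrow> (nat \<Rightarrow> real)" where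
  "lincomb d a x b y = (\<lambda>k\<in>{..<d}. a * x k + b * y k)"

text \<open>If \<open>w\<close> is zero, division by zero gives the coefficient 0 and every point of
  the space is fixed, so the degenerate direction is covered too.\<close>

definition reflection :: "nat \<Rightarrow> (nat \<Rightarrow> real) \<Rightarrow> (nat \<Rightarrow> real) \<Rightarrow> (nat \<Rightarrow> real)" where
  "reflection d w x = lincomb d 1 x (- (2 * inner_prod d x w / inner_prod d w w)) w"

lemma inner_prod_commute: "inner_prod d x y = inner_prod d y x"
  by (simp add: inner_prod_def mult.commute)

lemma inner_prod_lincomb_left:
  "inner_prod d (lincomb d a x b y) z = a * inner_prod d x z + b * inner_prod d y z"
  by (simp add: inner_prod_def lincomb_def sum_distrib_left sum.distrib[symmetric] algebra_simps)

lemma inner_prod_lincomb_right: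
  "inner_prod d z (lincomb d a x b y) = a * inner_prod d z x + b * inner_prod d z y"
  using inner_prod_lincomb_left[of d a x b y z] by (simp add: inner_prod_commute)

lemmas inner_prod_lincomb = inner_prod_lincomb_left inner_prod_lincomb_right

lemma inner_prod_nonneg: "inner_prod d x x \<ge> 0"
  by (simp add: inner_prod_def sum_nonneg)

lemma inner_prod_self_eq_0: "inner_prod d x x = 0 \<longleftrightarrow> (\<forall>k<d. x k = 0)"
  by (auto simp: inner_prod_def sum_nonneg_eq_0_iff)

lemma lincomb_in_space [simp]: "lincomb d a x b y \<in> space (euclidean_space_measure d)"
  by (simp add: lincomb_def space_euclidean_space_measure)

lemma inner_prod_reflection:
  "inner_prod d (reflection d w x) (reflection d w y) = inner_prod d x y"
proof (cases "inner_prod d w w = 0")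
  case True
  then show ?thesis by (simp add: reflection_def inner_prod_lincomb)
next
  case False
  define a where "a = 2 * inner_prod d x w / inner_prod d w w"
  define b where "b = 2 * inner_prod d y w / inner_prod d w w"
  have "a * inner_prod d w w = 2 * inner_prod d x w" "b * inner_prod d w w = 2 * inner_prod d y w"
    using False by (simp_all add: a_def b_def)
  moreover have "inner_prod d (reflection d w x) (reflection d w y) =
      inner_prod d x y - b * inner_prod d x w - a * inner_prod d y w + a * b * inner_prod d w w"
    unfolding reflection_def a_def[symmetric] b_def[symmetric] inner_prod_lincomb
      inner_prod_commute[of d w x] inner_prod_commute[of d w y]
    by (simp add: algebra_simps)
  moreover have "a * n = 2 * r \<Longrightarrow> b * n = 2 * s \<Longrightarrow> u - b * r - a * s + a * b * n = u" for n r s u :: real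
    by algebra
  ultimately show ?thesis by simp
qed

lemma inner_prod_reflection_left:
  "inner_prod d (reflection d w x) y = inner_prod d x (reflection d w y)"
  by (simp add: reflection_def inner_prod_lincomb inner_prod_commute[of d w y])

lemma measurable_lincomb [measurable]:
  assumes [measurable]: "a \<in> borel_measurable M" "b \<in> borel_measurable M"
    "f \<in> M \<rightarrow>\<^sub>M euclidean_space_measure d" "g \<in> M \<rightarrow>\<^sub>M euclidean_space_measure d"
  shows "(\<lambda>x. lincomb d (a x) (f x) (b x) (g x)) \<in> M \<rightarrow>\<^sub>M euclidean_space_measure d"
proof (rule measurable_into_euclidean_space)
  fix k assume k: "k < d"
  have "(\<lambda>x. f x k) \<in> borel_measurable M" "(\<lambda>x. g x k) \<in> borel_measurable M"
    using measurable_compose[OF assms(3) measurable_coordinate[OF k]]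
      measurable_compose[OF assms(4) measurable_coordinate[OF k]] .
  then show "(\<lambda>x. lincomb d (a x) (f x) (b x) (g x) k) \<in> borel_measurable M"
    using k by (simp add: lincomb_def)
qed (simp add: lincomb_def)

lemma measurable_reflection [measurable]:
  assumes [measurable]: "w \<in> space (euclidean_space_measure d)"
  shows "reflection d w \<in> euclidean_space_measure d \<rightarrow>\<^sub>M euclidean_space_measure d"
  unfolding reflection_def by measurable

text \<open>
  For \<open>w k \<noteq> 0\<close> the reflection replaces \<open>x k\<close> by \<open>\<langle>x, w\<rangle>\<close>, shears the other coordinates by multiples
  of the new coordinate, and then recovers the \<open>k\<close>-th coordinate of the image from
  \<open>\<langle>reflection d w x, w\<rangle> = - \<langle>x, w\<rangle>\<close>. The first and last step scale the volume by \<open>\<bar>w k\<bar>\<close> and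
  \<open>1 / \<bar>w k\<bar>\<close>.
\<close>
lemma nn_integral_reflection_euclidean:
  fixes F :: "(nat \<Rightarrow> real) \<Rightarrow> ennreal"
  assumes w: "w \<in> space (euclidean_space_measure d)"
    and F [measurable]: "F \<in> borel_measurable (euclidean_space_measure d)"
  shows "(\<integral>\<^sup>+x. F (reflection d w x) \<partial>euclidean_space_measure d) = (\<integral>\<^sup>+x. F x \<partial>euclidean_space_measure d)"
proof (cases "\<forall>k<d. w k = 0")
  case True
  have "reflection d w x = x" if "x \<in> space (euclidean_space_measure d)" for x
    using that True by (auto simp: reflection_def lincomb_def space_euclidean_space_measure
        PiE_def extensional_def fun_eq_iff)
  then show ?thesis by (intro nn_integral_cong) simp
next
  case False
  then obtain k where k: "k < d" "w k \<noteq> 0" by blast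
  define N where "N = inner_prod d w w"
  have N: "N \<noteq> 0" using False by (simp add: N_def inner_prod_self_eq_0)
  let ?I = "{..<d} - {k}"
  define r where "r = (\<lambda>x :: nat \<Rightarrow> real. \<Sum>i\<in>?I. w i * x i)"
  define c where "c = (\<lambda>i. - 2 * w i / N)"
  define sh where "sh = (\<lambda>x i. if i \<in> ?I then x i + c i * x k else x i)"
  define C where "C = (\<lambda>x :: nat \<Rightarrow> real. x(k := - r x / w k + (- 1 / w k) * x k))"
  have inner_split: "inner_prod d x w = r x + w k * x k" for x
    using k by (simp add: inner_prod_def r_def sum.remove[of _ k] mult.commute)
  have r_upd: "r (x(k := u)) = r x" for x u by (auto simp: r_def intro!: sum.cong)
  have [measurable]: "r \<in> borel_measurable (euclidean_space_measure d)"
    unfolding r_def by (intro borel_measurable_sum borel_measurable_times) auto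
  have mC [measurable]: "C \<in> euclidean_space_measure d \<rightarrow>\<^sub>M euclidean_space_measure d"
  proof (rule measurable_into_euclidean_space)
    fix i assume "i < d"
    then show "(\<lambda>x. C x i) \<in> borel_measurable (euclidean_space_measure d)"
      using k by (cases "i = k") (auto simp: C_def)
  qed (use k in \<open>auto simp: C_def space_euclidean_space_measure PiE_def extensional_def\<close>)
  have msh [measurable]: "sh \<in> euclidean_space_measure d \<rightarrow>\<^sub>M euclidean_space_measure d"
  proof (rule measurable_into_euclidean_space)
    fix i assume "i < d"
    then show "(\<lambda>x. sh x i) \<in> borel_measurable (euclidean_space_measure d)"
      using k by (cases "i = k") (auto simp: sh_def)
  qed (auto simp: sh_def space_euclidean_space_measure PiE_def extensional_def)
  have refl: "reflection d w x = C (sh (x(k := r x + w k * x k)))"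
    if x: "x \<in> space (euclidean_space_measure d)" for x
  proof
    fix i
    let ?s = "r x + w k * x k"
    have "(\<Sum>i\<in>?I. w i * (x i + c i * s)) = r x + (\<Sum>i\<in>?I. w i * c i) * s" for s
      by (simp add: r_def distrib_left sum.distrib sum_distrib_right mult.assoc)
    moreover have "r (sh (x(k := ?s))) = (\<Sum>i\<in>?I. w i * (x i + c i * ?s))"
      by (simp add: r_def sh_def)
    ultimately have rs: "r (sh (x(k := ?s))) = r x + (\<Sum>i\<in>?I. w i * c i) * ?s"
      by simp
    have N_split: "N = w k * w k + (\<Sum>i\<in>?I. w i * w i)"
      using k by (simp add: N_def inner_prod_def sum.remove[of _ k])
    have "(\<Sum>i\<in>?I. w i * c i) = (\<Sum>i\<in>?I. (- 2 / N) * (w i * w i))"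
      by (intro sum.cong) (auto simp: c_def)
    also have "\<dots> = (- 2 / N) * (N - w k * w k)"
      unfolding sum_distrib_left[symmetric] using N_split by simp
    finally have wc: "(\<Sum>i\<in>?I. w i * c i) = - 2 + 2 * w k * w k / N"
      using N by (simp add: field_simps)
    have refl_i: "reflection d w x i = x i - 2 * ?s / N * w i" if "i < d"
      using that by (simp add: reflection_def lincomb_def N_def[symmetric] inner_split[symmetric])
    have sh_i: "sh (x(k := ?s)) i = x i + c i * ?s" if "i < d" "i \<noteq> k"
      using that by (simp add: sh_def)
    consider "i = k" | "i < d" "i \<noteq> k" | "i \<ge> d" by linarith
    then show "reflection d w x i = C (sh (x(k := ?s))) i"
    proof cases
      case 1
      have "C (sh (x(k := ?s))) k = - r (sh (x(k := ?s))) / w k - sh (x(k := ?s)) k / w k"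
        by (simp add: C_def)
      also have "sh (x(k := ?s)) k = ?s" by (simp add: sh_def)
      also have "r (sh (x(k := ?s))) = r x + (- 2 + 2 * w k * w k / N) * ?s"
        unfolding rs wc ..
      also have "- (r x + (- 2 + 2 * w k * w k / N) * ?s) / w k - ?s / w k =
          x k - 2 * ?s / N * w k"
      proof -
        have "- (u + (- 2 + 2 * b * b / N) * s) / b - s / b = y - 2 * s / N * b"
          if "s = u + b * y" "b \<noteq> 0" for b s u y
          using N that by (simp add: field_simps)
        then show ?thesis using k by simp
      qed
      finally show ?thesis using 1 k refl_i by metis
    next
      case 2
      have "C (sh (x(k := ?s))) i = sh (x(k := ?s)) i" using 2 by (simp add: C_def)
      also have "\<dots> = reflection d w x i"
        unfolding sh_i[OF 2] refl_i[OF 2(1)] by (simp add: c_def)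
      finally show ?thesis ..
    next
      case 3
      then have "x i = undefined"
        using x by (simp add: space_euclidean_space_measure PiE_def extensional_def)
      moreover have "C (sh (x(k := ?s))) i = x i" using 3 k by (simp add: C_def sh_def)
      ultimately show ?thesis using 3 by (simp add: reflection_def lincomb_def)
    qed
  qed
  have "(\<integral>\<^sup>+x. F x \<partial>euclidean_space_measure d) =
      ennreal \<bar>- 1 / w k\<bar> * (\<integral>\<^sup>+x. F (C x) \<partial>euclidean_space_measure d)"
    unfolding C_def using k F by (intro nn_integral_coordinate_affine) (simp_all add: r_upd)
  also have "(\<integral>\<^sup>+x. F (C x) \<partial>euclidean_space_measure d) = (\<integral>\<^sup>+x. F (C (sh x)) \<partial>euclidean_space_measure d)"
    unfolding sh_def
    using k measurable_compose[OF mC F] by (intro nn_integral_shear[symmetric, where F = "\<lambda>x. F (C x)"]) simp_all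
  also have "\<dots> = ennreal \<bar>w k\<bar> * (\<integral>\<^sup>+x. F (C (sh (x(k := r x + w k * x k)))) \<partial>euclidean_space_measure d)"
    using k measurable_compose[OF msh measurable_compose[OF mC F]]
    by (intro nn_integral_coordinate_affine[where F = "\<lambda>x. F (C (sh x))"]) (simp_all add: r_upd)
  also have "(\<integral>\<^sup>+x. F (C (sh (x(k := r x + w k * x k)))) \<partial>euclidean_space_measure d) =
      (\<integral>\<^sup>+x. F (reflection d w x) \<partial>euclidean_space_measure d)"
    by (intro nn_integral_cong) (simp add: refl)
  finally have "(\<integral>\<^sup>+x. F x \<partial>euclidean_space_measure d) = (ennreal \<bar>- 1 / w k\<bar> * ennreal \<bar>w k\<bar>) *
      (\<integral>\<^sup>+x. F (reflection d w x) \<partial>euclidean_space_measure d)"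
    by (simp only: mult.assoc)
  moreover have "ennreal \<bar>- 1 / w k\<bar> * ennreal \<bar>w k\<bar> = 1"
    using k by (subst ennreal_mult[symmetric]) (simp_all add: abs_mult[symmetric])
  ultimately show ?thesis by simp
qed

text \<open>A reflection is linear and keeps the norm, so the scaling by the inverse norm passes
  through it.\<close>

lemma radial_projection_reflection:
  "radial_projection d (reflection d w x) = reflection d w (radial_projection d x)"
proof
  fix k
  define s where "s = sqrt (inner_prod d x x)"
  have apply_k: "reflection d w y k = y k - 2 * inner_prod d y w / inner_prod d w w * w k" if "k < d" for y
    using that by (simp add: reflection_def lincomb_def)
  have "inner_prod d (radial_projection d x) w = inner_prod d x w / s"
    by (simp add: inner_prod_def[of d _ w] radial_projection_def sum_divide_distrib s_def)
  moreover have "radial_projection d (reflection d w x) k = reflection d w x k / s" if "k < d"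
    using that by (simp add: radial_projection_def inner_prod_reflection s_def)
  moreover have "radial_projection d x k = x k / s" if "k < d"
    using that by (simp add: radial_projection_def s_def)
  ultimately show "radial_projection d (reflection d w x) k = reflection d w (radial_projection d x) k"
  proof (cases "k < d")
    case False
    then show ?thesis by (simp add: radial_projection_def reflection_def lincomb_def)
  qed (simp add: apply_k diff_divide_distrib)
qed

lemma space_sphere_uniform: "space (sphere_uniform d) = space (euclidean_space_measure d)"
  by (rule sets_eq_imp_space_eq) (rule sets_sphere_uniform)

text \<open>Lebesgue measure, the unit ball and the radial projection are all compatible with the
  reflection, and \<open>sphere_uniform\<close> is built from these three.\<close>

lemma nn_integral_reflection_sphere:
  fixes F :: "(nat \<Rightarrow> real) \<Rightarrow> ennreal"
  assumes w [measurable]: "w \<in> space (euclidean_space_measure d)"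
    and F [measurable]: "F \<in> borel_measurable (euclidean_space_measure d)"
  shows "(\<integral>\<^sup>+x. F (reflection d w x) \<partial>sphere_uniform d) = (\<integral>\<^sup>+x. F x \<partial>sphere_uniform d)"
proof -
  have *: "(\<integral>\<^sup>+x. H x \<partial>sphere_uniform d) =
      (\<integral>\<^sup>+x. H (radial_projection d x) * indicator (unit_ball d) x \<partial>euclidean_space_measure d)
        / emeasure (euclidean_space_measure d) (unit_ball d)"
    if [measurable]: "H \<in> borel_measurable (euclidean_space_measure d)" for H :: "_ \<Rightarrow> ennreal"
    unfolding sphere_uniform_def by (simp add: nn_integral_distr nn_integral_uniform_measure)
  have ind: "indicator (unit_ball d) (reflection d w x) = (indicator (unit_ball d) x :: ennreal)"
    if "x \<in> space (euclidean_space_measure d)" for x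
    using that by (auto simp: unit_ball_def indicator_def inner_prod_reflection)
       (simp_all add: reflection_def)
  have "(\<integral>\<^sup>+x. F (reflection d w (radial_projection d x)) * indicator (unit_ball d) x \<partial>euclidean_space_measure d) =
    (\<integral>\<^sup>+x. (\<lambda>x. F (radial_projection d x) * indicator (unit_ball d) x) (reflection d w x) \<partial>euclidean_space_measure d)"
    by (intro nn_integral_cong) (simp add: radial_projection_reflection ind)
  also have "\<dots> = (\<integral>\<^sup>+x. F (radial_projection d x) * indicator (unit_ball d) x \<partial>euclidean_space_measure d)"
    by (rule nn_integral_reflection_euclidean) (use w in measurable)
  finally show ?thesis by (simp add: * )
qed

lemma distr_sphere_uniform_reflection:
  assumes w [measurable]: "w \<in> space (euclidean_space_measure d)"
  shows "distr (sphere_uniform d) (sphere_uniform d) (reflection d w) = sphere_uniform d"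
proof (rule measure_eqI)
  fix A assume "A \<in> sets (distr (sphere_uniform d) (sphere_uniform d) (reflection d w))"
  then have A [measurable]: "A \<in> sets (euclidean_space_measure d)" by (simp add: sets_sphere_uniform)
  have "emeasure (distr (sphere_uniform d) (sphere_uniform d) (reflection d w)) A =
      (\<integral>\<^sup>+x. indicator A x \<partial>distr (sphere_uniform d) (sphere_uniform d) (reflection d w))"
    by (simp add: sets_sphere_uniform)
  also have "\<dots> = (\<integral>\<^sup>+x. indicator A (reflection d w x) \<partial>sphere_uniform d)"
    by (subst nn_integral_distr) (use w in measurable)
  also have "\<dots> = emeasure (sphere_uniform d) A"
    using w by (subst nn_integral_reflection_sphere) (auto simp: sets_sphere_uniform)
  finally show "emeasure (distr (sphere_uniform d) (sphere_uniform d) (reflection d w)) A =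
    emeasure (sphere_uniform d) A" .
qed simp

lemma integral_reflection_sphere:
  fixes F :: "(nat \<Rightarrow> real) \<Rightarrow> real"
  assumes w [measurable]: "w \<in> space (euclidean_space_measure d)"
    and F [measurable]: "F \<in> borel_measurable (euclidean_space_measure d)"
  shows "(\<integral>x. F (reflection d w x) \<partial>sphere_uniform d) = (\<integral>x. F x \<partial>sphere_uniform d)"
proof -
  have "(\<integral>x. F x \<partial>distr (sphere_uniform d) (sphere_uniform d) (reflection d w)) =
      (\<integral>x. F (reflection d w x) \<partial>sphere_uniform d)"
    by (rule integral_distr) (use w in measurable)
  then show ?thesis by (simp add: distr_sphere_uniform_reflection w)
qed

section \<open>Unit vectors and the invariance of inner product laws\<close>

definition unit_sphere :: "nat \<Rightarrow> (nat \<Rightarrow> real) set" where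
  "unit_sphere d = {x \<in> space (euclidean_space_measure d). inner_prod d x x = 1}"

definition basis_vector :: "nat \<Rightarrow> nat \<Rightarrow> (nat \<Rightarrow> real)" where
  "basis_vector d k = (\<lambda>i\<in>{..<d}. if i = k then 1 else 0)"

lemma unit_sphereD:
  assumes "x \<in> unit_sphere d"
  shows "x \<in> space (euclidean_space_measure d)" "inner_prod d x x = 1"
  using assms by (auto simp: unit_sphere_def)

lemma inner_prod_basis_vector: "k < d \<Longrightarrow> inner_prod d (basis_vector d k) x = x k"
  by (simp add: inner_prod_def basis_vector_def if_distrib[of "\<lambda>a. a * _"] cong: if_cong)

lemma basis_vector_in_unit_sphere: "k < d \<Longrightarrow> basis_vector d k \<in> unit_sphere d"
  by (simp add: unit_sphere_def inner_prod_basis_vector)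
     (simp add: basis_vector_def space_euclidean_space_measure)

lemma lincomb_in_unit_sphere:
  assumes "u \<in> unit_sphere d" "v \<in> unit_sphere d" "a\<^sup>2 + b\<^sup>2 + 2 * a * b * inner_prod d u v = 1"
  shows "lincomb d a u b v \<in> unit_sphere d"
  using assms
  by (simp add: unit_sphere_def inner_prod_lincomb inner_prod_commute[of d v u] power2_eq_square algebra_simps)

lemma AE_unit_sphere:
  assumes "d \<ge> 1"
  shows "AE x in sphere_uniform d. x \<in> unit_sphere d"
  using sphere_uniform_on_sphere[OF assms]
  by (simp add: unit_sphere_def space_sphere_uniform[symmetric])

lemma inner_prod_Cauchy_Schwarz: "(inner_prod d x y)\<^sup>2 \<le> inner_prod d x x * inner_prod d y y"
  using Cauchy_Schwarz_ineq_sum[of x y "{..<d}"] by (simp add: inner_prod_def power2_eq_square)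

lemma abs_inner_prod_le_1:
  assumes "u \<in> unit_sphere d" "v \<in> unit_sphere d"
  shows "\<bar>inner_prod d u v\<bar> \<le> 1"
  using inner_prod_Cauchy_Schwarz[of d u v] assms by (simp add: unit_sphere_def abs_square_le_1)

text \<open>The mirror is the perpendicular bisector of \<open>u\<close> and \<open>v\<close>: with
  w = u - v one has \<langle>w, w\<rangle> = 2 \<langle>u, w\<rangle> for unit vectors, so the full
  difference is subtracted from \<open>u\<close>. If \<langle>u, v\<rangle> = 1, then w vanishes and
  the two vectors coincide.\<close>

lemma reflection_swap:
  assumes u: "u \<in> unit_sphere d" and v: "v \<in> unit_sphere d"
  shows "reflection d (lincomb d 1 u (- 1) v) u = v"
proof
  fix k
  define w where "w = lincomb d 1 u (- 1) v"
  have ww: "inner_prod d w w = 2 - 2 * inner_prod d u v" and uw: "inner_prod d u w = 1 - inner_prod d u v"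
    using u v by (simp_all add: w_def inner_prod_lincomb unit_sphere_def inner_prod_commute[of d v u])
  have R: "reflection d w u k = u k - 2 * inner_prod d u w / inner_prod d w w * (u k - v k)" if "k < d"
    using that by (simp add: reflection_def lincomb_def w_def)
  have "u k - v k = 0" if "inner_prod d u v = 1" "k < d"
    using ww that inner_prod_self_eq_0[of d w] by (auto simp: w_def lincomb_def)
  then have "reflection d w u k = v k" if "k < d"
    using R that ww uw by (cases "inner_prod d u v = 1") (auto simp: field_simps)
  moreover have "reflection d w u k = v k" if "\<not> k < d"
    using that unit_sphereD(1)[OF v]
    by (auto simp: reflection_def lincomb_def space_euclidean_space_measure PiE_def extensional_def)
  ultimately show "reflection d (lincomb d 1 u (- 1) v) u k = v k"
    unfolding w_def by blast
qed

lemma measurable_inner_prod_left [measurable]: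
  assumes "u \<in> space (euclidean_space_measure d)"
  shows "inner_prod d u \<in> borel_measurable (euclidean_space_measure d)"
  using assms measurable_inner_prod[OF measurable_const measurable_ident] by (simp add: id_def)

text \<open>The reflection that swaps \<open>u\<close> and \<open>v\<close> is self-adjoint and
  preserves the sphere measure. From here on, a law of \<langle>u, y\<rangle> may be computed at
  whichever unit vector, or average over unit vectors, is convenient.\<close>

lemma integral_inner_prod_unit_eq:
  fixes \<phi> :: "real \<Rightarrow> real"
  assumes u: "u \<in> unit_sphere d" and v: "v \<in> unit_sphere d" and \<phi> [measurable]: "\<phi> \<in> borel_measurable borel"
  shows "(\<integral>y. \<phi> (inner_prod d u y) \<partial>sphere_uniform d) = (\<integral>y. \<phi> (inner_prod d v y) \<partial>sphere_uniform d)"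
proof -
  define w where "w = lincomb d 1 u (- 1) v"
  note [measurable] = unit_sphereD(1)[OF u] unit_sphereD(1)[OF v]
  have "inner_prod d v y = inner_prod d u (reflection d w y)" for y
    using reflection_swap[OF u v] by (simp add: w_def inner_prod_reflection_left[symmetric])
  then have "(\<integral>y. \<phi> (inner_prod d v y) \<partial>sphere_uniform d) =
      (\<integral>y. \<phi> (inner_prod d u (reflection d w y)) \<partial>sphere_uniform d)"
    by simp
  also have "\<dots> = (\<integral>y. \<phi> (inner_prod d u y) \<partial>sphere_uniform d)"
    by (rule integral_reflection_sphere) (simp_all add: w_def)
  finally show ?thesis ..
qed

subsection \<open>Moments of a coordinate\<close>

lemma integrable_sphere_bounded:
  fixes F :: "(nat \<Rightarrow> real) \<Rightarrow> real"
  assumes "d \<ge> 1" and "F \<in> borel_measurable (euclidean_space_measure d)"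
    and "\<And>y. y \<in> unit_sphere d \<Longrightarrow> \<bar>F y\<bar> \<le> B"
  shows "integrable (sphere_uniform d) F"
proof -
  interpret prob_space "sphere_uniform d" by (rule prob_space_sphere_uniform)
  show ?thesis
    using AE_unit_sphere[OF assms(1)] assms(2)
    by (intro integrable_const_bound[of _ B])
       (auto elim!: eventually_mono intro: assms(3) simp: measurable_cong_sets[OF sets_sphere_uniform refl])
qed

lemma integral_sphere_mono:
  fixes F G :: "(nat \<Rightarrow> real) \<Rightarrow> real"
  assumes "d \<ge> 1" "integrable (sphere_uniform d) F" "integrable (sphere_uniform d) G"
    and "\<And>y. y \<in> unit_sphere d \<Longrightarrow> F y \<le> G y"
  shows "(\<integral>y. F y \<partial>sphere_uniform d) \<le> (\<integral>y. G y \<partial>sphere_uniform d)"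
  using AE_unit_sphere[OF assms(1)] assms(2-)
  by (intro integral_mono_AE) (auto elim!: eventually_mono)

lemma integral_sphere_cong:
  fixes F G :: "(nat \<Rightarrow> real) \<Rightarrow> real"
  assumes "d \<ge> 1" and [measurable]: "F \<in> borel_measurable (euclidean_space_measure d)"
    "G \<in> borel_measurable (euclidean_space_measure d)"
    and "\<And>y. y \<in> unit_sphere d \<Longrightarrow> F y = G y"
  shows "(\<integral>y. F y \<partial>sphere_uniform d) = (\<integral>y. G y \<partial>sphere_uniform d)"
  using AE_unit_sphere[OF assms(1)] assms(4)
  by (intro integral_cong_AE) (auto elim!: eventually_mono)

lemma integrable_inner_prod_power:
  assumes "d \<ge> 1" and u: "u \<in> unit_sphere d"
  shows "integrable (sphere_uniform d) (\<lambda>y. inner_prod d u y ^ k)"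
proof (rule integrable_sphere_bounded[OF assms(1), where B = 1])
  fix y assume "y \<in> unit_sphere d"
  then show "\<bar>inner_prod d u y ^ k\<bar> \<le> 1"
    unfolding power_abs by (intro power_le_one abs_inner_prod_le_1 u) auto
qed (use unit_sphereD(1)[OF u] in measurable)

lemma integral_inner_prod_unit_eq_0:
  assumes u: "u \<in> unit_sphere d"
  shows "(\<integral>y. inner_prod d u y \<partial>sphere_uniform d) = 0"
proof -
  note [measurable] = unit_sphereD(1)[OF u]
  have "inner_prod d u (reflection d u y) = - inner_prod d u y" for y
    using u by (simp add: reflection_def inner_prod_lincomb unit_sphere_def inner_prod_commute[of d y u])
  then have "(\<integral>y. - inner_prod d u y \<partial>sphere_uniform d) = (\<integral>y. inner_prod d u (reflection d u y) \<partial>sphere_uniform d)"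
    by simp
  also have "\<dots> = (\<integral>y. inner_prod d u y \<partial>sphere_uniform d)"
    by (rule integral_reflection_sphere) (use unit_sphereD[OF u] in simp_all)
  finally show ?thesis by simp
qed

text \<open>All coordinates have the same second moment, and on the sphere their squares add up to
  1.\<close>

lemma integral_inner_prod_unit_square:
  assumes d: "d \<ge> 1" and u: "u \<in> unit_sphere d"
  shows "(\<integral>y. (inner_prod d u y)\<^sup>2 \<partial>sphere_uniform d) = 1 / real d"
proof -
  interpret prob_space "sphere_uniform d" by (rule prob_space_sphere_uniform)
  have k: "(\<integral>y. (y k)\<^sup>2 \<partial>sphere_uniform d) = (\<integral>y. (inner_prod d u y)\<^sup>2 \<partial>sphere_uniform d)" if "k < d" for k
    using integral_inner_prod_unit_eq[OF basis_vector_in_unit_sphere[OF that] u, of "\<lambda>x. x\<^sup>2"] that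
    by (simp add: inner_prod_basis_vector)
  have int: "integrable (sphere_uniform d) (\<lambda>y. (y k)\<^sup>2)" if "k < d" for k
  proof (rule integrable_sphere_bounded[OF d, where B = 1])
    fix y assume "y \<in> unit_sphere d"
    then show "\<bar>(y k)\<^sup>2\<bar> \<le> 1"
      using abs_inner_prod_le_1[OF basis_vector_in_unit_sphere[OF that]] that
      by (simp add: inner_prod_basis_vector abs_square_le_1)
  qed (use that in measurable)
  have "1 = (\<integral>y. (1::real) \<partial>sphere_uniform d)" by (simp add: prob_space)
  also have "\<dots> = (\<integral>y. (\<Sum>k<d. (y k)\<^sup>2) \<partial>sphere_uniform d)"
    by (rule integral_sphere_cong[OF d]) (auto simp: unit_sphere_def inner_prod_def power2_eq_square)
  also have "\<dots> = (\<Sum>k<d. \<integral>y. (y k)\<^sup>2 \<partial>sphere_uniform d)"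
    by (rule Bochner_Integration.integral_sum) (auto intro: int)
  also have "\<dots> = real d * (\<integral>y. (inner_prod d u y)\<^sup>2 \<partial>sphere_uniform d)"
    by (simp add: k)
  finally show ?thesis using d by (simp add: field_simps)
qed

text \<open>Hoeffding's lemma for a fair two-valued variable of range 2 x gives cosh x \<le> exp
  (x^2 / 2); evenness covers negative x.\<close>

lemma exp_plus_exp_minus_le:
  fixes x :: real
  shows "exp x + exp (- x) \<le> 2 * exp (x\<^sup>2 / 2)"
proof -
  have "exp x + exp (- x) \<le> 2 * exp (x\<^sup>2 / 2)" if "x \<ge> 0" for x :: real
  proof -
    have "- (2 * x) * (1 / 2) + ln (1 + 1 / 2 * (exp (2 * x) - 1)) \<le> (2 * x)\<^sup>2 / 8"
      using that by (intro Hoeffdings_lemma_aux) auto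
    then have "ln ((1 + exp (2 * x)) / 2) \<le> x + x\<^sup>2 / 2"
      by (simp add: field_simps power2_eq_square)
    then have "exp (ln ((1 + exp (2 * x)) / 2)) \<le> exp (x + x\<^sup>2 / 2)"
      by simp
    then have "(1 + exp (2 * x)) / 2 \<le> exp (x + x\<^sup>2 / 2)"
      by (simp add: add_pos_pos)
    then have "(1 + exp (2 * x)) * exp (- x) \<le> 2 * exp (x + x\<^sup>2 / 2) * exp (- x)"
      by (intro mult_right_mono) auto
    moreover have "(1 + exp (2 * x)) * exp (- x) = exp x + exp (- x)"
      by (simp add: distrib_right mult_exp_exp)
    moreover have "2 * exp (x + x\<^sup>2 / 2) * exp (- x) = 2 * exp (x\<^sup>2 / 2)"
      by (simp only: mult.assoc mult_exp_exp) simp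
    ultimately show ?thesis by simp
  qed
  from this[of x] this[of "- x"] show ?thesis by (cases "x \<ge> 0") (auto simp: add.commute)
qed

text \<open>Averaging over the \<open>2\<^sup>d\<close> unit vectors with all coordinates equal to \<open>\<plusminus> 1 / sqrt d\<close>.\<close>
lemma integral_exp_inner_prod_unit_le:
  assumes d: "d \<ge> 1" and u: "u \<in> unit_sphere d"
  shows "(\<integral>y. exp (l * sqrt (real d) * inner_prod d u y) \<partial>sphere_uniform d) \<le> exp (l\<^sup>2 / 2)"
proof -
  interpret prob_space "sphere_uniform d" by (rule prob_space_sphere_uniform)
  define sgn where "sgn = (\<lambda>(A :: nat set) k. if k \<in> A then 1 else - 1 :: real)"
  define z where "z = (\<lambda>A. \<lambda>k\<in>{..<d}. sgn A k / sqrt (real d))"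
  have "sgn A k * sgn A k = 1" for A k by (simp add: sgn_def)
  then have z: "z A \<in> unit_sphere d" for A
    using d by (simp add: z_def unit_sphere_def inner_prod_def space_euclidean_space_measure)
  have zin: "l * sqrt (real d) * inner_prod d (z A) y = (\<Sum>k<d. l * sgn A k * y k)" for A y
    using d by (simp add: z_def inner_prod_def sum_distrib_left mult.assoc)
  let ?M = "\<integral>y. exp (l * sqrt (real d) * inner_prod d u y) \<partial>sphere_uniform d"
  have M: "?M = (\<integral>y. exp (\<Sum>k<d. l * sgn A k * y k) \<partial>sphere_uniform d)" for A
    using integral_inner_prod_unit_eq[OF u z[of A], of "\<lambda>s. exp (l * sqrt (real d) * s)"] by (simp add: zin)
  have int: "integrable (sphere_uniform d) (\<lambda>y. exp (\<Sum>k<d. l * sgn A k * y k))" for A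
  proof (rule integrable_sphere_bounded[OF d, where B = "exp (\<bar>l\<bar> * sqrt (real d))"])
    fix y assume "y \<in> unit_sphere d"
    then have "\<bar>l\<bar> * sqrt (real d) * \<bar>inner_prod d (z A) y\<bar> \<le> \<bar>l\<bar> * sqrt (real d) * 1"
      by (intro mult_left_mono abs_inner_prod_le_1 z) auto
    then have "\<bar>l * sqrt (real d) * inner_prod d (z A) y\<bar> \<le> \<bar>l\<bar> * sqrt (real d)"
      by (simp add: abs_mult)
    then show "\<bar>exp (\<Sum>k<d. l * sgn A k * y k)\<bar> \<le> exp (\<bar>l\<bar> * sqrt (real d))"
      by (simp add: zin)
  qed measurable
  \<comment> \<open>The signs of different coordinates are chosen independently, so the sum over all
    sign patterns factorises.\<close>
  have expand: "(\<Sum>A\<in>Pow {..<d}. exp (\<Sum>k<d. l * sgn A k * y k)) = (\<Prod>k<d. exp (l * y k) + exp (- (l * y k)))" for y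
  proof -
    have "exp (\<Sum>k<d. l * sgn A k * y k) = (\<Prod>k\<in>A. exp (l * y k)) * (\<Prod>k\<in>{..<d} - A. exp (- (l * y k)))"
      if "A \<subseteq> {..<d}" for A
    proof -
      have "(\<Sum>k<d. l * sgn A k * y k) = (\<Sum>k\<in>A. l * y k) + (\<Sum>k\<in>{..<d} - A. - (l * y k))"
        using that by (subst sum.subset_diff[OF that]) (auto simp: sgn_def add.commute intro!: arg_cong2[of _ _ _ _ "(+)"] sum.cong)
      then show ?thesis
        using finite_subset[OF that] by (simp only: exp_add exp_sum finite_lessThan finite_Diff)
    qed
    then show ?thesis by (subst prod_add) auto
  qed
  have "2 ^ d * ?M = (\<Sum>A\<in>Pow {..<d}. ?M)" by (simp add: card_Pow)
  also have "\<dots> = (\<Sum>A\<in>Pow {..<d}. \<integral>y. exp (\<Sum>k<d. l * sgn A k * y k) \<partial>sphere_uniform d)"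
    by (intro sum.cong M refl)
  also have "\<dots> = (\<integral>y. (\<Sum>A\<in>Pow {..<d}. exp (\<Sum>k<d. l * sgn A k * y k)) \<partial>sphere_uniform d)"
    by (rule Bochner_Integration.integral_sum[symmetric]) (rule int)
  also have "\<dots> \<le> (\<integral>y. 2 ^ d * exp (l\<^sup>2 / 2) \<partial>sphere_uniform d)"
  proof (rule integral_sphere_mono[OF d])
    fix y assume y: "y \<in> unit_sphere d"
    have "(\<Prod>k<d. exp (l * y k) + exp (- (l * y k))) \<le> (\<Prod>k<d. 2 * exp ((l * y k)\<^sup>2 / 2))"
      by (intro prod_mono conjI exp_plus_exp_minus_le) (simp add: add_nonneg_nonneg)
    also have "\<dots> = 2 ^ d * exp (\<Sum>k<d. (l * y k)\<^sup>2 / 2)"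
      by (simp add: prod.distrib exp_sum)
    also have "(\<Sum>k<d. (l * y k)\<^sup>2 / 2) = l\<^sup>2 / 2 * inner_prod d y y"
      by (simp add: inner_prod_def sum_distrib_left power2_eq_square mult_ac)
    finally show "(\<Sum>A\<in>Pow {..<d}. exp (\<Sum>k<d. l * sgn A k * y k)) \<le> 2 ^ d * exp (l\<^sup>2 / 2)"
      using y by (simp add: expand unit_sphere_def)
  qed (auto intro: int)
  also have "\<dots> = 2 ^ d * exp (l\<^sup>2 / 2)" by (simp add: prob_space)
  finally show ?thesis by simp
qed

text \<open>From t^2 / 2 \<le> exp t at t = x / 2, squared: this is where 64 = 8^2 comes
  from.\<close>

lemma power4_le_exp:
  fixes x :: real
  shows "x ^ 4 \<le> 64 * (exp x + exp (- x))"
proof -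
  have "x ^ 4 \<le> 64 * exp x" if "x \<ge> 0" for x :: real
  proof -
    have "1 + x / 2 + (x / 2)\<^sup>2 / 2 \<le> exp (x / 2)" using that by (intro exp_lower_Taylor_quadratic) auto
    then have "x\<^sup>2 / 8 \<le> exp (x / 2)" using that by (simp add: power2_eq_square)
    then have "(x\<^sup>2 / 8)\<^sup>2 \<le> (exp (x / 2))\<^sup>2" by (intro power_mono) auto
    then show ?thesis by (simp add: power2_eq_square power4_eq_xxxx mult_exp_exp)
  qed
  from this[of x] this[of "- x"] show ?thesis
    by (cases "x \<ge> 0") (auto intro: order_trans simp: add_increasing add_increasing2)
qed

text \<open>The exponential moments of sqrt d \<langle>u, y\<rangle> at l = 1 and l = -1 dominate
  its fourth moment; 256 = 64 * 2 * 2 uses exp (1/2) \<le> 2.\<close>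

lemma integral_inner_prod_unit_power4_le:
  assumes d: "d \<ge> 1" and u: "u \<in> unit_sphere d"
  shows "(\<integral>y. (inner_prod d u y) ^ 4 \<partial>sphere_uniform d) \<le> 256 / (real d)\<^sup>2"
proof -
  note [measurable] = unit_sphereD(1)[OF u]
  let ?s = "\<lambda>y. sqrt (real d) * inner_prod d u y"
  have int: "integrable (sphere_uniform d) (\<lambda>y. \<phi> (inner_prod d u y))"
    if "continuous_on UNIV \<phi>" for \<phi> :: "real \<Rightarrow> real"
  proof -
    have "bounded (\<phi> ` {-1..1})"
      using that by (intro compact_imp_bounded compact_continuous_image continuous_on_subset[OF that]) auto
    then obtain B where "\<forall>z\<in>\<phi> ` {-1..1}. norm z \<le> B" unfolding bounded_iff by blast
    then have B: "\<And>x. x \<in> {-1..1} \<Longrightarrow> \<bar>\<phi> x\<bar> \<le> B" by simp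
    have [measurable]: "\<phi> \<in> borel_measurable borel" using that by (rule borel_measurable_continuous_onI)
    show ?thesis
    proof (rule integrable_sphere_bounded[OF d, where B = B])
      fix y assume "y \<in> unit_sphere d"
      from abs_inner_prod_le_1[OF u this] show "\<bar>\<phi> (inner_prod d u y)\<bar> \<le> B"
        by (intro B) auto
    qed measurable
  qed
  have i4: "integrable (sphere_uniform d) (\<lambda>y. (?s y) ^ 4)"
    by (intro int[where \<phi> = "\<lambda>s. (sqrt (real d) * s) ^ 4"] continuous_intros)
  have i_exp: "integrable (sphere_uniform d) (\<lambda>y. exp (?s y))"
    by (intro int[where \<phi> = "\<lambda>s. exp (sqrt (real d) * s)"] continuous_intros)
  have i_exp_minus: "integrable (sphere_uniform d) (\<lambda>y. exp (- ?s y))"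
    by (intro int[where \<phi> = "\<lambda>s. exp (- (sqrt (real d) * s))"] continuous_intros)
  have "(real d)\<^sup>2 * (\<integral>y. (inner_prod d u y) ^ 4 \<partial>sphere_uniform d) = (\<integral>y. (?s y) ^ 4 \<partial>sphere_uniform d)"
    by (simp add: power_mult_distrib power4_eq_xxxx[of "sqrt _"] power2_eq_square mult.assoc[symmetric])
  also have "\<dots> \<le> (\<integral>y. 64 * (exp (?s y) + exp (- ?s y)) \<partial>sphere_uniform d)"
    using i4 i_exp i_exp_minus by (intro integral_sphere_mono[OF d] power4_le_exp) auto
  also have "\<dots> = 64 * ((\<integral>y. exp (1 * sqrt (real d) * inner_prod d u y) \<partial>sphere_uniform d)
      + (\<integral>y. exp (- 1 * sqrt (real d) * inner_prod d u y) \<partial>sphere_uniform d))"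
    using i_exp i_exp_minus by simp
  also have "\<dots> \<le> 64 * (exp (1 / 2) + exp (1 / 2))"
    using integral_exp_inner_prod_unit_le[OF d u, of 1] integral_exp_inner_prod_unit_le[OF d u, of "-1"]
    by (intro mult_left_mono add_mono) auto
  also have "\<dots> \<le> 256"
    using exp_half_le2 by simp
  finally show ?thesis using d by (simp add: field_simps)
qed

text \<open>A second moment 1 / d together with a fourth moment of order at most 1 / d^2 forces a
  first absolute moment of order 1 / sqrt d, by interpolating x^2 between \<bar>x\<bar> and
  x^4.\<close>

lemma integral_abs_inner_prod_unit_ge:
  assumes d: "d \<ge> 1" and u: "u \<in> unit_sphere d"
  shows "(\<integral>y. \<bar>inner_prod d u y\<bar> \<partial>sphere_uniform d) \<ge> 1 / (64 * sqrt (real d))"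
proof -
  note [measurable] = unit_sphereD(1)[OF u]
  interpret prob_space "sphere_uniform d" by (rule prob_space_sphere_uniform)
  let ?s = "inner_prod d u"
  \<comment> \<open>The cut-off \<bar>x\<bar> sqrt d = 32 lets the x^4 term consume only 256 / 1024
    = 1/4 of the second moment, which leaves 3/4 for the term in \<bar>x\<bar>.\<close>
  have pw: "x\<^sup>2 \<le> 32 / sqrt (real d) * \<bar>x\<bar> + real d / 1024 * x ^ 4" for x :: real
  proof (cases "\<bar>x\<bar> * sqrt (real d) \<le> 32")
    case True
    then have "\<bar>x\<bar> * (\<bar>x\<bar> * sqrt (real d)) \<le> \<bar>x\<bar> * 32" by (intro mult_left_mono) auto
    then have "x\<^sup>2 * sqrt (real d) \<le> 32 * \<bar>x\<bar>"
      by (simp add: mult.assoc[symmetric] power2_eq_square)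
    then have "x\<^sup>2 \<le> 32 / sqrt (real d) * \<bar>x\<bar>"
      using d by (simp add: pos_le_divide_eq)
    then show ?thesis by (simp add: add_increasing2)
  next
    case False
    then have "32\<^sup>2 \<le> (\<bar>x\<bar> * sqrt (real d))\<^sup>2" by (intro power_mono) auto
    then have "1 * x\<^sup>2 \<le> (real d / 1024 * x\<^sup>2) * x\<^sup>2"
      by (intro mult_right_mono) (auto simp: power_mult_distrib mult.commute)
    then have "x\<^sup>2 \<le> real d / 1024 * x ^ 4" by (simp add: power4_eq_xxxx power2_eq_square mult.assoc)
    then show ?thesis by (simp add: add_increasing)
  qed
  note i = integrable_inner_prod_power[OF d u]
  have i1: "integrable (sphere_uniform d) (\<lambda>y. \<bar>?s y\<bar>)"
    using i[of 1] by simp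
  have "1 / real d = (\<integral>y. (?s y)\<^sup>2 \<partial>sphere_uniform d)"
    using integral_inner_prod_unit_square[OF d u] ..
  also have "\<dots> \<le> (\<integral>y. 32 / sqrt (real d) * \<bar>?s y\<bar> + real d / 1024 * (?s y) ^ 4 \<partial>sphere_uniform d)"
    using i1 i by (intro integral_mono pw) auto
  also have "\<dots> = 32 / sqrt (real d) * (\<integral>y. \<bar>?s y\<bar> \<partial>sphere_uniform d) + real d / 1024 * (\<integral>y. (?s y) ^ 4 \<partial>sphere_uniform d)"
    using i1 i by simp
  also have "\<dots> \<le> 32 / sqrt (real d) * (\<integral>y. \<bar>?s y\<bar> \<partial>sphere_uniform d) + real d / 1024 * (256 / (real d)\<^sup>2)"
    by (intro add_left_mono mult_left_mono integral_inner_prod_unit_power4_le d u) simp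
  also have "real d / 1024 * (256 / (real d)\<^sup>2) = 1 / 4 * (1 / real d)"
    using d by (simp add: power2_eq_square)
  finally have *: "3 / 4 * (1 / real d) \<le> 32 / sqrt (real d) * (\<integral>y. \<bar>?s y\<bar> \<partial>sphere_uniform d)"
    by simp
  have "1 / (64 * r) \<le> r / 32 * (3 / 4 * (1 / (r * r)))" if "r > 0" for r :: real
    using that by (simp add: field_simps)
  from this[of "sqrt (real d)"] have "1 / (64 * sqrt (real d)) \<le> sqrt (real d) / 32 * (3 / 4 * (1 / real d))"
    using d by simp
  also have "\<dots> \<le> sqrt (real d) / 32 * (32 / sqrt (real d) * (\<integral>y. \<bar>?s y\<bar> \<partial>sphere_uniform d))"
    using * by (intro mult_left_mono) auto
  also have "\<dots> = (\<integral>y. \<bar>?s y\<bar> \<partial>sphere_uniform d)" using d by simp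
  finally show ?thesis .
qed

subsection \<open>The threshold\<close>

text \<open>A coordinate hyperplane is Lebesgue-null, and radial projection preserves non-zero
  coordinates. For \<open>k = 0\<close> this excludes the points \<open>y\<close> whose inner
  product with a point moving along the great circle is constant.\<close>

lemma AE_sphere_coordinate_nonzero:
  assumes k: "k < d"
  shows "AE y in sphere_uniform d. y k \<noteq> 0"
proof -
  let ?E = "euclidean_space_measure d"
  interpret product_sigma_finite "\<lambda>_. lborel :: real measure" by standard
  let ?Z = "PiE {..<d} (\<lambda>i. if i = k then {0} else UNIV :: real set)"
  have meas: "?Z \<in> sets ?E"
    unfolding euclidean_space_measure_def by (intro sets_PiM_I_finite) auto
  have "emeasure ?E ?Z = (\<Prod>i<d. emeasure lborel (if i = k then {0} else UNIV :: real set))"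
    unfolding euclidean_space_measure_def by (subst emeasure_PiM) auto
  also have "\<dots> = 0" using k by (auto intro!: prod_zero bexI[of _ k])
  finally have "AE x in ?E. x \<notin> ?Z"
    using meas by (intro AE_not_in null_setsI) auto
  then have "AE x in ?E. x k \<noteq> 0"
  proof (rule AE_mp, intro AE_I2 impI)
    fix x assume x: "x \<in> space ?E" "x \<notin> ?Z"
    then show "x k \<noteq> 0"
      by (auto simp: space_euclidean_space_measure PiE_iff split: if_splits)
  qed
  moreover have "radial_projection d x k \<noteq> 0" if "x k \<noteq> 0" for x
    using that k inner_prod_self_eq_0[of d x] by (auto simp: radial_projection_def)
  ultimately have "AE x in ?E. radial_projection d x k \<noteq> 0"
    by (auto elim: AE_mp)
  then have "AE x in uniform_measure ?E (unit_ball d). radial_projection d x k \<noteq> 0"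
    by (intro AE_uniform_measureI) auto
  then show ?thesis
    unfolding sphere_uniform_def using k
    by (subst AE_distr_iff) (simp_all cong: measurable_cong_sets)
qed

section \<open>Great circles and sinusoids\<close>

definition circle_point :: "nat \<Rightarrow> real \<Rightarrow> (nat \<Rightarrow> real)" where
  "circle_point d a = lincomb d (cos a) (basis_vector d 0) (sin a) (basis_vector d 1)"

lemma inner_prod_circle_point:
  "d \<ge> 2 \<Longrightarrow> inner_prod d (circle_point d a) y = y 0 * cos a + y 1 * sin a"
  by (simp add: circle_point_def inner_prod_lincomb inner_prod_basis_vector mult.commute)

lemma inner_prod_circle_point_circle_point:
  assumes "d \<ge> 2"
  shows "inner_prod d (circle_point d a) (circle_point d b) = cos (a - b)"
proof -
  have "circle_point d b 0 = cos b" "circle_point d b 1 = sin b"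
    using assms by (simp_all add: circle_point_def lincomb_def basis_vector_def)
  then show ?thesis using assms by (simp add: inner_prod_circle_point cos_diff mult.commute)
qed

lemma circle_point_in_unit_sphere: "d \<ge> 2 \<Longrightarrow> circle_point d a \<in> unit_sphere d"
  by (simp add: unit_sphere_def inner_prod_circle_point_circle_point) (simp add: circle_point_def)

text \<open>Separates the gap \<open>b - a\<close>, whose sine has a known sign, from a sinusoid at
  the midpoint. Both later facts about sinusoids compare such midpoint factors.\<close>

lemma sinusoid_diff:
  fixes A B a b :: real
  shows "(A * cos a + B * sin a) - (A * cos b + B * sin b) =
    2 * sin ((b - a) / 2) * (A * sin ((a + b) / 2) - B * cos ((a + b) / 2))"
proof -
  have "sin ((a - b) / 2) = - sin ((b - a) / 2)"
    by (metis minus_diff_eq minus_divide_left sin_minus)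
  then have "cos a - cos b = 2 * sin ((b - a) / 2) * sin ((a + b) / 2)"
      "sin a - sin b = - (2 * sin ((b - a) / 2) * cos ((a + b) / 2))"
    by (simp_all add: cos_diff_cos sin_diff_sin mult_ac)
  moreover have "(A * cos a + B * sin a) - (A * cos b + B * sin b) = A * (cos a - cos b) + B * (sin a - sin b)"
    by (simp add: algebra_simps)
  ultimately show ?thesis by (simp only:) (simp add: algebra_simps)
qed

text \<open>Two equalities of values say that two midpoint factors vanish. This is a linear system
  for A and B with determinant sin ((c - b) / 2), which is non-zero for distinct points of the unit
  interval.\<close>

lemma sinusoid_eq_at_three_points:
  fixes A B t a b c :: real
  assumes eq: "A * cos a + B * sin a = t" "A * cos b + B * sin b = t" "A * cos c + B * sin c = t"
    and "a \<in> {0..1}" "b \<in> {0..1}" "c \<in> {0..1}" and "a \<noteq> b" "a \<noteq> c" "b \<noteq> c"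
  shows "A = 0" "B = 0"
proof -
  have pi: "pi > 1" using pi_gt3 by linarith
  have sin_nz: "sin ((y - x) / 2) \<noteq> 0" if "x \<in> {0..1}" "y \<in> {0..1}" "x \<noteq> y" for x y :: real
    using sin_eq_0_pi[of "(y - x) / 2"] that pi by (auto simp: field_simps)
  define m where "m = (a + b) / 2"
  define m' where "m' = (a + c) / 2"
  have "A * sin m = B * cos m"
    using sinusoid_diff[of A a B b] sin_nz[of a b] assms by (simp add: m_def)
  moreover have "A * sin m' = B * cos m'"
    using sinusoid_diff[of A a B c] sin_nz[of a c] assms by (simp add: m'_def)
  ultimately have "A * (sin m' * cos m - cos m' * sin m) = 0" "B * (sin m' * cos m - cos m' * sin m) = 0"
    by algebra+
  moreover have "sin m' * cos m - cos m' * sin m = sin ((c - b) / 2)"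
    by (simp add: sin_diff[symmetric] m_def m'_def diff_divide_distrib[symmetric])
  ultimately show "A = 0" "B = 0" using sin_nz[of b c] assms by auto
qed

lemma three_distinct_elements:
  assumes "card S \<ge> 3"
  obtains a b c where "a \<in> S" "b \<in> S" "c \<in> S" "a \<noteq> b" "a \<noteq> c" "b \<noteq> c"
  using assms by (auto simp: numeral_3_eq_3 card_le_Suc_iff)

text \<open>For N points e on an arc of the great circle, the N events \<langle>e, y\<rangle> = t
  are equally likely, and almost surely at most two of them occur. Hence N P \<le> 2 for every N,
  which leaves only P = 0.\<close>

lemma integral_inner_prod_unit_atom:
  assumes d: "d \<ge> 2" and u: "u \<in> unit_sphere d"
  shows "(\<integral>y. indicat_real {t} (inner_prod d u y) \<partial>sphere_uniform d) = 0"
proof -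
  interpret prob_space "sphere_uniform d" by (rule prob_space_sphere_uniform)
  let ?e = "circle_point d"
  note e = circle_point_in_unit_sphere[OF d]
  note ee = inner_prod_circle_point[OF d]
  note [measurable] = unit_sphereD(1)[OF e]
  let ?P = "\<integral>y. indicat_real {t} (inner_prod d u y) \<partial>sphere_uniform d"
  have int: "integrable (sphere_uniform d) (\<lambda>y. indicat_real {t} (inner_prod d (?e a) y))" for a
    using d by (intro integrable_sphere_bounded[where B = 1]) (auto simp: indicator_def)
  have "real N * ?P \<le> 2" for N
  proof -
    have "real N * ?P = (\<Sum>j<N. \<integral>y. indicat_real {t} (inner_prod d (?e (real j / real N)) y) \<partial>sphere_uniform d)"
      using integral_inner_prod_unit_eq[OF u e, of "indicat_real {t}"] by simp
    also have "\<dots> = (\<integral>y. (\<Sum>j<N. indicat_real {t} (inner_prod d (?e (real j / real N)) y)) \<partial>sphere_uniform d)"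
      by (rule Bochner_Integration.integral_sum[symmetric]) (rule int)
    also have "\<dots> \<le> (\<integral>y. 2 \<partial>sphere_uniform d)"
    proof (rule integral_mono_AE)
      show "AE y in sphere_uniform d. (\<Sum>j<N. indicat_real {t} (inner_prod d (?e (real j / real N)) y)) \<le> 2"
        using AE_sphere_coordinate_nonzero[of 0 d]
      proof (rule AE_mp[OF _ AE_I2], safe)
        fix y :: "nat \<Rightarrow> real" assume y: "y 0 \<noteq> 0"
        let ?J = "{j \<in> {..<N}. inner_prod d (?e (real j / real N)) y = t}"
        have "card ?J \<le> 2"
        proof (rule ccontr)
          assume "\<not> card ?J \<le> 2"
          then have "card ?J \<ge> 3" by simp
          then obtain a b c where "a \<in> ?J" "b \<in> ?J" "c \<in> ?J" "a \<noteq> b" "a \<noteq> c" "b \<noteq> c"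
            by (rule three_distinct_elements)
          then show False
            using sinusoid_eq_at_three_points(1)[of "y 0" "real a / real N" "y 1" t "real b / real N" "real c / real N"] y
            by (auto simp: ee field_simps)
        qed
        moreover have "(\<Sum>j<N. indicat_real {t} (inner_prod d (?e (real j / real N)) y)) = real (card ?J)"
          by (simp add: indicator_def sum.If_cases Int_def)
        ultimately show "(\<Sum>j<N. indicat_real {t} (inner_prod d (?e (real j / real N)) y)) \<le> 2"
          by simp
      qed (use d in auto)
    qed (auto intro: int)
    also have "\<dots> = 2" by (simp add: prob_space)
    finally show ?thesis .
  qed
  moreover have "?P \<ge> 0" by simp
  ultimately show ?thesis
    using reals_Archimedean3[of ?P] by (metis less_eq_real_def not_less)
qed

text \<open>Without atoms the distribution function is continuous, so the intermediate value theorem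
  applies; the endpoints -2 and 2 lie strictly outside the range of \<langle>u, y\<rangle>.\<close>

lemma integral_inner_prod_unit_ge_exists:
  assumes d: "d \<ge> 2" and u: "u \<in> unit_sphere d" and p: "0 < p" "p < 1"
  shows "\<exists>t. (\<integral>y. indicat_real {t..} (inner_prod d u y) \<partial>sphere_uniform d) = p"
proof -
  interpret S: prob_space "sphere_uniform d" by (rule prob_space_sphere_uniform)
  note [measurable] = unit_sphereD(1)[OF u]
  define \<nu> where "\<nu> = distr (sphere_uniform d) borel (inner_prod d u)"
  interpret \<nu>: real_distribution \<nu> unfolding \<nu>_def by (intro S.real_distribution_distr) measurable
  have meas: "measure \<nu> A = (\<integral>y. indicat_real A (inner_prod d u y) \<partial>sphere_uniform d)" if [measurable]: "A \<in> sets borel" for A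
  proof -
    have "measure \<nu> A = (\<integral>x. indicat_real A x \<partial>\<nu>)" by simp
    also have "\<dots> = (\<integral>y. indicat_real A (inner_prod d u y) \<partial>sphere_uniform d)"
      unfolding \<nu>_def by (rule integral_distr) measurable
    finally show ?thesis .
  qed
  have atom: "measure \<nu> {t} = 0" for t
    using integral_inner_prod_unit_atom[OF d u] by (simp add: meas)
  have cdf: "cdf \<nu> s = (\<integral>y. indicat_real {..s} (inner_prod d u y) \<partial>sphere_uniform d)" for s
    unfolding cdf_def by (rule meas) simp
  have "cdf \<nu> (- 2) = (\<integral>y. 0 \<partial>sphere_uniform d)"
    unfolding cdf using abs_inner_prod_le_1[OF u] d
    by (intro integral_sphere_cong) (force simp: indicator_def)+
  moreover have "cdf \<nu> 2 = (\<integral>y. 1 \<partial>sphere_uniform d)"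
    unfolding cdf using abs_inner_prod_le_1[OF u] d
    by (intro integral_sphere_cong) (force simp: indicator_def)+
  ultimately have "\<exists>t. - 2 \<le> t \<and> t \<le> 2 \<and> cdf \<nu> t = 1 - p"
    using p by (intro IVT) (auto simp: \<nu>.isCont_cdf atom S.prob_space)
  then obtain t where t: "cdf \<nu> t = 1 - p" by blast
  have "{..t} = {..<t} \<union> {t}" by auto
  then have "measure \<nu> {..<t} = 1 - p"
    using t atom[of t] \<nu>.finite_measure_Union[of "{..<t}" "{t}"] by (simp add: cdf_def)
  moreover have "measure \<nu> {t..} = 1 - measure \<nu> {..<t}"
    using \<nu>.prob_compl[of "{..<t}"] by (simp add: Compl_eq_Diff_UNIV[symmetric])
  ultimately show ?thesis by (intro exI[of _ t]) (simp add: meas)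
qed

lemma integral_indicator_inner_prod:
  assumes "u \<in> unit_sphere d" and "A \<in> sets borel"
  shows "(\<integral>y. indicat_real A (inner_prod d u y) \<partial>sphere_uniform d) =
    measure (sphere_uniform d) {y \<in> space (sphere_uniform d). inner_prod d u y \<in> A}"
proof -
  note [measurable] = unit_sphereD(1)[OF assms(1)] assms(2)
  have "(\<integral>y. indicat_real A (inner_prod d u y) \<partial>sphere_uniform d) =
      (\<integral>y. indicat_real {y \<in> space (sphere_uniform d). inner_prod d u y \<in> A} y \<partial>sphere_uniform d)"
    by (intro Bochner_Integration.integral_cong) (auto simp: indicator_def)
  also have "\<dots> = measure (sphere_uniform d) {y \<in> space (sphere_uniform d). inner_prod d u y \<in> A}"
  proof -
    interpret prob_space "sphere_uniform d" by (rule prob_space_sphere_uniform)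
    have "{y \<in> space (sphere_uniform d). inner_prod d u y \<in> A} \<in> sets (sphere_uniform d)" by measurable
    then show ?thesis by simp
  qed
  finally show ?thesis .
qed

text \<open>
  If \<open>\<langle>u, y\<rangle>\<close> almost surely avoids \<open>{a..<b}\<close>, then so does \<open>\<langle>w, y\<rangle>\<close> for every unit vector \<open>w\<close>. Moving
  \<open>w\<close> from \<open>u\<close> to \<open>- u\<close> in small steps, \<open>\<langle>w, y\<rangle>\<close> can never jump across the gap.
\<close>
lemma integral_inner_prod_unit_gap:
  assumes d: "d \<ge> 2" and u: "u \<in> unit_sphere d" and ab: "a < b"
    and gap: "(\<integral>y. indicat_real {a..<b} (inner_prod d u y) \<partial>sphere_uniform d) = 0"
  shows "(\<integral>y. indicat_real {b..} (inner_prod d u y) \<partial>sphere_uniform d) \<in> {0, 1}"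
proof -
  interpret prob_space "sphere_uniform d" by (rule prob_space_sphere_uniform)
  let ?e = "circle_point d"
  note e = circle_point_in_unit_sphere[OF d]
  note [measurable] = unit_sphereD(1)[OF e]
  \<comment> \<open>Consecutive points of a half circle cut into N equal arcs have squared distance
    2 - 2 cos (pi / N); N is taken so large that this is below the squared width of the gap.\<close>
  have "(\<lambda>N. 2 - 2 * cos (pi / real N)) \<longlonglongrightarrow> 2 - 2 * cos 0"
    by (intro tendsto_intros lim_const_over_n)
  then have "\<forall>\<^sub>F N in sequentially. 2 - 2 * cos (pi / real N) < (b - a)\<^sup>2"
    using ab by (intro order_tendstoD(2)) auto
  then have "\<forall>\<^sub>F N in sequentially. 2 - 2 * cos (pi / real N) < (b - a)\<^sup>2 \<and> N > 0"
    using eventually_gt_at_top[of 0] by (rule eventually_conj)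
  then obtain N where N: "2 - 2 * cos (pi / real N) < (b - a)\<^sup>2" "N > 0"
    by (auto dest: eventually_happens)
  define w where "w = (\<lambda>j. ?e (real j * (pi / real N)))"
  have w: "w j \<in> unit_sphere d" for j by (simp add: w_def e)
  note [measurable] = unit_sphereD(1)[OF w]
  have avoid: "AE y in sphere_uniform d. \<not> (a \<le> inner_prod d (w j) y \<and> inner_prod d (w j) y < b)" for j
  proof -
    have "measure (sphere_uniform d) {y \<in> space (sphere_uniform d). inner_prod d (w j) y \<in> {a..<b}} = 0"
      using gap integral_inner_prod_unit_eq[OF u w, of "indicat_real {a..<b}" j]
        integral_indicator_inner_prod[OF w, of "{a..<b}" j] by simp
    then have "AE y in sphere_uniform d. y \<notin> {y \<in> space (sphere_uniform d). inner_prod d (w j) y \<in> {a..<b}}"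
      by (intro AE_not_in null_setsI) (simp_all add: emeasure_eq_measure)
    then show ?thesis
      by (rule AE_mp) (auto intro!: AE_I2)
  qed
  have step: "\<bar>inner_prod d (w (Suc j)) y - inner_prod d (w j) y\<bar> < b - a" if "y \<in> unit_sphere d" for j y
  proof -
    define z where "z = lincomb d 1 (w (Suc j)) (- 1) (w j)"
    have "real (Suc j) * x - real j * x = x" for x by (simp add: algebra_simps)
    then have "inner_prod d (w (Suc j)) (w j) = cos (pi / real N)"
      unfolding w_def inner_prod_circle_point_circle_point[OF d] by (rule arg_cong)
    then have "inner_prod d z z = 2 - 2 * cos (pi / real N)"
      using unit_sphereD(2)[OF w] by (simp add: z_def inner_prod_lincomb inner_prod_commute[of d "w j" "w (Suc j)"])
    then have "(inner_prod d z y)\<^sup>2 \<le> 2 - 2 * cos (pi / real N)"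
      using inner_prod_Cauchy_Schwarz[of d z y] that by (simp add: unit_sphere_def)
    then have "(inner_prod d z y)\<^sup>2 < (b - a)\<^sup>2" using N by linarith
    then have "\<bar>inner_prod d z y\<bar> ^ 2 < (b - a) ^ 2" by simp
    then have "\<bar>inner_prod d z y\<bar> < b - a"
      by (rule power_less_imp_less_base) (use ab in simp)
    then show ?thesis using ab by (simp add: z_def inner_prod_lincomb)
  qed
  have chain: "AE y in sphere_uniform d. b \<le> inner_prod d (w j) y \<longleftrightarrow> b \<le> inner_prod d (w 0) y" for j
  proof (induction j)
    case (Suc j)
    have "d \<ge> 1" using d by simp
    from Suc avoid[of j] avoid[of "Suc j"] AE_unit_sphere[OF this] show ?case
    proof eventually_elim
      case (elim y)
      then show ?case using step[of y j] by (auto simp: abs_less_iff)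
    qed
  qed simp
  have "w N = ?e pi" using N by (simp add: w_def)
  then have "inner_prod d (w N) y = - inner_prod d (w 0) y" for y
    using d by (simp add: w_def inner_prod_circle_point)
  with chain[of N] have *: "AE y in sphere_uniform d. b \<le> - inner_prod d (w 0) y \<longleftrightarrow> b \<le> inner_prod d (w 0) y"
    by simp
  have "(\<integral>y. indicat_real {b..} (inner_prod d u y) \<partial>sphere_uniform d) =
      (\<integral>y. indicat_real {b..} (inner_prod d (w 0) y) \<partial>sphere_uniform d)"
    by (rule integral_inner_prod_unit_eq[OF u w]) simp
  \<comment> \<open>At the antipode, b \<le> s has become equivalent to b \<le> -s. Both cannot hold
    if b > 0, and one of them always holds if b \<le> 0, so the event has probability 0 or
    1.\<close>
  also have "\<dots> = (\<integral>y. (if b > 0 then 0 else 1) \<partial>sphere_uniform d)"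
    using * by (intro integral_cong_AE) (auto simp: indicator_def elim!: eventually_mono)
  also have "\<dots> \<in> {0, 1}" by (simp add: prob_space)
  finally show ?thesis .
qed

text \<open>Resolves the definite description in \<open>threshold\<close>. The pair probability
  reduces to the tail function of one fixed vector; two different solutions would enclose an
  interval without mass, and then the tail would be 0 or 1 instead of \<open>p\<close>.\<close>

lemma integral_ge_threshold:
  assumes d: "d \<ge> 2" and u: "u \<in> unit_sphere d" and p: "0 < p" "p < 1"
  shows "(\<integral>y. indicat_real {threshold p d..} (inner_prod d u y) \<partial>sphere_uniform d) = p"
proof -
  interpret S: prob_space "sphere_uniform d" by (rule prob_space_sphere_uniform)
  interpret SS: pair_prob_space "sphere_uniform d" "sphere_uniform d" ..
  note [measurable] = unit_sphereD(1)[OF u]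
  define F where "F = (\<lambda>t. \<integral>y. indicat_real {t..} (inner_prod d u y) \<partial>sphere_uniform d)"
  have pair: "measure (sphere_uniform d \<Otimes>\<^sub>M sphere_uniform d)
      {(x, y) \<in> space (sphere_uniform d \<Otimes>\<^sub>M sphere_uniform d). inner_prod d x y \<ge> t} = F t" for t
  proof -
    let ?A = "{(x, y) \<in> space (sphere_uniform d \<Otimes>\<^sub>M sphere_uniform d). inner_prod d x y \<ge> t}"
    have "?A = {z \<in> space (sphere_uniform d \<Otimes>\<^sub>M sphere_uniform d). inner_prod d (fst z) (snd z) \<ge> t}"
      by auto
    also have "\<dots> \<in> sets (sphere_uniform d \<Otimes>\<^sub>M sphere_uniform d)" by measurable
    finally have A: "?A \<in> sets (sphere_uniform d \<Otimes>\<^sub>M sphere_uniform d)" .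
    have "emeasure (sphere_uniform d \<Otimes>\<^sub>M sphere_uniform d) ?A =
        (\<integral>\<^sup>+x. emeasure (sphere_uniform d) (Pair x -` ?A) \<partial>sphere_uniform d)"
      by (rule S.emeasure_pair_measure_alt[OF A])
    also have "\<dots> = (\<integral>\<^sup>+x. ennreal (F t) \<partial>sphere_uniform d)"
    proof (rule nn_integral_cong_AE)
      have "d \<ge> 1" using d by simp
      from AE_unit_sphere[OF this]
      show "AE x in sphere_uniform d. emeasure (sphere_uniform d) (Pair x -` ?A) = ennreal (F t)"
      proof (rule eventually_mono)
        fix x assume x: "x \<in> unit_sphere d"
        then have "Pair x -` ?A = {y \<in> space (sphere_uniform d). inner_prod d x y \<in> {t..}}"
          by (auto simp: space_pair_measure space_sphere_uniform unit_sphere_def)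
        then show "emeasure (sphere_uniform d) (Pair x -` ?A) = ennreal (F t)"
          using integral_indicator_inner_prod[OF x, of "{t..}"]
            integral_inner_prod_unit_eq[OF u x, of "indicat_real {t..}"]
          by (simp add: S.emeasure_eq_measure F_def)
      qed
    qed
    also have "\<dots> = ennreal (F t)" by (simp add: S.emeasure_space_1)
    finally show ?thesis by (simp add: measure_def F_def)
  qed
  obtain t where t: "F t = p"
    using integral_inner_prod_unit_ge_exists[OF d u p] by (auto simp: F_def)
  have int: "integrable (sphere_uniform d) (\<lambda>y. indicat_real A (inner_prod d u y))" if "A \<in> sets borel" for A
    using d that by (intro integrable_sphere_bounded[where B = 1]) (auto simp: indicator_def)
  have less: False if "a < b" "F a = p" "F b = p" for a b
  proof -
    have "indicat_real {a..<b} s = indicat_real {a..} s - indicat_real {b..} s" for s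
      using that by (auto simp: indicator_def)
    then have "(\<integral>y. indicat_real {a..<b} (inner_prod d u y) \<partial>sphere_uniform d) = F a - F b"
      unfolding F_def by (subst Bochner_Integration.integral_diff[symmetric]) (auto intro: int)
    then have "F b \<in> {0, 1}"
      using integral_inner_prod_unit_gap[OF d u \<open>a < b\<close>] that by (simp add: F_def)
    then show False using that p by auto
  qed
  have "threshold p d = t"
    unfolding threshold_def pair
  proof (rule the_equality[where P = "\<lambda>t. F t = p"])
    fix s assume "F s = p"
    then show "s = t" using t less[of s t] less[of t s] by (metis linorder_neqE)
  qed (rule t)
  then show ?thesis using t by (simp add: F_def)
qed

subsection \<open>The centred edge kernel\<close>

text \<open>The derivative of sin x - x / 2 is non-negative as long as cos x \<ge> 1/2, that is, up
  to pi / 3 > 1.\<close>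

lemma sin_ge_half:
  fixes x :: real
  assumes "0 \<le> x" "x \<le> 1"
  shows "x / 2 \<le> sin x"
proof -
  have "sin 0 - 0 / 2 \<le> sin x - x / 2"
  proof (rule DERIV_nonneg_imp_nondecreasing[OF assms(1)])
    fix y :: real assume y: "0 \<le> y" "y \<le> x"
    have "cos (pi / 3) \<le> cos y" using y assms pi_gt3 by (intro cos_monotone_0_pi_le) auto
    then show "\<exists>D. ((\<lambda>x. sin x - x / 2) has_real_derivative D) (at y) \<and> 0 \<le> D"
      by (intro exI[of _ "cos y - 1 / 2"]) (auto intro!: derivative_eq_intros simp: cos_60)
  qed
  then show ?thesis by simp
qed

locale sphere_graph =
  fixes d :: nat and p :: real
  assumes d: "d \<ge> 2" and p: "0 < p" "p < 1"
begin

abbreviation S where "S \<equiv> sphere_uniform d"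
abbreviation E where "E \<equiv> euclidean_space_measure d"

sublocale S: prob_space S by (rule prob_space_sphere_uniform)
sublocale SS: pair_prob_space S S ..

definition edge :: "(nat \<Rightarrow> real) \<Rightarrow> (nat \<Rightarrow> real) \<Rightarrow> real" where
  "edge x y = indicat_real {threshold p d..} (inner_prod d x y) - p"

text \<open>This is \<open>g\<close>, and \<open>edge\<close> is \<open>f\<close>. For unit vectors
  it is the covariance of two events for a uniform point \<open>y\<close>: that \<langle>x,
  y\<rangle> reaches the threshold, and that \<langle>y, z\<rangle> does.\<close>

definition path2 :: "(nat \<Rightarrow> real) \<Rightarrow> (nat \<Rightarrow> real) \<Rightarrow> real" where
  "path2 x z = (\<integral>y. edge x y * edge y z \<partial>S)"

lemma d1: "d \<ge> 1" using d by simp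

lemma edge_commute: "edge x y = edge y x"
  by (simp add: edge_def inner_prod_commute)

lemma edge_cases: "edge x y = 1 - p \<or> edge x y = - p"
  by (simp add: edge_def indicator_def)

lemma edge_bounds: "- p \<le> edge x y" "edge x y \<le> 1 - p" "\<bar>edge x y\<bar> \<le> 1"
  using edge_cases[of x y] p by auto

lemma edge_square: "edge x y * edge x y = (1 - 2 * p) * edge x y + p * (1 - p)"
  using edge_cases[of x y] by (elim disjE, simp_all only:) (simp_all add: algebra_simps)

lemma measurable_edge [measurable]:
  assumes [measurable]: "g \<in> M \<rightarrow>\<^sub>M E" "h \<in> M \<rightarrow>\<^sub>M E"
  shows "(\<lambda>x. edge (g x) (h x)) \<in> borel_measurable M"
  unfolding edge_def by measurable

lemma measurable_path2 [measurable]: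
  assumes g [measurable]: "g \<in> M \<rightarrow>\<^sub>M E" and h [measurable]: "h \<in> M \<rightarrow>\<^sub>M E"
  shows "(\<lambda>x. path2 (g x) (h x)) \<in> borel_measurable M"
  unfolding path2_def by measurable

lemma edge_reflection: "edge (reflection d w x) (reflection d w y) = edge x y"
  by (simp add: edge_def inner_prod_reflection)

lemma abs_mult_le_1: "\<bar>a * b\<bar> \<le> 1" if "\<bar>a\<bar> \<le> 1" "\<bar>b\<bar> \<le> 1" for a b :: real
  using that by (simp add: abs_mult mult_le_one)

lemma integrable_bounded:
  fixes F :: "(nat \<Rightarrow> real) \<Rightarrow> real"
  assumes "F \<in> borel_measurable E" "\<And>y. y \<in> unit_sphere d \<Longrightarrow> \<bar>F y\<bar> \<le> B"
  shows "integrable S F"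
  using integrable_sphere_bounded[OF d1 assms] .

lemma abs_integral_le:
  fixes F :: "(nat \<Rightarrow> real) \<Rightarrow> real"
  assumes "\<And>y. \<bar>F y\<bar> \<le> B"
  shows "\<bar>\<integral>y. F y \<partial>S\<bar> \<le> B"
proof (cases "integrable S F")
  case True
  have "\<bar>\<integral>y. F y \<partial>S\<bar> \<le> (\<integral>y. \<bar>F y\<bar> \<partial>S)" by (rule integral_abs_bound)
  also have "\<dots> \<le> (\<integral>y. B \<partial>S)" using True assms by (intro integral_mono) auto
  finally show ?thesis by (simp add: S.prob_space)
next
  case False
  \<comment> \<open>The integral of a non-integrable function is 0, and B \<ge> 0 because it bounds
    an absolute value.\<close>
  then show ?thesis using assms[of undefined] by (simp add: not_integrable_integral_eq)
qed

lemma Fubini_bounded: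
  fixes F :: "(nat \<Rightarrow> real) \<Rightarrow> (nat \<Rightarrow> real) \<Rightarrow> real"
  assumes [measurable]: "(\<lambda>(x, y). F x y) \<in> borel_measurable (E \<Otimes>\<^sub>M E)" and B: "\<And>x y. \<bar>F x y\<bar> \<le> B"
  shows "(\<integral>x. (\<integral>y. F x y \<partial>S) \<partial>S) = (\<integral>y. (\<integral>x. F x y \<partial>S) \<partial>S)"
proof -
  have "integrable (S \<Otimes>\<^sub>M S) (\<lambda>(x, y). F x y)"
    using B by (intro SS.P.integrable_const_bound[of _ B]) auto
  then show ?thesis by (rule SS.Fubini_integral[symmetric])
qed

lemma measurable_edge_right [measurable]: "x \<in> space E \<Longrightarrow> edge x \<in> borel_measurable E"
  using measurable_edge[OF measurable_const measurable_ident] by (simp add: id_def)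

lemma measurable_path2_right [measurable]: "x \<in> space E \<Longrightarrow> path2 x \<in> borel_measurable E"
  using measurable_path2[OF measurable_const measurable_ident] by (simp add: id_def)

lemma integral_edge:
  assumes "x \<in> unit_sphere d"
  shows "(\<integral>y. edge x y \<partial>S) = 0"
proof -
  note [measurable] = unit_sphereD(1)[OF assms]
  have "integrable S (\<lambda>y. indicat_real {threshold p d..} (inner_prod d x y))"
    by (rule integrable_bounded[where B = 1]) (auto simp: indicator_def)
  then show ?thesis
    unfolding edge_def using integral_ge_threshold[OF d assms p] by (simp add: S.prob_space)
qed

lemma integrable_edge: "x \<in> space E \<Longrightarrow> integrable S (edge x)"
  using edge_bounds by (intro integrable_bounded[where B = 1]) auto

lemma integrable_edge_edge:
  assumes "x \<in> space E" "z \<in> space E"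
  shows "integrable S (\<lambda>y. edge x y * edge y z)"
  using assms edge_bounds by (intro integrable_bounded[where B = 1] abs_mult_le_1) auto

section \<open>Symmetry, monotonicity and modulus of continuity of \<open>path2\<close>\<close>

lemma path2_reflection:
  assumes w: "w \<in> space E" and x: "x \<in> space E" "y \<in> space E"
  shows "path2 (reflection d w x) (reflection d w y) = path2 x y"
proof -
  note [measurable] = w x
  have [measurable]: "reflection d w x \<in> space E" "reflection d w y \<in> space E"
    by (simp_all add: reflection_def)
  have "path2 x y = (\<integral>z. edge (reflection d w x) (reflection d w z) * edge (reflection d w z) (reflection d w y) \<partial>S)"
    unfolding path2_def by (simp add: edge_reflection)
  also have "\<dots> = path2 (reflection d w x) (reflection d w y)"
    unfolding path2_def
    by (rule integral_reflection_sphere[where F = "\<lambda>z. edge (reflection d w x) z * edge z (reflection d w y)"])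
      (use w in measurable)
  finally show ?thesis ..
qed

text \<open>Both factors have second moment p (1 - p), so the inequality of arithmetic and geometric
  means already gives the Cauchy-Schwarz bound. The sharp constant later keeps 1 + q^2 path2 / (p (1
  - p)) non-negative.\<close>

lemma abs_path2_le:
  assumes x: "x \<in> unit_sphere d" and z: "z \<in> unit_sphere d"
  shows "\<bar>path2 x z\<bar> \<le> p * (1 - p)"
proof -
  note [measurable] = unit_sphereD(1)[OF x] unit_sphereD(1)[OF z]
  have sq: "(\<integral>y. (edge u y)\<^sup>2 \<partial>S) = p * (1 - p)" if u: "u \<in> unit_sphere d" for u
  proof -
    note [measurable] = unit_sphereD(1)[OF u]
    have "(edge u y)\<^sup>2 = (1 - 2 * p) * edge u y + p * (1 - p)" for y
      by (simp add: power2_eq_square edge_square)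
    moreover have "integrable S (edge u)"
      using edge_bounds by (intro integrable_bounded) auto
    ultimately show ?thesis using integral_edge[OF u] by (simp add: S.prob_space)
  qed
  have i2: "integrable S (\<lambda>y. (edge u y)\<^sup>2)" if "u \<in> unit_sphere d" for u
    using edge_bounds[of u] unit_sphereD(1)[OF that]
    by (intro integrable_bounded[where B = 1]) (auto simp: abs_square_le_1)
  have "\<bar>path2 x z\<bar> \<le> (\<integral>y. \<bar>edge x y * edge y z\<bar> \<partial>S)"
    unfolding path2_def by (rule integral_abs_bound)
  also have "\<dots> \<le> (\<integral>y. ((edge x y)\<^sup>2 + (edge z y)\<^sup>2) / 2 \<partial>S)"
  proof (rule integral_mono)
    show "integrable S (\<lambda>y. \<bar>edge x y * edge y z\<bar>)"
      using edge_bounds by (intro integrable_bounded[where B = 1]) (auto simp: abs_mult mult_le_one)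
    show "integrable S (\<lambda>y. ((edge x y)\<^sup>2 + (edge z y)\<^sup>2) / 2)"
      using i2 x z by auto
    fix y
    show "\<bar>edge x y * edge y z\<bar> \<le> ((edge x y)\<^sup>2 + (edge z y)\<^sup>2) / 2"
      using sum_squares_bound[of "\<bar>edge x y\<bar>" "\<bar>edge y z\<bar>"] by (simp add: abs_mult edge_commute[of y z])
  qed
  also have "\<dots> = p * (1 - p)" using i2[OF x] i2[OF z] sq[OF x] sq[OF z] by simp
  finally show ?thesis .
qed

lemma path2_le_1:
  assumes "x \<in> unit_sphere d" "z \<in> unit_sphere d"
  shows "\<bar>path2 x z\<bar> \<le> 1"
  using abs_path2_le[OF assms] mult_le_one[of p "1 - p"] p by linarith

lemma path2_self:
  assumes x: "x \<in> unit_sphere d"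
  shows "path2 x x = p * (1 - p)"
proof -
  note [measurable] = unit_sphereD(1)[OF x]
  have "edge x y * edge y x = (1 - 2 * p) * edge x y + p * (1 - p)" for y
    by (simp add: edge_commute[of y x] edge_square)
  moreover have "integrable S (edge x)"
    using edge_bounds by (intro integrable_bounded) auto
  ultimately show ?thesis using integral_edge[OF x] by (simp add: path2_def S.prob_space)
qed

text \<open>
  Two-point symmetrisation: averaging over the reflection that swaps \<open>v\<close> and \<open>v'\<close> turns the
  difference into the integral of a product of two factors of equal sign.
\<close>
lemma path2_mono:
  assumes u: "u \<in> unit_sphere d" and v: "v \<in> unit_sphere d" and v': "v' \<in> unit_sphere d"
    and le: "inner_prod d u v' \<le> inner_prod d u v"
  shows "path2 u v' \<le> path2 u v"
proof -
  note [measurable] = unit_sphereD(1)[OF u] unit_sphereD(1)[OF v] unit_sphereD(1)[OF v']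
  define w where "w = lincomb d 1 v (- 1) v'"
  have w [measurable]: "w \<in> space E" by (simp add: w_def)
  let ?R = "reflection d w"
  have R: "?R v = v'" unfolding w_def by (rule reflection_swap[OF v v'])
  have R': "edge v (?R y) = edge v' y" "edge v' (?R y) = edge v y" for y
  proof -
    show "edge v (?R y) = edge v' y"
      unfolding R[symmetric] edge_def by (simp only: inner_prod_reflection_left)
    show "edge v' (?R y) = edge v y"
      unfolding R[symmetric] by (rule edge_reflection)
  qed
  have i: "integrable S (\<lambda>y. edge u (g y) * edge w' y)"
    if [measurable]: "g \<in> E \<rightarrow>\<^sub>M E" "w' \<in> space E" for g w'
    using edge_bounds by (intro integrable_bounded[where B = 1]) (auto simp: abs_mult mult_le_one)
  note vs = unit_sphereD(1)[OF v] unit_sphereD(1)[OF v']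
  let ?F = "\<lambda>y. edge u y * (edge v y - edge v' y)"
  have iF: "integrable S ?F"
    using vs i[of "\<lambda>y. y" v] i[of "\<lambda>y. y" v'] by (simp add: right_diff_distrib)
  have "path2 u v - path2 u v' = (\<integral>y. ?F y \<partial>S)"
    using vs i[of "\<lambda>y. y" v] i[of "\<lambda>y. y" v'] by (simp add: path2_def right_diff_distrib edge_commute[of _ v] edge_commute[of _ v'])
  moreover have "(\<integral>y. ?F (?R y) \<partial>S) = (\<integral>y. ?F y \<partial>S)"
    by (rule integral_reflection_sphere) (use w in measurable)
  moreover have "integrable S (\<lambda>y. ?F (?R y))"
    using vs i[of ?R v] i[of ?R v'] measurable_reflection[OF w] by (simp add: R' right_diff_distrib)
  ultimately have "2 * (path2 u v - path2 u v') = (\<integral>y. ?F y + ?F (?R y) \<partial>S)"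
    using iF by simp
  also have "\<dots> = (\<integral>y. (edge u y - edge u (?R y)) * (edge v y - edge v' y) \<partial>S)"
    by (simp add: R' algebra_simps)
  also have "\<dots> \<ge> 0"
  proof (rule integral_nonneg_AE, rule AE_I2)
    fix y
    \<comment> \<open>\<open>u\<close> lies on the side of \<open>v\<close>, so \<langle>u,
      y\<rangle> - \<langle>u, ?R y\<rangle> has the weak sign of \<langle>y, w\<rangle> =
      \<langle>v, y\<rangle> - \<langle>v', y\<rangle>. Both factors are increments of a
      non-decreasing function in that direction.\<close>
    have uw: "inner_prod d u w \<ge> 0" using le by (simp add: w_def inner_prod_lincomb)
    have diff: "inner_prod d u y - inner_prod d u (?R y) = 2 * inner_prod d y w / inner_prod d w w * inner_prod d u w"
      by (simp add: reflection_def inner_prod_lincomb)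
    have yw: "inner_prod d y w = inner_prod d v y - inner_prod d v' y"
      by (simp add: w_def inner_prod_lincomb inner_prod_commute)
    have pos: "inner_prod d w w \<ge> 0" by (rule inner_prod_nonneg)
    show "0 \<le> (edge u y - edge u (?R y)) * (edge v y - edge v' y)"
    proof (cases "inner_prod d v' y \<le> inner_prod d v y")
      case True
      then have "inner_prod d u (?R y) \<le> inner_prod d u y"
        using diff uw yw pos by (smt (verit) divide_nonneg_nonneg mult_nonneg_nonneg)
      with True show ?thesis
        by (intro mult_nonneg_nonneg) (auto simp: edge_def indicator_def)
    next
      case False
      then have "inner_prod d u y \<le> inner_prod d u (?R y)"
        using diff uw yw pos by (smt (verit) divide_nonneg_nonneg mult_nonneg_nonneg minus_divide_left mult_minus_left)
      with False show ?thesis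
        by (intro mult_nonpos_nonpos) (auto simp: edge_def indicator_def)
    qed
  qed
  finally show ?thesis by simp
qed

lemma path2_eq_left:
  assumes "u \<in> unit_sphere d" "v \<in> unit_sphere d" "v' \<in> unit_sphere d"
    and "inner_prod d u v' = inner_prod d u v"
  shows "path2 u v' = path2 u v"
  using path2_mono[OF assms(1-3)] path2_mono[OF assms(1,3,2)] assms(4) by simp

text \<open>A reflection carries \<open>u\<close> to \<open>u'\<close>; what remains is a change in
  the second argument, where monotonicity applies in both directions. Henceforth
  \<open>path2\<close> may be treated as a function of the inner product.\<close>

lemma path2_eq:
  assumes u: "u \<in> unit_sphere d" and v: "v \<in> unit_sphere d" and u': "u' \<in> unit_sphere d" and v': "v' \<in> unit_sphere d"
    and eq: "inner_prod d u v = inner_prod d u' v'"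
  shows "path2 u v = path2 u' v'"
proof -
  define w where "w = lincomb d 1 u (- 1) u'"
  have R: "reflection d w u = u'" unfolding w_def by (rule reflection_swap[OF u u'])
  have Rv: "reflection d w v \<in> unit_sphere d"
    using v by (simp add: unit_sphere_def inner_prod_reflection) (simp add: reflection_def)
  have "path2 u v = path2 u' (reflection d w v)"
    using path2_reflection[OF _ unit_sphereD(1)[OF u] unit_sphereD(1)[OF v], of w] by (simp add: R) (simp add: w_def)
  also have "\<dots> = path2 u' v'"
  proof (rule path2_eq_left[OF u' v' Rv])
    show "inner_prod d u' (reflection d w v) = inner_prod d u' v'"
      using inner_prod_reflection[of d w u v] eq by (simp add: R)
  qed
  finally show ?thesis .
qed

text \<open>The pairs (a, b + \<delta>) and (a + \<delta>, b) have the same midpoint m, so both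
  differences carry the factor X. The outer drop forces X > 0, and then the value cannot climb back
  to t between a + \<delta> and b.\<close>

lemma downcrossing_unique:
  fixes A B t a b \<delta> :: real
  assumes "0 \<le> a" "a + \<delta> \<le> b" "0 < \<delta>" "b + \<delta> \<le> 1"
    and "A * cos a + B * sin a \<ge> t" "A * cos (a + \<delta>) + B * sin (a + \<delta>) < t"
    and "A * cos b + B * sin b \<ge> t" "A * cos (b + \<delta>) + B * sin (b + \<delta>) < t"
  shows False
proof -
  define m where "m = (a + b + \<delta>) / 2"
  define X where "X = A * sin m - B * cos m"
  have m: "(a + (b + \<delta>)) / 2 = m" "(a + \<delta> + b) / 2 = m" by (simp_all add: m_def)
  have s: "sin ((b + \<delta> - a) / 2) > 0" "sin ((b - (a + \<delta>)) / 2) \<ge> 0"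
    using assms(1-4) pi_gt3 by (auto intro!: sin_gt_zero sin_ge_zero)
  have "2 * sin ((b + \<delta> - a) / 2) * X > 0"
    using sinusoid_diff[of A a B "b + \<delta>"] assms(5-8) unfolding m X_def by linarith
  then have "X > 0" using s(1) by (simp add: zero_less_mult_iff)
  then have "2 * sin ((b - (a + \<delta>)) / 2) * X \<ge> 0" using s(2) by simp
  then show False
    using sinusoid_diff[of A "a + \<delta>" B b] assms(5-8) unfolding m X_def by linarith
qed

text \<open>
  For \<open>a\<close> in the unit interval, \<open>\<langle>circle_point d a, y\<rangle>\<close> crosses the threshold downwards at most once, so
  the roughly \<open>1 / \<delta>\<close> equally likely events of a downward crossing within \<open>[j \<delta>, (j + 1) \<delta>]\<close> are disjoint.
\<close>
lemma path2_near_diagonal: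
  assumes u: "u \<in> unit_sphere d" and v: "v \<in> unit_sphere d" and \<delta>: "0 \<le> \<delta>" "\<delta> \<le> 1"
    and uv: "cos \<delta> \<le> inner_prod d u v"
  shows "p * (1 - p) - path2 u v \<le> 2 * \<delta>"
proof (cases "\<delta> = 0")
  case True
  then have "inner_prod d u v = 1" using uv abs_inner_prod_le_1[OF u v] by auto
  then have "path2 u v = path2 u u"
    using u by (intro path2_eq u v) (simp add: unit_sphere_def)
  then show ?thesis using path2_self[OF u] True by simp
next
  case False
  let ?e = "circle_point d"
  note e = circle_point_in_unit_sphere[OF d]
  note ee = inner_prod_circle_point_circle_point[OF d]
  note ey = inner_prod_circle_point[OF d]
  note [measurable] = unit_sphereD(1)[OF e]
  \<comment> \<open>By monotonicity the worst case is the angle \<delta> itself.\<close>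
  define g where "g = path2 (?e 0) (?e \<delta>)"
  have g: "g \<le> path2 u v"
  proof -
    have "path2 u v = path2 (?e 0) (?e (arccos (inner_prod d u v)))"
      using abs_inner_prod_le_1[OF u v] by (intro path2_eq u v e) (simp add: ee abs_le_iff)
    also have "\<dots> \<ge> g"
      unfolding g_def using abs_inner_prod_le_1[OF u v] uv by (intro path2_mono e) (simp add: ee abs_le_iff)
    finally show ?thesis .
  qed
  define H where "H = (\<lambda>a y. edge (?e a) y + p)"
  have H01: "H a y = (if inner_prod d (?e a) y \<ge> threshold p d then 1 else 0)" for a y
    by (simp add: H_def edge_def indicator_def)
  have mH [measurable]: "H a \<in> borel_measurable E" for a
    unfolding H_def by measurable
  \<comment> \<open>The indicator of a downward crossing between the angles a and a + \<delta>; its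
    mean p (1 - p) - g is the same for all a.\<close>
  define c where "c = (\<lambda>a y. H a y * (1 - H (a + \<delta>) y))"
  have mc [measurable]: "c a \<in> borel_measurable E" for a unfolding c_def by measurable
  have c01: "0 \<le> c a y" "c a y \<le> 1" for a y by (simp_all add: c_def H01)
  have ic: "integrable S (c a)" for a
    using c01 by (intro integrable_bounded[where B = 1]) auto
  have int_c: "(\<integral>y. c a y \<partial>S) = p * (1 - p) - g" for a
  proof -
    have i1: "integrable S (edge (?e a))" for a using edge_bounds by (intro integrable_bounded[where B = 1]) auto
    have i2: "integrable S (\<lambda>y. edge (?e a) y * edge y (?e b))" for a b
      using edge_bounds by (intro integrable_bounded[where B = 1]) (auto simp: abs_mult mult_le_one)
    have "c a y = (1 - p) * edge (?e a) y - p * edge (?e (a + \<delta>)) y - edge (?e a) y * edge y (?e (a + \<delta>)) + p * (1 - p)" for y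
      unfolding c_def H_def by (simp add: edge_commute[of y] algebra_simps)
    then have "(\<integral>y. c a y \<partial>S) = - path2 (?e a) (?e (a + \<delta>)) + p * (1 - p)"
      using i1 i2 integral_edge[OF e] by (simp add: path2_def S.prob_space)
    moreover have "path2 (?e a) (?e (a + \<delta>)) = g"
      unfolding g_def by (intro path2_eq e) (simp add: ee)
    ultimately show ?thesis by simp
  qed
  define N where "N = nat \<lfloor>1 / \<delta>\<rfloor>"
  have N: "real N \<le> 1 / \<delta>" "1 / \<delta> < real N + 1"
    using \<delta> by (auto simp: N_def)
  have N1: "real N \<ge> 1" using \<delta> False by (simp add: N_def)
  have "real N * (p * (1 - p) - g) = (\<Sum>j<N. \<integral>y. c (real j * \<delta>) y \<partial>S)"
    by (simp add: int_c)
  also have "\<dots> = (\<integral>y. (\<Sum>j<N. c (real j * \<delta>) y) \<partial>S)"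
    by (rule Bochner_Integration.integral_sum[symmetric]) (rule ic)
  also have "\<dots> \<le> (\<integral>y. 1 \<partial>S)"
  proof (rule integral_mono)
    fix y
    let ?J = "{j \<in> {..<N}. c (real j * \<delta>) y \<noteq> 0}"
    have cases: "False" if ij: "i \<in> ?J" "j \<in> ?J" "i < j" for i j
    proof (rule downcrossing_unique)
      show "0 \<le> real i * \<delta>" "0 < \<delta>" using \<delta> False by auto
      have "real i + 1 \<le> real j" using ij by linarith
      then have "(real i + 1) * \<delta> \<le> real j * \<delta>" using \<delta> by (intro mult_right_mono) auto
      then show "real i * \<delta> + \<delta> \<le> real j * \<delta>" by (simp add: distrib_right)
      have "real j + 1 \<le> real N" using ij by auto
      then have "(real j + 1) * \<delta> \<le> 1 / \<delta> * \<delta>" using \<delta> N by (intro mult_right_mono) auto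
      then show "real j * \<delta> + \<delta> \<le> 1" using False by (simp add: distrib_right)
    qed (use ij in \<open>auto simp: c_def H01 ey split: if_splits\<close>)
    have "card ?J \<le> 1"
    proof -
      have "\<forall>i\<in>?J. \<forall>j\<in>?J. i = j" using cases by (meson linorder_neqE_nat)
      moreover have "finite ?J" by simp
      ultimately show ?thesis using card_le_Suc0_iff_eq[of ?J] by simp
    qed
    have "(\<Sum>j<N. c (real j * \<delta>) y) = (\<Sum>j\<in>?J. c (real j * \<delta>) y)"
      by (intro sum.mono_neutral_right) auto
    also have "\<dots> \<le> (\<Sum>j\<in>?J. 1)" using c01 by (intro sum_mono) auto
    also have "\<dots> \<le> 1" using \<open>card ?J \<le> 1\<close> by simp
    finally show "(\<Sum>j<N. c (real j * \<delta>) y) \<le> 1" .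
  qed (auto intro: ic)
  also have "\<dots> = 1" by (simp add: S.prob_space)
  finally have *: "real N * (p * (1 - p) - g) \<le> 1" .
  \<comment> \<open>Rounding 1 / \<delta> down to N \<ge> 1 loses at most a factor 2, which is the 2
    in the bound.\<close>
  have "1 / \<delta> \<le> 2 * real N" using N N1 by linarith
  then have "1 \<le> 2 * \<delta> * real N" using \<delta> False by (simp add: field_simps)
  with * have "real N * (p * (1 - p) - g) \<le> real N * (2 * \<delta>)" by (simp add: mult_ac)
  then have "p * (1 - p) - g \<le> 2 * \<delta>" using N1 by simp
  then show ?thesis using g by simp
qed


section \<open>Decay of \<open>path2\<close> in high dimension\<close>

lemma integrable_path2: "x \<in> unit_sphere d \<Longrightarrow> integrable S (path2 x)"
  using path2_le_1 unit_sphereD(1)[of x d] by (intro integrable_bounded[where B = 1]) auto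

lemma integral_path2:
  assumes u: "u \<in> unit_sphere d"
  shows "(\<integral>v. path2 u v \<partial>S) = 0"
proof -
  note [measurable] = unit_sphereD(1)[OF u]
  have "(\<integral>v. path2 u v \<partial>S) = (\<integral>y. (\<integral>v. edge u y * edge y v \<partial>S) \<partial>S)"
    unfolding path2_def using edge_bounds
    by (intro Fubini_bounded[where B = 1] abs_mult_le_1) auto
  also have "\<dots> = (\<integral>y. 0 \<partial>S)"
    by (rule integral_sphere_cong[OF d1]) (auto simp: integral_edge)
  finally show ?thesis by simp
qed

text \<open>\<open>v\<close> is compared with a unit vector \<open>w\<close> orthogonal to
  \<open>u\<close> in the plane of \<open>u\<close> and \<open>v\<close>. The difference of two edge
  values is -1, 0 or 1, hence in absolute value equal to its square; the mean square is 2 (p (1 - p)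
  - path2 v w), to which the bound near the diagonal applies with angle 2 \<bar>s\<bar>. For
  \<bar>s\<bar> > 1/2 the trivial bound on \<open>path2\<close> is enough.\<close>

lemma path2_near_orthogonal:
  assumes u: "u \<in> unit_sphere d" and v: "v \<in> unit_sphere d"
  shows "\<bar>path2 u v - path2 (circle_point d 0) (circle_point d (pi / 2))\<bar> \<le> 8 * \<bar>inner_prod d u v\<bar>"
proof -
  define s where "s = inner_prod d u v"
  let ?\<gamma> = "path2 (circle_point d 0) (circle_point d (pi / 2))"
  note b = circle_point_in_unit_sphere[OF d]
  show ?thesis
  proof (cases "\<bar>s\<bar> \<le> 1 / 2")
    case False
    then show ?thesis using path2_le_1[OF u v] path2_le_1[OF b b, of 0 "pi / 2"] by (auto simp: s_def)
  next
    case True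
    define c where "c = sqrt (1 - s\<^sup>2)"
    have "\<bar>s\<bar>\<^sup>2 \<le> (1 / 2)\<^sup>2" using True by (intro power_mono) auto
    then have s2: "s\<^sup>2 < 1" by (simp add: power2_eq_square)
    have c: "c > 0" "c\<^sup>2 = 1 - s\<^sup>2" using s2 by (auto simp: c_def)
    define w where "w = lincomb d (1 / c) v (- s / c) u"
    have w: "w \<in> unit_sphere d"
      unfolding w_def
    proof (rule lincomb_in_unit_sphere[OF v u])
      have "(1 / c)\<^sup>2 + (- s / c)\<^sup>2 + 2 * (1 / c) * (- s / c) * inner_prod d v u = (1 - s\<^sup>2) / c\<^sup>2"
        using c(1) by (simp add: s_def inner_prod_commute[of d v u] power2_eq_square diff_divide_distrib add_divide_distrib)
      then show "(1 / c)\<^sup>2 + (- s / c)\<^sup>2 + 2 * (1 / c) * (- s / c) * inner_prod d v u = 1"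
        using c s2 by simp
    qed
    have uw: "inner_prod d u w = 0"
      using u by (simp add: w_def inner_prod_lincomb unit_sphere_def s_def)
    have "inner_prod d v w = (1 - s * s) / c"
      using v by (simp add: w_def inner_prod_lincomb unit_sphere_def s_def inner_prod_commute[of d v u] diff_divide_distrib)
    also have "1 - s * s = c * c" using c(2) by (simp add: power2_eq_square)
    finally have vw: "inner_prod d v w = c" using c by simp
    note sp [measurable] = unit_sphereD(1)[OF u] unit_sphereD(1)[OF v] unit_sphereD(1)[OF w]
    \<comment> \<open>The angle between \<open>v\<close> and \<open>w\<close> is at most 2
      \<bar>s\<bar>, since \<langle>v, w\<rangle> = sqrt (1 - s^2) and sin (2 \<bar>s\<bar>) \<ge>
      \<bar>s\<bar>.\<close>
    have "cos (2 * \<bar>s\<bar>) \<le> c"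
      unfolding c_def
    proof (rule real_le_rsqrt)
      have "\<bar>s\<bar>\<^sup>2 \<le> (sin (2 * \<bar>s\<bar>))\<^sup>2"
        using sin_ge_half[of "2 * \<bar>s\<bar>"] True by (intro power_mono) auto
      then show "(cos (2 * \<bar>s\<bar>))\<^sup>2 \<le> 1 - s\<^sup>2" by (simp add: cos_squared_eq)
    qed
    then have D: "p * (1 - p) - path2 v w \<le> 2 * (2 * \<bar>s\<bar>)"
      using True by (intro path2_near_diagonal v w) (auto simp: vw)
    note i = integrable_edge_edge
    have "path2 u v - path2 u w = (\<integral>y. edge u y * (edge y v - edge y w) \<partial>S)"
      using sp i[of u v] i[of u w] by (simp add: path2_def right_diff_distrib)
    also have "\<bar>\<dots>\<bar> \<le> (\<integral>y. \<bar>edge u y * (edge y v - edge y w)\<bar> \<partial>S)"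
      by (rule integral_abs_bound)
    also have "\<dots> \<le> (\<integral>y. edge v y * edge y v + edge w y * edge y w - 2 * (edge v y * edge y w) \<partial>S)"
    proof (rule integral_mono)
      show "integrable S (\<lambda>y. \<bar>edge u y * (edge y v - edge y w)\<bar>)"
        using sp i[of u v] i[of u w] by (simp add: right_diff_distrib)
      show "integrable S (\<lambda>y. edge v y * edge y v + edge w y * edge y w - 2 * (edge v y * edge y w))"
        using i sp by simp
      fix y
      have "\<bar>edge u y * (edge y v - edge y w)\<bar> \<le> 1 * \<bar>edge y v - edge y w\<bar>"
        unfolding abs_mult using edge_bounds by (intro mult_right_mono) auto
      also have "\<dots> = (edge y v - edge y w)\<^sup>2"
        using edge_cases[of y v] edge_cases[of y w] by (elim disjE, simp_all only:) auto
      also have "\<dots> = edge v y * edge y v + edge w y * edge y w - 2 * (edge v y * edge y w)"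
        by (simp add: edge_commute[of _ y] power2_eq_square algebra_simps)
      finally show "\<bar>edge u y * (edge y v - edge y w)\<bar> \<le>
        edge v y * edge y v + edge w y * edge y w - 2 * (edge v y * edge y w)" .
    qed
    also have "\<dots> = path2 v v + path2 w w - 2 * path2 v w"
      unfolding path2_def using i sp by simp
    also have "\<dots> \<le> 8 * \<bar>s\<bar>" using D by (simp add: path2_self v w)
    finally have "\<bar>path2 u v - path2 u w\<bar> \<le> 8 * \<bar>s\<bar>" .
    moreover have "path2 u w = ?\<gamma>" using uw by (intro path2_eq u w b) (simp add: inner_prod_circle_point_circle_point[OF d])
    ultimately show ?thesis by (simp add: s_def)
  qed
qed

lemma integral_abs_inner_prod_unit_le:
  assumes u: "u \<in> unit_sphere d"
  shows "(\<integral>y. \<bar>inner_prod d u y\<bar> \<partial>S) \<le> 1 / sqrt (real d)"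
proof -
  note [measurable] = unit_sphereD(1)[OF u]
  define r where "r = sqrt (real d)"
  have r: "r > 0" "real d = r * r" using d by (simp_all add: r_def)
  have i1: "integrable S (\<lambda>y. \<bar>inner_prod d u y\<bar>)"
    using integrable_inner_prod_power[OF d1 u, of 1] by simp
  note i2 = integrable_inner_prod_power[OF d1 u, of 2]
  have "(\<integral>y. \<bar>inner_prod d u y\<bar> \<partial>S) \<le> (\<integral>y. r / 2 * (inner_prod d u y)\<^sup>2 + 1 / (2 * r) \<partial>S)"
  proof (rule integral_mono)
    fix y
    have "0 \<le> (r * \<bar>inner_prod d u y\<bar> - 1)\<^sup>2" by simp
    then have "2 * r * \<bar>inner_prod d u y\<bar> \<le> r * r * (inner_prod d u y)\<^sup>2 + 1"
      by (simp add: power2_diff power_mult_distrib power2_eq_square algebra_simps)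
    then show "\<bar>inner_prod d u y\<bar> \<le> r / 2 * (inner_prod d u y)\<^sup>2 + 1 / (2 * r)"
      using r(1) by (simp add: field_simps)
  qed (use i1 i2 in auto)
  also have "\<dots> = r / 2 * (1 / real d) + 1 / (2 * r)"
    using i2 integral_inner_prod_unit_square[OF d1 u] by (simp add: S.prob_space)
  also have "\<dots> = 1 / r" using r(1) by (simp add: r(2))
  finally show ?thesis by (simp add: r_def)
qed

text \<open>The value at orthogonal vectors is itself of order at most 1 / sqrt d:
  \<open>path2 u\<close> has mean zero, so this constant is in absolute value at most the mean of 8
  \<bar>\<langle>u, y\<rangle>\<bar>.\<close>

lemma abs_path2_bound:
  assumes u: "u \<in> unit_sphere d" and v: "v \<in> unit_sphere d"
  shows "\<bar>path2 u v\<bar> \<le> 8 * (\<bar>inner_prod d u v\<bar> + 1 / sqrt (real d))"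
proof -
  let ?\<gamma> = "path2 (circle_point d 0) (circle_point d (pi / 2))"
  note [measurable] = unit_sphereD(1)[OF u]
  have i1: "integrable S (\<lambda>y. \<bar>inner_prod d u y\<bar>)"
    using integrable_inner_prod_power[OF d1 u, of 1] by simp
  have "- ?\<gamma> = (\<integral>y. path2 u y - ?\<gamma> \<partial>S)"
    using integrable_path2[OF u] integral_path2[OF u] by (simp add: S.prob_space)
  also have "\<bar>\<dots>\<bar> \<le> (\<integral>y. \<bar>path2 u y - ?\<gamma>\<bar> \<partial>S)" by (rule integral_abs_bound)
  also have "\<dots> \<le> (\<integral>y. 8 * \<bar>inner_prod d u y\<bar> \<partial>S)"
    using i1 integrable_path2[OF u] by (intro integral_sphere_mono[OF d1] path2_near_orthogonal u) auto
  also have "\<dots> \<le> 8 * (1 / sqrt (real d))"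
    using integral_abs_inner_prod_unit_le[OF u] by simp
  finally show ?thesis using path2_near_orthogonal[OF u v] by simp
qed

lemma integral_path2_square_le:
  assumes u: "u \<in> unit_sphere d"
  shows "(\<integral>v. (path2 u v)\<^sup>2 \<partial>S) \<le> 256 / real d"
proof -
  note [measurable] = unit_sphereD(1)[OF u]
  note i2 = integrable_inner_prod_power[OF d1 u, of 2]
  have ip: "integrable S (\<lambda>y. (path2 u y)\<^sup>2)"
    using path2_le_1[OF u] by (intro integrable_bounded[where B = 1]) (auto simp: abs_square_le_1)
  have "(\<integral>v. (path2 u v)\<^sup>2 \<partial>S) \<le> (\<integral>v. 128 * (inner_prod d u v)\<^sup>2 + 128 / real d \<partial>S)"
  proof (rule integral_sphere_mono[OF d1 ip])
    fix v assume v: "v \<in> unit_sphere d"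
    let ?a = "\<bar>inner_prod d u v\<bar>" and ?b = "1 / sqrt (real d)"
    have "\<bar>path2 u v\<bar>\<^sup>2 \<le> (8 * (?a + ?b))\<^sup>2" by (intro power_mono abs_path2_bound u v) auto
    also have "\<dots> = 64 * (?a + ?b)\<^sup>2" by (simp only: power_mult_distrib) simp
    also have "(?a + ?b)\<^sup>2 \<le> 2 * ?a\<^sup>2 + 2 * ?b\<^sup>2"
      using sum_squares_bound[of ?a ?b] by (simp add: power2_sum)
    finally show "(path2 u v)\<^sup>2 \<le> 128 * (inner_prod d u v)\<^sup>2 + 128 / real d"
      by (simp add: power_divide)
  qed (use i2 in auto)
  also have "\<dots> = 256 / real d"
    using i2 integral_inner_prod_unit_square[OF d1 u] by (simp add: S.prob_space)
  finally show ?thesis .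
qed

section \<open>Lower bounds for the triangle density\<close>

definition min_prob :: real where "min_prob = min p (1 - p)"

lemma min_prob: "0 < min_prob" "min_prob \<le> 1"
  using p by (auto simp: min_prob_def)

text \<open>The eigenvalue on linear functions of the integral operator with kernel
  \<open>edge\<close>, as \<open>integral_edge_inner_prod\<close> shows; any other unit vector gives
  the same value.\<close>

definition corr :: real where
  "corr = (\<integral>y. edge (basis_vector d 0) y * inner_prod d (basis_vector d 0) y \<partial>S)"

lemma basis0: "basis_vector d 0 \<in> unit_sphere d" using d by (simp add: basis_vector_in_unit_sphere)

lemma basis0_space: "basis_vector d 0 \<in> space E" by (rule unit_sphereD(1)[OF basis0])

lemma integral_edge_inner_prod_self:
  assumes "u \<in> unit_sphere d"
  shows "(\<integral>y. edge u y * inner_prod d u y \<partial>S) = corr"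
  unfolding corr_def edge_def
  by (rule integral_inner_prod_unit_eq[OF assms basis0, of "\<lambda>s. (indicat_real {threshold p d..} s - p) * s"]) measurable

text \<open>\<open>edge\<close> changes sign exactly where s = \<langle>u, y\<rangle> passes the
  threshold t, so its product with s - t is at least \<open>min_prob\<close> times \<bar>s -
  t\<bar>, and t drops out since \<open>edge\<close> has mean zero. Moreover E \<bar>s\<bar> \<le> 2
  E \<bar>s - t\<bar>, because s - t has mean -t.\<close>

lemma corr_ge: "corr \<ge> min_prob / (128 * sqrt (real d))"
proof -
  let ?u = "basis_vector d 0" and ?t = "threshold p d"
  note u = basis0
  note [measurable] = unit_sphereD(1)[OF u]
  let ?s = "inner_prod d ?u"
  have i1: "integrable S ?s"
    using integrable_inner_prod_power[OF d1 u, of 1] by simp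
  have i2: "integrable S (\<lambda>y. edge ?u y * ?s y)"
    using abs_inner_prod_le_1[OF u] edge_bounds by (intro integrable_bounded[where B = 1] abs_mult_le_1) auto
  have "1 / (64 * sqrt (real d)) \<le> (\<integral>y. \<bar>?s y\<bar> \<partial>S)"
    by (rule integral_abs_inner_prod_unit_ge[OF d1 u])
  also have "\<dots> \<le> (\<integral>y. \<bar>?s y - ?t\<bar> + \<bar>?t\<bar> \<partial>S)"
    using i1 by (intro integral_mono) auto
  also have "\<dots> = (\<integral>y. \<bar>?s y - ?t\<bar> \<partial>S) + \<bar>?t\<bar>"
    using i1 by (simp add: S.prob_space)
  also have "\<bar>?t\<bar> = \<bar>\<integral>y. ?s y - ?t \<partial>S\<bar>"
    using i1 integral_inner_prod_unit_eq_0[OF u] by (simp add: S.prob_space)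
  also have "\<dots> \<le> (\<integral>y. \<bar>?s y - ?t\<bar> \<partial>S)" by (rule integral_abs_bound)
  finally have "1 / (64 * sqrt (real d)) \<le> 2 * (\<integral>y. \<bar>?s y - ?t\<bar> \<partial>S)" by simp
  then have "min_prob * (1 / (128 * sqrt (real d))) \<le> min_prob * (\<integral>y. \<bar>?s y - ?t\<bar> \<partial>S)"
    using min_prob by (intro mult_left_mono) auto
  also have "\<dots> = (\<integral>y. min_prob * \<bar>?s y - ?t\<bar> \<partial>S)" by simp
  also have "\<dots> \<le> (\<integral>y. edge ?u y * (?s y - ?t) \<partial>S)"
  proof (rule integral_mono)
    fix y
    show "min_prob * \<bar>?s y - ?t\<bar> \<le> edge ?u y * (?s y - ?t)"
    proof (cases "?t \<le> ?s y")
      case True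
      then have "min_prob * (?s y - ?t) \<le> (1 - p) * (?s y - ?t)"
        by (intro mult_right_mono) (auto simp: min_prob_def)
      then show ?thesis using True by (simp add: edge_def)
    next
      case False
      then have "min_prob * (?t - ?s y) \<le> p * (?t - ?s y)"
        by (intro mult_right_mono) (auto simp: min_prob_def)
      then show ?thesis using False by (simp add: edge_def algebra_simps)
    qed
  qed (use i1 i2 integrable_edge[OF basis0_space] in \<open>auto simp: right_diff_distrib\<close>)
  also have "\<dots> = corr"
    using i2 integrable_edge[OF basis0_space] integral_edge[OF u] unfolding corr_def by (simp add: right_diff_distrib)
  finally show ?thesis by simp
qed

text \<open>
  The component of \<open>u\<close> orthogonal to \<open>y\<close> contributes nothing, by reflection in that component.
\<close>
lemma integral_edge_inner_prod:
  assumes u: "u \<in> unit_sphere d" and y: "y \<in> unit_sphere d"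
  shows "(\<integral>v. edge y v * inner_prod d u v \<partial>S) = corr * inner_prod d u y"
proof -
  note [measurable] = unit_sphereD(1)[OF u] unit_sphereD(1)[OF y]
  define w where "w = lincomb d 1 u (- inner_prod d u y) y"
  have w [measurable]: "w \<in> space E" by (simp add: w_def)
  have wy: "inner_prod d w y = 0"
    using y by (simp add: w_def inner_prod_lincomb unit_sphere_def)
  let ?R = "reflection d w"
  have refl_w: "inner_prod d w (?R v) = - inner_prod d w v" for v
  proof (cases "inner_prod d w w = 0")
    case True
    then have "\<forall>k<d. w k = 0" unfolding inner_prod_self_eq_0 .
    then have "inner_prod d w z = 0" for z by (simp add: inner_prod_def)
    then show ?thesis by simp
  next
    case False
    then show ?thesis by (simp add: reflection_def inner_prod_lincomb inner_prod_commute[of d v w])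
  qed
  have refl_y: "inner_prod d y (?R v) = inner_prod d y v" for v
    using wy by (simp add: reflection_def inner_prod_lincomb inner_prod_commute[of d y w])
  have "(\<integral>v. edge y (?R v) * inner_prod d w (?R v) \<partial>S) = (\<integral>v. edge y v * inner_prod d w v \<partial>S)"
    by (rule integral_reflection_sphere) (use w in measurable)
  then have zero: "(\<integral>v. edge y v * inner_prod d w v \<partial>S) = 0"
    by (simp add: refl_w edge_def refl_y)
  have i: "integrable S (\<lambda>v. edge y v * inner_prod d x v)" if "x \<in> unit_sphere d" for x
    using abs_inner_prod_le_1[OF that] edge_bounds unit_sphereD(1)[OF that]
    by (intro integrable_bounded[where B = 1] abs_mult_le_1) auto
  have "edge y v * inner_prod d w v = edge y v * inner_prod d u v - inner_prod d u y * (edge y v * inner_prod d y v)" for v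
    by (simp add: w_def inner_prod_lincomb algebra_simps)
  then have "0 = (\<integral>v. edge y v * inner_prod d u v \<partial>S) - inner_prod d u y * (\<integral>v. edge y v * inner_prod d y v \<partial>S)"
    using zero i[OF u] i[OF y] by simp
  then show ?thesis
    unfolding integral_edge_inner_prod_self[OF y] by simp
qed

text \<open>Linear functions are eigenfunctions of \<open>edge\<close> with eigenvalue
  \<open>corr\<close>, and \<open>path2\<close> is the kernel of the squared operator.\<close>

lemma integral_path2_inner_prod:
  assumes u: "u \<in> unit_sphere d"
  shows "(\<integral>v. path2 u v * inner_prod d u v \<partial>S) = corr\<^sup>2"
proof -
  note [measurable] = unit_sphereD(1)[OF u]
  \<comment> \<open>\<langle>u, v\<rangle> is bounded on the sphere only, whereas
    \<open>Fubini_bounded\<close> asks for a bound everywhere; the clamped version agrees with it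
    almost surely.\<close>
  define cl where "cl = (\<lambda>v. max (- 1) (min 1 (inner_prod d u v)))"
  have cl: "cl v = inner_prod d u v" if "v \<in> unit_sphere d" for v
    using abs_inner_prod_le_1[OF u that] by (simp add: cl_def)
  have cl1: "\<bar>cl v\<bar> \<le> 1" for v by (simp add: cl_def)
  have [measurable]: "cl \<in> borel_measurable E" unfolding cl_def by measurable
  have "(\<integral>v. path2 u v * inner_prod d u v \<partial>S) = (\<integral>v. (\<integral>y. edge u y * edge y v * cl v \<partial>S) \<partial>S)"
  proof (rule integral_sphere_cong[OF d1])
    fix v assume v: "v \<in> unit_sphere d"
    then show "path2 u v * inner_prod d u v = (\<integral>y. edge u y * edge y v * cl v \<partial>S)"
      by (simp add: path2_def cl)
  qed measurable
  also have "\<dots> = (\<integral>y. (\<integral>v. edge u y * edge y v * cl v \<partial>S) \<partial>S)"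
    using edge_bounds cl1 by (intro Fubini_bounded[where B = 1] abs_mult_le_1) auto
  also have "\<dots> = (\<integral>y. corr * (edge u y * inner_prod d u y) \<partial>S)"
  proof (rule integral_sphere_cong[OF d1])
    fix y assume y: "y \<in> unit_sphere d"
    have "(\<integral>v. edge u y * edge y v * cl v \<partial>S) = (\<integral>v. edge u y * (edge y v * inner_prod d u v) \<partial>S)"
      using unit_sphereD(1)[OF y] by (intro integral_sphere_cong[OF d1]) (auto simp: cl mult.assoc)
    also have "\<dots> = edge u y * (corr * inner_prod d u y)"
      by (simp add: integral_edge_inner_prod[OF u y])
    finally show "(\<integral>v. edge u y * edge y v * cl v \<partial>S) = corr * (edge u y * inner_prod d u y)"
      by simp
  qed measurable
  also have "\<dots> = corr\<^sup>2"
    by (simp add: integral_edge_inner_prod_self[OF u] power2_eq_square)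
  finally show ?thesis .
qed

text \<open>The mean of \<open>path2\<close> times s = \<langle>u, v\<rangle> is corr^2, of order at
  least 1 / d. Where \<bar>s\<bar> \<le> K / sqrt d, the product is at most K / sqrt d times
  \<bar>path2\<bar>; elsewhere \<bar>path2\<bar> \<le> 16 \<bar>s\<bar>, and the fourth moment of s
  makes the contribution small.\<close>

lemma integral_abs_path2_ge:
  assumes u: "u \<in> unit_sphere d"
  shows "(\<integral>v. \<bar>path2 u v\<bar> \<partial>S) \<ge> min_prob ^ 3 / (2 ^ 29 * sqrt (real d))"
proof -
  note [measurable] = unit_sphereD(1)[OF u]
  define r where "r = sqrt (real d)"
  have r: "r \<ge> 1" "real d = r * r" using d by (simp_all add: r_def)
  define m where "m = min_prob"
  have m: "0 < m" "m \<le> 1" using min_prob by (simp_all add: m_def)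
  \<comment> \<open>Makes the fourth-moment term m^2 / (2^16 d), a quarter of the lower bound m^2 /
    (2^14 d) for corr^2.\<close>
  define K where "K = 2 ^ 14 / m"
  have K: "K \<ge> 1" using m by (simp add: K_def field_simps)
  have i1: "integrable S (\<lambda>v. \<bar>path2 u v\<bar>)" using integrable_path2[OF u] by simp
  note i4 = integrable_inner_prod_power[OF d1 u, of 4]
  have "(m / (128 * r))\<^sup>2 \<le> corr\<^sup>2"
    using corr_ge m r(1) by (intro power_mono) (simp_all add: m_def[symmetric] r_def[symmetric])
  also have "\<dots> = (\<integral>v. path2 u v * inner_prod d u v \<partial>S)"
    by (rule integral_path2_inner_prod[OF u, symmetric])
  also have "\<dots> \<le> (\<integral>v. K / r * \<bar>path2 u v\<bar> + 16 * (r * r) / K\<^sup>2 * (inner_prod d u v) ^ 4 \<partial>S)"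
  proof (rule integral_sphere_mono[OF d1])
    show "integrable S (\<lambda>v. path2 u v * inner_prod d u v)"
      using abs_inner_prod_le_1[OF u] path2_le_1[OF u]
      by (intro integrable_bounded[where B = 1] abs_mult_le_1) auto
    fix v assume v: "v \<in> unit_sphere d"
    let ?s = "inner_prod d u v"
    have "path2 u v * ?s \<le> \<bar>path2 u v\<bar> * \<bar>?s\<bar>" by (simp add: abs_mult[symmetric])
    also have "\<dots> \<le> K / r * \<bar>path2 u v\<bar> + 16 * (r * r) / K\<^sup>2 * ?s ^ 4"
    proof (cases "\<bar>?s\<bar> \<le> K / r")
      case True
      then have "\<bar>?s\<bar> * \<bar>path2 u v\<bar> \<le> K / r * \<bar>path2 u v\<bar>" by (intro mult_right_mono) auto
      moreover have "0 \<le> 16 * (r * r) / K\<^sup>2 * ?s ^ 4" by simp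
      ultimately show ?thesis
        unfolding mult.commute[of "\<bar>path2 u v\<bar>" "\<bar>?s\<bar>"] by linarith
    next
      case False
      have nonneg: "0 \<le> K / r * \<bar>path2 u v\<bar>" using K r(1) by simp
      have ge1: "1 \<le> (r * r) / K\<^sup>2 * ?s\<^sup>2"
      proof -
        have "K \<le> r * \<bar>?s\<bar>" using False r by (simp add: field_simps)
        then have "K\<^sup>2 \<le> (r * \<bar>?s\<bar>)\<^sup>2" using K by (intro power_mono) auto
        then show ?thesis using K by (simp add: power_mult_distrib power2_eq_square[of r] field_simps)
      qed
      have "1 / r \<le> K / r" using K r by (intro divide_right_mono) auto
      with False have "1 / r \<le> \<bar>?s\<bar>" by simp
      then have "\<bar>path2 u v\<bar> \<le> 16 * \<bar>?s\<bar>"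
        using abs_path2_bound[OF u v] by (simp add: r_def)
      then have "\<bar>path2 u v\<bar> * \<bar>?s\<bar> \<le> 16 * \<bar>?s\<bar> * \<bar>?s\<bar>" by (intro mult_right_mono) auto
      also have "\<dots> = 16 * ?s\<^sup>2 * 1" by (simp add: power2_eq_square mult.assoc)
      also have "16 * ?s\<^sup>2 * 1 \<le> 16 * ?s\<^sup>2 * ((r * r) / K\<^sup>2 * ?s\<^sup>2)"
        using ge1 by (intro mult_left_mono) auto
      also have "\<dots> = 16 * (r * r) / K\<^sup>2 * ?s ^ 4"
        by (simp add: power4_eq_xxxx power2_eq_square)
      also have "\<dots> \<le> K / r * \<bar>path2 u v\<bar> + 16 * (r * r) / K\<^sup>2 * ?s ^ 4"
        using nonneg by linarith
      finally show ?thesis .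
    qed
    finally show "path2 u v * ?s \<le> K / r * \<bar>path2 u v\<bar> + 16 * (r * r) / K\<^sup>2 * ?s ^ 4" .
  qed (use i1 i4 in auto)
  also have "\<dots> = K / r * (\<integral>v. \<bar>path2 u v\<bar> \<partial>S) + 16 * (r * r) / K\<^sup>2 * (\<integral>v. (inner_prod d u v) ^ 4 \<partial>S)"
    using i1 i4 by simp
  also have "\<dots> \<le> K / r * (\<integral>v. \<bar>path2 u v\<bar> \<partial>S) + 16 * (r * r) / K\<^sup>2 * (256 / (r * r)\<^sup>2)"
    using integral_inner_prod_unit_power4_le[OF d1 u] r(2) by (intro add_left_mono mult_left_mono) auto
  finally have "(m / (128 * r))\<^sup>2 \<le> K / r * (\<integral>v. \<bar>path2 u v\<bar> \<partial>S) + 16 * (r * r) / K\<^sup>2 * (256 / (r * r)\<^sup>2)" .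
  moreover have "(m / (128 * r))\<^sup>2 = m\<^sup>2 / (2 ^ 14 * r\<^sup>2)" by (simp add: power_divide power_mult_distrib)
  moreover have "16 * (r * r) / K\<^sup>2 * (256 / (r * r)\<^sup>2) = m\<^sup>2 / (2 ^ 16 * r\<^sup>2)"
    using r(1) m by (simp add: K_def power_divide power2_eq_square field_simps)
  ultimately have "m\<^sup>2 / (2 ^ 14 * r\<^sup>2) - m\<^sup>2 / (2 ^ 16 * r\<^sup>2) \<le> 2 ^ 14 / m / r * (\<integral>v. \<bar>path2 u v\<bar> \<partial>S)"
    by (simp add: K_def)
  moreover have "m\<^sup>2 / (2 ^ 15 * r\<^sup>2) \<le> m\<^sup>2 / (2 ^ 14 * r\<^sup>2) - m\<^sup>2 / (2 ^ 16 * r\<^sup>2)"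
    using r(1) by (simp add: field_simps)
  ultimately have "m\<^sup>2 / (2 ^ 15 * r\<^sup>2) \<le> 2 ^ 14 / m / r * (\<integral>v. \<bar>path2 u v\<bar> \<partial>S)" by linarith
  then have "m * r / 2 ^ 14 * (m\<^sup>2 / (2 ^ 15 * r\<^sup>2)) \<le> m * r / 2 ^ 14 * (2 ^ 14 / m / r * (\<integral>v. \<bar>path2 u v\<bar> \<partial>S))"
    using m r by (intro mult_left_mono) auto
  also have "\<dots> = (\<integral>v. \<bar>path2 u v\<bar> \<partial>S)" using m r by simp
  also have "m * r / 2 ^ 14 * (m\<^sup>2 / (2 ^ 15 * r\<^sup>2)) = m ^ 3 / (2 ^ 29 * r)"
    using r by (simp add: power2_eq_square power3_eq_cube)
  finally show ?thesis by (simp add: m_def r_def)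
qed

text \<open>The mean product of \<open>edge\<close> over the three sides of a triangle with
  independent uniform vertices; by symmetry one vertex may be held fixed.\<close>

definition triangle :: real where
  "triangle = (\<integral>y. edge (basis_vector d 0) y * path2 (basis_vector d 0) y \<partial>S)"

lemma integral_edge_path2:
  assumes u: "u \<in> unit_sphere d"
  shows "(\<integral>y. edge u y * path2 u y \<partial>S) = triangle"
proof -
  let ?e = "basis_vector d 0"
  define w where "w = lincomb d 1 u (- 1) ?e"
  note [measurable] = unit_sphereD(1)[OF u] unit_sphereD(1)[OF basis0]
  have R: "reflection d w u = ?e" unfolding w_def by (rule reflection_swap[OF u basis0])
  have w [measurable]: "w \<in> space E" by (simp add: w_def)
  have "(\<integral>y. edge u y * path2 u y \<partial>S) =
      (\<integral>y. edge ?e (reflection d w y) * path2 ?e (reflection d w y) \<partial>S)"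
  proof (rule integral_sphere_cong[OF d1])
    fix y assume "y \<in> unit_sphere d"
    then show "edge u y * path2 u y = edge ?e (reflection d w y) * path2 ?e (reflection d w y)"
      using edge_reflection[of w u y] path2_reflection[OF w unit_sphereD(1)[OF u], of y]
      by (simp add: R unit_sphereD(1))
  qed (use w in measurable)
  also have "\<dots> = triangle"
    unfolding triangle_def by (rule integral_reflection_sphere[OF w]) measurable
  finally show ?thesis .
qed

text \<open>The argument for \<open>corr_ge\<close>, with the monotone function
  \<open>path2 ?e\<close> in place of the inner product: \<open>c\<close> is its value at the
  threshold, so \<open>path2 ?e y - c\<close> and \<open>edge ?e y\<close> never have opposite
  signs.\<close>

lemma triangle_ge: "triangle \<ge> min_prob ^ 4 / (2 ^ 30 * sqrt (real d))"
proof -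
  let ?e = "basis_vector d 0" and ?t = "threshold p d"
  note u = basis0
  note [measurable] = unit_sphereD(1)[OF u]
  let ?s = "inner_prod d ?e"
  have int_edge: "(\<integral>y. indicat_real {?t..} (?s y) \<partial>S) = p" by (rule integral_ge_threshold[OF d u p])
  \<comment> \<open>A threshold outside this range would make \<open>p\<close> equal to 0 or 1. The
    bounds turn arccos of the threshold into a genuine angle for the witness
    \<open>v\<close>.\<close>
  have t: "- 1 \<le> ?t" "?t \<le> 1"
  proof -
    show "?t \<le> 1"
    proof (rule ccontr)
      assume "\<not> ?t \<le> 1"
      then have "(\<integral>y. indicat_real {?t..} (?s y) \<partial>S) = (\<integral>y. 0 \<partial>S)"
        using abs_inner_prod_le_1[OF u] by (intro integral_sphere_cong[OF d1]) (force simp: indicator_def)+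
      then show False using int_edge p by simp
    qed
    show "- 1 \<le> ?t"
    proof (rule ccontr)
      assume "\<not> - 1 \<le> ?t"
      then have "(\<integral>y. indicat_real {?t..} (?s y) \<partial>S) = (\<integral>y. 1 \<partial>S)"
        using abs_inner_prod_le_1[OF u] by (intro integral_sphere_cong[OF d1]) (force simp: indicator_def)+
      then show False using int_edge p by (simp add: S.prob_space)
    qed
  qed
  define v where "v = circle_point d (arccos ?t)"
  have v: "v \<in> unit_sphere d" unfolding v_def by (rule circle_point_in_unit_sphere[OF d])
  have ev: "?s v = ?t"
    unfolding inner_prod_commute[of d ?e] v_def inner_prod_circle_point[OF d]
    using t d by (simp add: basis_vector_def)
  define c where "c = path2 ?e v"
  have ip: "integrable S (path2 ?e)" by (rule integrable_path2[OF u])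
  have ie: "integrable S (edge ?e)" by (rule integrable_edge[OF basis0_space])
  have iep: "integrable S (\<lambda>y. edge ?e y * path2 ?e y)"
    using edge_bounds path2_le_1[OF u] by (intro integrable_bounded[where B = 1] abs_mult_le_1) auto
  have "min_prob ^ 3 / (2 ^ 29 * sqrt (real d)) \<le> (\<integral>y. \<bar>path2 ?e y\<bar> \<partial>S)"
    by (rule integral_abs_path2_ge[OF u])
  also have "\<dots> \<le> (\<integral>y. \<bar>path2 ?e y - c\<bar> + \<bar>c\<bar> \<partial>S)"
    using ip by (intro integral_mono) auto
  also have "\<dots> = (\<integral>y. \<bar>path2 ?e y - c\<bar> \<partial>S) + \<bar>c\<bar>"
    using ip by (simp add: S.prob_space)
  also have "\<bar>c\<bar> = \<bar>\<integral>y. path2 ?e y - c \<partial>S\<bar>"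
    using ip integral_path2[OF u] by (simp add: S.prob_space)
  also have "\<dots> \<le> (\<integral>y. \<bar>path2 ?e y - c\<bar> \<partial>S)" by (rule integral_abs_bound)
  finally have "min_prob ^ 3 / (2 ^ 29 * sqrt (real d)) \<le> 2 * (\<integral>y. \<bar>path2 ?e y - c\<bar> \<partial>S)" by simp
  then have "min_prob * (min_prob ^ 3 / (2 ^ 29 * sqrt (real d)) / 2) \<le> min_prob * (\<integral>y. \<bar>path2 ?e y - c\<bar> \<partial>S)"
    using min_prob by (intro mult_left_mono) auto
  also have "\<dots> = (\<integral>y. min_prob * \<bar>path2 ?e y - c\<bar> \<partial>S)" by simp
  also have "\<dots> \<le> (\<integral>y. edge ?e y * (path2 ?e y - c) \<partial>S)"
  proof (rule integral_sphere_mono[OF d1])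
    fix y assume y: "y \<in> unit_sphere d"
    show "min_prob * \<bar>path2 ?e y - c\<bar> \<le> edge ?e y * (path2 ?e y - c)"
    proof (cases "?t \<le> ?s y")
      case True
      then have "c \<le> path2 ?e y" unfolding c_def by (intro path2_mono u v y) (simp add: ev)
      moreover from this have "min_prob * (path2 ?e y - c) \<le> (1 - p) * (path2 ?e y - c)"
        by (intro mult_right_mono) (auto simp: min_prob_def)
      ultimately show ?thesis using True by (simp add: edge_def)
    next
      case False
      then have "path2 ?e y \<le> c" unfolding c_def by (intro path2_mono u v y) (simp add: ev)
      moreover from this have "min_prob * (c - path2 ?e y) \<le> p * (c - path2 ?e y)"
        by (intro mult_right_mono) (auto simp: min_prob_def)
      ultimately show ?thesis using False by (simp add: edge_def algebra_simps)
    qed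
  qed (use ip iep ie in \<open>auto simp: right_diff_distrib\<close>)
  also have "\<dots> = triangle"
    using iep ie integral_edge[OF u] unfolding triangle_def by (simp add: right_diff_distrib)
  finally show ?thesis by (simp add: power4_eq_xxxx power3_eq_cube)
qed

section \<open>Moments of the row likelihood ratio\<close>

lemma exp_le_quadratic:
  fixes x :: real
  shows "exp x \<le> 1 + x + x\<^sup>2 * exp \<bar>x\<bar>"
proof -
  obtain t where t: "\<bar>t\<bar> \<le> \<bar>x\<bar>" "exp x = (\<Sum>m<2. x ^ m / fact m) + exp t / fact 2 * x ^ 2"
    using Maclaurin_exp_le[of x 2] by blast
  have "exp x = 1 + x + exp t / 2 * x\<^sup>2" using t(2) by (simp add: numeral_2_eq_2)
  also have "exp t / 2 * x\<^sup>2 \<le> exp \<bar>x\<bar> * x\<^sup>2"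
  proof (rule mult_right_mono)
    have "exp t / 2 \<le> exp t" by simp
    also have "\<dots> \<le> exp \<bar>x\<bar>" using t(1) by simp
    finally show "exp t / 2 \<le> exp \<bar>x\<bar>" .
  qed simp
  finally show ?thesis by (simp add: mult.commute)
qed

text \<open>The power is at most exp (k r path2). In its second-order expansion the linear term
  vanishes, because \<open>path2 y\<close> has mean zero; in the remainder k r \<bar>path2\<bar>
  \<le> \<epsilon> (\<bar>w\<bar> + 1) with w = sqrt d \<langle>y, z\<rangle>, whose exponential
  moments are bounded uniformly in d.\<close>

lemma integral_path2_power_le:
  assumes y: "y \<in> unit_sphere d" and r: "0 \<le> r" "r * (p * (1 - p)) \<le> 1"
    and k: "8 * real k * r \<le> sqrt (real d)"
  shows "(\<integral>z. (1 + r * path2 y z) ^ k \<partial>S) \<le> 1 + 256 * exp 4 * (real k)\<^sup>2 * r\<^sup>2 / real d"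
proof -
  note [measurable] = unit_sphereD(1)[OF y]
  define \<epsilon> where "\<epsilon> = 8 * real k * r / sqrt (real d)"
  \<comment> \<open>The hypothesis on \<open>k\<close> amounts to \<epsilon> \<le> 1. It bounds the
    exponential in the remainder by exp (\<bar>w\<bar> + 1), while the square in front keeps its
    factor \<epsilon>^2.\<close>
  have \<epsilon>: "0 \<le> \<epsilon>" "\<epsilon> \<le> 1" using k r d by (auto simp: \<epsilon>_def)
  let ?w = "\<lambda>z. sqrt (real d) * inner_prod d y z"
  let ?x = "\<lambda>z. real k * r * path2 y z"
  have iw: "integrable S (\<lambda>z. exp (c * ?w z))" for c
  proof (rule integrable_bounded[where B = "exp (\<bar>c\<bar> * sqrt (real d))"])
    fix z assume "z \<in> unit_sphere d"
    then have "\<bar>c\<bar> * sqrt (real d) * \<bar>inner_prod d y z\<bar> \<le> \<bar>c\<bar> * sqrt (real d) * 1"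
      by (intro mult_left_mono abs_inner_prod_le_1 y) auto
    then have "\<bar>c * ?w z\<bar> \<le> \<bar>c\<bar> * sqrt (real d)" by (simp add: abs_mult mult.assoc)
    then show "\<bar>exp (c * ?w z)\<bar> \<le> exp (\<bar>c\<bar> * sqrt (real d))" by simp
  qed measurable
  have "(\<integral>z. (1 + r * path2 y z) ^ k \<partial>S) \<le>
      (\<integral>z. 1 + ?x z + 2 * \<epsilon>\<^sup>2 * exp 2 * (exp (2 * ?w z) + exp (- 2 * ?w z)) \<partial>S)"
  proof (rule integral_sphere_mono[OF d1])
    have bd: "\<bar>r * path2 y z\<bar> \<le> 1" if z: "z \<in> unit_sphere d" for z
    proof -
      have "r * \<bar>path2 y z\<bar> \<le> r * (p * (1 - p))"
        using r by (intro mult_left_mono abs_path2_le y z) auto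
      then show ?thesis using r by (simp add: abs_mult)
    qed
    show "integrable S (\<lambda>z. (1 + r * path2 y z) ^ k)"
    proof (rule integrable_bounded[where B = "2 ^ k"])
      fix z assume "z \<in> unit_sphere d"
      then show "\<bar>(1 + r * path2 y z) ^ k\<bar> \<le> 2 ^ k"
        unfolding power_abs using bd[of z] by (intro power_mono) auto
    qed measurable
    show "integrable S (\<lambda>z. 1 + ?x z + 2 * \<epsilon>\<^sup>2 * exp 2 * (exp (2 * ?w z) + exp (- 2 * ?w z)))"
      using integrable_path2[OF y] iw[of 2] iw[of "-2"] by auto
    fix z assume z: "z \<in> unit_sphere d"
    have "(1 + r * path2 y z) ^ k \<le> exp (r * path2 y z) ^ k"
      using bd[OF z] by (intro power_mono exp_ge_add_one_self) auto
    also have "\<dots> = exp (?x z)" by (simp add: exp_of_nat_mult[symmetric] mult.assoc)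
    also have "\<dots> \<le> 1 + ?x z + (?x z)\<^sup>2 * exp \<bar>?x z\<bar>" by (rule exp_le_quadratic)
    also have "(?x z)\<^sup>2 * exp \<bar>?x z\<bar> \<le> 2 * \<epsilon>\<^sup>2 * exp 2 * (exp (2 * ?w z) + exp (- 2 * ?w z))"
    proof -
      let ?v = "\<bar>?w z\<bar> + 1"
      have "\<bar>?x z\<bar> = real k * r * \<bar>path2 y z\<bar>" using r by (simp add: abs_mult)
      also have "\<dots> \<le> real k * r * (8 * (\<bar>inner_prod d y z\<bar> + 1 / sqrt (real d)))"
        using r by (intro mult_left_mono abs_path2_bound y z) auto
      also have "\<dots> = \<epsilon> * ?v"
        using d by (simp add: \<epsilon>_def abs_mult field_simps)
      finally have x: "\<bar>?x z\<bar> \<le> \<epsilon> * ?v" .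
      have "\<epsilon> * ?v \<le> 1 * ?v" using \<epsilon> by (intro mult_right_mono) auto
      with x have x': "\<bar>?x z\<bar> \<le> ?v" by (simp only: mult_1)
      have "\<bar>?x z\<bar>\<^sup>2 \<le> (\<epsilon> * ?v)\<^sup>2" using x by (intro power_mono) auto
      then have "(?x z)\<^sup>2 * exp \<bar>?x z\<bar> \<le> (\<epsilon> * ?v)\<^sup>2 * exp ?v"
        using x' by (intro mult_mono) auto
      also have "\<dots> = \<epsilon>\<^sup>2 * (?v\<^sup>2 * exp ?v)" by (simp add: power_mult_distrib)
      also have "\<dots> \<le> \<epsilon>\<^sup>2 * (2 * exp ?v * exp ?v)"
        using exp_lower_Taylor_quadratic[of ?v] by (intro mult_left_mono mult_right_mono) auto
      also have "2 * exp ?v * exp ?v = 2 * (exp 2 * exp (2 * \<bar>?w z\<bar>))"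
        by (simp add: mult_exp_exp algebra_simps)
      also have "\<epsilon>\<^sup>2 * (2 * (exp 2 * exp (2 * \<bar>?w z\<bar>))) \<le> \<epsilon>\<^sup>2 * (2 * (exp 2 * (exp (2 * ?w z) + exp (- 2 * ?w z))))"
      proof (intro mult_left_mono)
        show "exp (2 * \<bar>?w z\<bar>) \<le> exp (2 * ?w z) + exp (- 2 * ?w z)"
          by (cases "?w z \<ge> 0") (simp_all add: abs_if)
      qed auto
      also have "\<dots> = 2 * \<epsilon>\<^sup>2 * exp 2 * (exp (2 * ?w z) + exp (- 2 * ?w z))"
        by (simp only: mult_ac)
      finally show ?thesis .
    qed
    finally show "(1 + r * path2 y z) ^ k \<le> 1 + ?x z + 2 * \<epsilon>\<^sup>2 * exp 2 * (exp (2 * ?w z) + exp (- 2 * ?w z))"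
      by simp
  qed
  also have "\<dots> = 1 + 2 * \<epsilon>\<^sup>2 * exp 2 * ((\<integral>z. exp (2 * ?w z) \<partial>S) + (\<integral>z. exp (- 2 * ?w z) \<partial>S))"
    using integrable_path2[OF y] iw[of 2] iw[of "-2"] integral_path2[OF y] by (simp add: S.prob_space)
  also have "\<dots> \<le> 1 + 2 * \<epsilon>\<^sup>2 * exp 2 * (exp 2 + exp 2)"
    using integral_exp_inner_prod_unit_le[OF d1 y, of 2] integral_exp_inner_prod_unit_le[OF d1 y, of "-2"]
    by (intro add_left_mono mult_left_mono add_mono) (auto simp: mult.assoc)
  also have "\<dots> = 1 + 4 * \<epsilon>\<^sup>2 * exp 4"
    by (simp add: mult_exp_exp)
  also have "\<epsilon>\<^sup>2 = 64 * (real k)\<^sup>2 * r\<^sup>2 / real d"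
    by (simp add: \<epsilon>_def power_divide power_mult_distrib)
  finally show ?thesis by (simp add: mult_ac)
qed

end

subsection \<open>Laws of random graphs as finite sums\<close>

text \<open>The probability that exactly the pairs in \<open>F\<close> are edges, when the pairs in
  \<open>V\<close> are independent. Graphs are kept as sets of ordered pairs, at which
  \<open>w\<close> can be evaluated; \<open>edge_sets\<close> translates them to sets of
  edges.\<close>

definition graph_weight :: "(nat \<times> nat) set \<Rightarrow> (nat \<Rightarrow> nat \<Rightarrow> real) \<Rightarrow> (nat \<times> nat) set \<Rightarrow> real" where
  "graph_weight V w F = (\<Prod>e\<in>V. if e \<in> F then w (fst e) (snd e) else 1 - w (fst e) (snd e))"

definition edge_sets :: "(nat \<times> nat) set \<Rightarrow> nat set set" where
  "edge_sets F = (\<lambda>(i, j). {i, j}) ` F"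

lemma prod_if_mem:
  fixes f g :: "'a \<Rightarrow> real"
  assumes "finite V" "F \<subseteq> V"
  shows "(\<Prod>e\<in>V. if e \<in> F then f e else g e) = prod f F * prod g (V - F)"
  using assms by (simp add: prod.If_cases Int_absorb1 Diff_eq)

text \<open>Independence of the pairs: the expectation of a product is the product of the
  expectations. Normalisation and all triangle moments are instances.\<close>

lemma sum_graph_weight_prod:
  assumes V: "finite V"
  shows "(\<Sum>F\<in>Pow V. graph_weight V w F * (\<Prod>e\<in>V. h e (e \<in> F))) =
    (\<Prod>e\<in>V. w (fst e) (snd e) * h e True + (1 - w (fst e) (snd e)) * h e False)"
proof -
  have "graph_weight V w F * (\<Prod>e\<in>V. h e (e \<in> F)) =
      (\<Prod>e\<in>F. w (fst e) (snd e) * h e True) * (\<Prod>e\<in>V - F. (1 - w (fst e) (snd e)) * h e False)"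
    if "F \<in> Pow V" for F
  proof -
    have "graph_weight V w F * (\<Prod>e\<in>V. h e (e \<in> F)) =
        (\<Prod>e\<in>V. if e \<in> F then w (fst e) (snd e) * h e True else (1 - w (fst e) (snd e)) * h e False)"
      unfolding graph_weight_def prod.distrib[symmetric] by (intro prod.cong) auto
    then show ?thesis using that V by (simp add: prod_if_mem)
  qed
  then show ?thesis by (simp add: prod_add[OF V])
qed

lemma sum_graph_weight:
  assumes "finite V"
  shows "(\<Sum>F\<in>Pow V. graph_weight V w F) = 1"
  using sum_graph_weight_prod[OF assms, of w "\<lambda>_ _. 1"] by simp

lemma graph_weight_bounds:
  assumes "\<And>i j. (i, j) \<in> V \<Longrightarrow> 0 \<le> w i j \<and> w i j \<le> 1"
  shows "0 \<le> graph_weight V w F" "graph_weight V w F \<le> 1"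
proof -
  have "0 \<le> w (fst e) (snd e) \<and> w (fst e) (snd e) \<le> 1" if "e \<in> V" for e
    using assms[of "fst e" "snd e"] that by simp
  then show "0 \<le> graph_weight V w F" "graph_weight V w F \<le> 1"
    unfolding graph_weight_def by (auto intro!: prod_nonneg prod_le_1)
qed

text \<open>The random Boolean function is replaced by its support; the default value False outside
  \<open>vertex_pairs n\<close> makes the function recoverable. Events of the random graphs thereby
  become finite sums over pair sets.\<close>

lemma measure_independent_edges:
  assumes w: "\<And>i j. (i, j) \<in> vertex_pairs n \<Longrightarrow> 0 \<le> w i j \<and> w i j \<le> 1"
  shows "measure (measure_pmf (independent_edges n w)) A =
    (\<Sum>F | F \<subseteq> vertex_pairs n \<and> edge_sets F \<in> A. graph_weight (vertex_pairs n) w F)"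
proof -
  let ?V = "vertex_pairs n"
  have V: "finite ?V" by (rule finite_vertex_pairs)
  define P where "P = Pi_pmf ?V False (\<lambda>(i, j). bernoulli_pmf (w i j))"
  define c where "c = (\<lambda>f :: nat \<times> nat \<Rightarrow> bool. {e \<in> ?V. f e})"
  have c: "independent_edges n w = map_pmf edge_sets (map_pmf c P)"
    unfolding independent_edges_def P_def map_pmf_comp
    by (intro arg_cong2[where f = map_pmf] ext refl) (auto simp: edge_sets_def c_def)
  have set: "set_pmf (map_pmf c P) \<subseteq> Pow ?V" by (auto simp: c_def)
  have pmf: "pmf (map_pmf c P) F = graph_weight ?V w F" if F: "F \<subseteq> ?V" for F
  proof -
    have "pmf (map_pmf c P) F = measure (measure_pmf P) (c -` {F} \<inter> set_pmf P)"
      by (simp add: pmf_map measure_Int_set_pmf)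
    also have "c -` {F} \<inter> set_pmf P = {\<lambda>e. e \<in> F} \<inter> set_pmf P"
    proof -
      have "f = (\<lambda>e. e \<in> F)" if "c f = F" "f \<in> set_pmf P" for f
      proof -
        have "f e = False" if "e \<notin> ?V" for e
          using that \<open>f \<in> set_pmf P\<close> set_Pi_pmf_subset[OF V, of False "\<lambda>(i, j). bernoulli_pmf (w i j)"]
          unfolding P_def by blast
        then show ?thesis using \<open>c f = F\<close> by (auto simp: c_def fun_eq_iff)
      qed
      moreover have "c (\<lambda>e. e \<in> F) = F" using F by (auto simp: c_def)
      ultimately show ?thesis by auto
    qed
    also have "measure (measure_pmf P) ({\<lambda>e. e \<in> F} \<inter> set_pmf P) = pmf P (\<lambda>e. e \<in> F)"
      by (simp add: measure_Int_set_pmf measure_pmf_single)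
    also have "\<dots> = graph_weight ?V w F"
      unfolding P_def graph_weight_def using F w
      by (subst pmf_Pi'[OF V]) (auto intro!: prod.cong)
    finally show ?thesis .
  qed
  have fin: "finite (Pow ?V)" using V by simp
  have "measure (measure_pmf (independent_edges n w)) A = measure (measure_pmf (map_pmf c P)) (edge_sets -` A)"
    unfolding c by simp
  also have "\<dots> = measure (measure_pmf (map_pmf c P)) (edge_sets -` A \<inter> Pow ?V)"
    using set by (intro measure_eq_AE) (auto simp: AE_measure_pmf_iff)
  also have "\<dots> = (\<Sum>F\<in>edge_sets -` A \<inter> Pow ?V. pmf (map_pmf c P) F)"
    using fin by (intro measure_measure_pmf_finite) auto
  also have "edge_sets -` A \<inter> Pow ?V = {F. F \<subseteq> ?V \<and> edge_sets F \<in> A}" by auto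
  also have "(\<Sum>F\<in>\<dots>. pmf (map_pmf c P) F) = (\<Sum>F\<in>\<dots>. graph_weight ?V w F)"
    by (intro sum.cong) (auto simp: pmf)
  finally show ?thesis .
qed

lemma inj_on_edge_sets: "inj_on edge_sets (Pow (vertex_pairs n))"
  unfolding edge_sets_def
  by (rule inj_on_image_Pow) (auto simp: inj_on_def vertex_pairs_def doubleton_eq_iff)

context sphere_graph
begin

section \<open>Graph laws as mixtures over latent points\<close>

abbreviation "latent n \<equiv> latent_points n d"

sublocale latent: prob_space "latent n" for n by (rule prob_space_latent_points)

lemma measurable_latent_component [measurable]:
  assumes "i \<in> {1..n}"
  shows "(\<lambda>x. x i) \<in> latent n \<rightarrow>\<^sub>M E"
  using measurable_component_singleton[OF assms, of "\<lambda>_. S"]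
  by (simp add: latent_points_def measurable_cong_sets[OF refl sets_sphere_uniform])

definition prob :: "real \<Rightarrow> (nat \<Rightarrow> nat \<Rightarrow> real) \<Rightarrow> nat \<Rightarrow> nat \<Rightarrow> real" where
  "prob q x i j = p + q * edge (x i) (x j)"

lemma prob_eq_connection_prob: "prob q x i j = connection_prob p d q (inner_prod d (x i) (x j))"
  by (simp add: prob_def edge_def connection_prob_def algebra_simps)

lemma prob_bounds:
  assumes "0 \<le> q" "q \<le> 1"
  shows "0 \<le> prob q x i j" "prob q x i j \<le> 1"
proof -
  have "0 \<le> q * p" "0 \<le> q * (1 - p)" "q * p \<le> 1 * p" "q * (1 - p) \<le> 1 * (1 - p)"
    using assms p by (auto intro!: mult_right_mono simp del: mult_1)
  then have "0 \<le> p + q * (1 - p) \<and> p + q * (1 - p) \<le> 1" "0 \<le> p + q * (- p) \<and> p + q * (- p) \<le> 1"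
    using p by (simp_all add: algebra_simps)
  then have "0 \<le> p + q * e \<and> p + q * e \<le> 1" if "e = 1 - p \<or> e = - p" for e
    using that by blast
  from this[OF edge_cases[of "x i" "x j"]] show "0 \<le> prob q x i j" "prob q x i j \<le> 1"
    by (simp_all add: prob_def)
qed

lemma measurable_prob [measurable]:
  assumes "(i, j) \<in> vertex_pairs n"
  shows "(\<lambda>x. prob q x i j) \<in> borel_measurable (latent n)"
proof -
  have "i \<in> {1..n}" "j \<in> {1..n}" using assms by (auto simp: vertex_pairs_def)
  then show ?thesis
    unfolding prob_def
    by (intro borel_measurable_add borel_measurable_times borel_measurable_const measurable_edge
        measurable_latent_component)
qed

lemma measurable_graph_weight [measurable]:
  "(\<lambda>x. graph_weight (vertex_pairs n) (prob q x) F) \<in> borel_measurable (latent n)"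
  unfolding graph_weight_def
proof (rule borel_measurable_prod)
  fix e assume "e \<in> vertex_pairs n"
  then have "(\<lambda>x. prob q x (fst e) (snd e)) \<in> borel_measurable (latent n)"
    using measurable_prob[of "fst e" "snd e"] by simp
  then show "(\<lambda>x. if e \<in> F then prob q x (fst e) (snd e) else 1 - prob q x (fst e) (snd e)) \<in> borel_measurable (latent n)"
    by simp
qed

lemma integrable_latent:
  fixes F :: "(nat \<Rightarrow> nat \<Rightarrow> real) \<Rightarrow> real"
  assumes "F \<in> borel_measurable (latent n)" "\<And>x. \<bar>F x\<bar> \<le> B"
  shows "integrable (latent n) F"
  using assms by (intro latent.integrable_const_bound[where B = B]) auto

text \<open>At \<open>q = 0\<close> the latent points have no influence, so one function describes
  both laws, and estimates for general \<open>q\<close> specialise to the Erdos-Renyi graph.\<close>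

definition graph_prob :: "nat \<Rightarrow> real \<Rightarrow> (nat \<times> nat) set \<Rightarrow> real" where
  "graph_prob n q F = (\<integral>x. graph_weight (vertex_pairs n) (prob q x) F \<partial>latent n)"

lemma integrable_graph_weight:
  assumes "0 \<le> q" "q \<le> 1"
  shows "integrable (latent n) (\<lambda>x. graph_weight (vertex_pairs n) (prob q x) F)"
  using graph_weight_bounds[of _ "prob q _"] prob_bounds[OF assms]
  by (intro integrable_latent[where B = 1]) (auto simp: abs_le_iff intro: order_trans[of _ 0])

lemma graph_prob_nonneg: "0 \<le> q \<Longrightarrow> q \<le> 1 \<Longrightarrow> 0 \<le> graph_prob n q F"
  unfolding graph_prob_def
  using graph_weight_bounds(1)[of _ "prob q _"] prob_bounds[of q] by (intro integral_nonneg_AE AE_I2) auto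

lemma graph_prob_0: "graph_prob n 0 F = graph_weight (vertex_pairs n) (\<lambda>_ _. p) F"
proof -
  have "prob 0 x = (\<lambda>_ _. p)" for x by (simp add: prob_def fun_eq_iff)
  then show ?thesis by (simp add: graph_prob_def latent.prob_space)
qed

lemma measure_erdos_renyi:
  "measure (erdos_renyi n p) A = (\<Sum>F | F \<subseteq> vertex_pairs n \<and> edge_sets F \<in> A. graph_prob n 0 F)"
  unfolding erdos_renyi_def using p by (subst measure_independent_edges) (auto simp: graph_prob_0)

lemma measure_geometric_graph:
  assumes q: "0 \<le> q" "q \<le> 1"
  shows "measure (geometric_graph n p d q) A = (\<Sum>F | F \<subseteq> vertex_pairs n \<and> edge_sets F \<in> A. graph_prob n q F)"
proof -
  have "measure (geometric_graph n p d q) A =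
      (\<integral>x. measure (measure_pmf (independent_edges n (prob q x))) A \<partial>latent n)"
    unfolding geometric_graph_def prob_eq_connection_prob
    by (rule latent.measure_bind[OF measurable_geometric_graph_kernel]) simp
  also have "\<dots> = (\<integral>x. (\<Sum>F | F \<subseteq> vertex_pairs n \<and> edge_sets F \<in> A. graph_weight (vertex_pairs n) (prob q x) F) \<partial>latent n)"
    using prob_bounds[OF q] by (subst measure_independent_edges) auto
  also have "\<dots> = (\<Sum>F | F \<subseteq> vertex_pairs n \<and> edge_sets F \<in> A. graph_prob n q F)"
    unfolding graph_prob_def by (rule Bochner_Integration.integral_sum) (rule integrable_graph_weight[OF q])
  finally show ?thesis .
qed

lemma finite_subgraphs: "finite {F. F \<subseteq> vertex_pairs n \<and> Q F}"
  by (rule finite_subset[of _ "Pow (vertex_pairs n)"]) (auto simp: finite_vertex_pairs)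

lemma sum_graph_prob:
  assumes q: "0 \<le> q" "q \<le> 1"
  shows "(\<Sum>F\<in>Pow (vertex_pairs n). graph_prob n q F) = 1"
  unfolding graph_prob_def
  by (subst Bochner_Integration.integral_sum[symmetric])
     (simp_all add: integrable_graph_weight[OF q] sum_graph_weight finite_vertex_pairs latent.prob_space)

lemma total_variation_le:
  assumes q: "0 \<le> q" "q \<le> 1"
  shows "total_variation (erdos_renyi n p) (geometric_graph n p d q) \<le>
    (\<Sum>F\<in>Pow (vertex_pairs n). \<bar>graph_prob n q F - graph_prob n 0 F\<bar>)"
  unfolding total_variation_def
proof (rule cSUP_least)
  fix A
  let ?G = "{F. F \<subseteq> vertex_pairs n \<and> edge_sets F \<in> A}"
  have "\<bar>measure (erdos_renyi n p) A - measure (geometric_graph n p d q) A\<bar> =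
      \<bar>\<Sum>F\<in>?G. graph_prob n 0 F - graph_prob n q F\<bar>"
    by (simp add: measure_erdos_renyi measure_geometric_graph q sum_subtractf)
  also have "\<dots> \<le> (\<Sum>F\<in>?G. \<bar>graph_prob n 0 F - graph_prob n q F\<bar>)" by (rule sum_abs)
  also have "\<dots> \<le> (\<Sum>F\<in>Pow (vertex_pairs n). \<bar>graph_prob n 0 F - graph_prob n q F\<bar>)"
    by (intro sum_mono2) (auto simp: finite_vertex_pairs)
  finally show "\<bar>measure (erdos_renyi n p) A - measure (geometric_graph n p d q) A\<bar> \<le>
      (\<Sum>F\<in>Pow (vertex_pairs n). \<bar>graph_prob n q F - graph_prob n 0 F\<bar>)"
    by (simp add: abs_minus_commute)
qed (auto simp: sets_erdos_renyi)

lemma total_variation_bounds: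
  shows "\<bar>measure (erdos_renyi n p) A - measure (geometric_graph n p d q) A\<bar> \<le>
      total_variation (erdos_renyi n p) (geometric_graph n p d q)"
    and "total_variation (erdos_renyi n p) (geometric_graph n p d q) \<le> 1"
proof -
  interpret ER: prob_space "erdos_renyi n p" by (simp add: erdos_renyi_def measure_pmf.prob_space_axioms)
  interpret G: prob_space "geometric_graph n p d q" by (rule prob_space_geometric_graph)
  have le: "\<bar>measure (erdos_renyi n p) A - measure (geometric_graph n p d q) A\<bar> \<le> 1" for A
    using ER.prob_le_1[of A] G.prob_le_1[of A]
      measure_nonneg[of "erdos_renyi n p" A] measure_nonneg[of "geometric_graph n p d q" A] by linarith
  then have "bdd_above (range (\<lambda>A. \<bar>measure (erdos_renyi n p) A - measure (geometric_graph n p d q) A\<bar>))"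
    by (auto intro!: bdd_aboveI)
  then show "\<bar>measure (erdos_renyi n p) A - measure (geometric_graph n p d q) A\<bar> \<le>
      total_variation (erdos_renyi n p) (geometric_graph n p d q)"
    unfolding total_variation_def sets_erdos_renyi by (intro cSUP_upper) auto
  show "total_variation (erdos_renyi n p) (geometric_graph n p d q) \<le> 1"
    unfolding total_variation_def using le by (intro cSUP_least) (auto simp: sets_erdos_renyi)
qed

text \<open>Integrates out vertex \<open>i\<close> without leaving the space
  \<open>latent n\<close>: the old coordinate stays behind as a dummy, so vertices can be removed in
  any order.\<close>

lemma latent_resample:
  fixes F :: "(nat \<Rightarrow> nat \<Rightarrow> real) \<Rightarrow> real"
  assumes i: "i \<in> {1..n}" and F [measurable]: "F \<in> borel_measurable (latent n)" and B: "\<And>x. \<bar>F x\<bar> \<le> B"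
  shows "(\<integral>x. F x \<partial>latent n) = (\<integral>x. (\<integral>y. F (x(i := y)) \<partial>S) \<partial>latent n)"
proof -
  interpret product_sigma_finite "\<lambda>_ :: nat. S"
    by standard
  let ?I = "{1..n} - {i}"
  have ins: "insert i ?I = {1..n}" using i by auto
  have L: "latent n = PiM (insert i ?I) (\<lambda>_. S)" unfolding latent_points_def ins ..
  have upd: "(\<lambda>(x, y). x(i := y)) \<in> latent n \<Otimes>\<^sub>M S \<rightarrow>\<^sub>M latent n"
    unfolding latent_points_def
  proof (rule measurable_PiM_single')
    fix k assume k: "k \<in> {1..n}"
    show "(\<lambda>\<omega>. (case \<omega> of (x, y) \<Rightarrow> x(i := y)) k) \<in> PiM {1..n} (\<lambda>_. S) \<Otimes>\<^sub>M S \<rightarrow>\<^sub>M S"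
      using k by (cases "k = i") (simp_all add: case_prod_beta)
  qed (use i in \<open>auto simp: space_pair_measure space_PiM PiE_iff extensional_def\<close>)
  have mH: "(\<lambda>x. \<integral>y. F (x(i := y)) \<partial>S) \<in> borel_measurable (latent n)"
    using measurable_compose[OF upd F]
    by (intro S.borel_measurable_lebesgue_integral) (simp add: case_prod_beta')
  have bound: "\<bar>\<integral>y. F (x(i := y)) \<partial>S\<bar> \<le> B" for x
    using B by (rule abs_integral_le)
  have "(\<integral>x. F x \<partial>latent n) = (\<integral>x. (\<integral>y. F (x(i := y)) \<partial>S) \<partial>PiM ?I (\<lambda>_. S))"
    unfolding L by (rule product_integral_insert) (use integrable_latent[OF F B] in \<open>auto simp: L\<close>)
  \<comment> \<open>Resampling coordinate \<open>i\<close> twice is the same as resampling it once,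
    so the integral over \<open>z\<close> is that of a constant.\<close>
  moreover have "(\<integral>x. (\<integral>y. F (x(i := y)) \<partial>S) \<partial>latent n) =
      (\<integral>x. (\<integral>z. (\<integral>y. F ((x(i := z))(i := y)) \<partial>S) \<partial>S) \<partial>PiM ?I (\<lambda>_. S))"
    unfolding L by (rule product_integral_insert) (use integrable_latent[OF mH bound] in \<open>auto simp: L\<close>)
  ultimately show ?thesis by (simp add: S.prob_space)
qed

lemma AE_latent_unit_sphere: "AE x in latent n. \<forall>i\<in>{1..n}. x i \<in> unit_sphere d"
proof (rule AE_finite_allI)
  fix i assume i: "i \<in> {1..n}"
  show "AE x in latent n. x i \<in> unit_sphere d"
    unfolding latent_points_def
    using AE_unit_sphere[OF d1] by (intro AE_PiM_component i) (auto intro: prob_space_sphere_uniform)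
qed simp

end

subsection \<open>Signed triangles\<close>

definition pairs_in :: "nat set \<Rightarrow> (nat \<times> nat) set" where
  "pairs_in A = {(i, j). i \<in> A \<and> j \<in> A \<and> i < j}"

definition triples :: "nat \<Rightarrow> nat set set" where
  "triples n = {A. A \<subseteq> {1..n} \<and> card A = 3}"

definition signed_triangles :: "nat \<Rightarrow> real \<Rightarrow> (nat \<times> nat) set \<Rightarrow> real" where
  "signed_triangles n p F = (\<Sum>A\<in>triples n. \<Prod>e\<in>pairs_in A. of_bool (e \<in> F) - p)"

lemma finite_triples: "finite (triples n)"
  unfolding triples_def by (rule finite_subset[of _ "Pow {1..n}"]) auto

lemma card_triples: "card (triples n) = n choose 3"
  using n_subsets[of "{1..n}" 3] by (simp add: triples_def)

lemma card_triples_le: "card (triples n) \<le> n ^ 3"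
  unfolding card_triples by (cases "3 \<le> n") (auto intro: binomial_le_pow simp: binomial_eq_0)

lemma pairs_in_subset: "A \<in> triples n \<Longrightarrow> pairs_in A \<subseteq> vertex_pairs n"
  by (auto simp: triples_def pairs_in_def vertex_pairs_def)

text \<open>\<open>pairs_in\<close> lists each pair in increasing order, while the vertices of a
  triangle arrive in any order; the symmetry of \<phi> reconciles the two.\<close>

lemma prod_pairs_in:
  fixes \<phi> :: "nat \<Rightarrow> nat \<Rightarrow> real"
  assumes sym: "\<And>i j. \<phi> i j = \<phi> j i" and ne: "a \<noteq> b" "a \<noteq> c" "b \<noteq> c"
  shows "(\<Prod>e\<in>pairs_in {a, b, c}. \<phi> (fst e) (snd e)) = \<phi> a b * \<phi> a c * \<phi> b c"
proof -
  have sorted: "(\<Prod>e\<in>pairs_in {a, b, c}. \<phi> (fst e) (snd e)) = \<phi> a b * \<phi> a c * \<phi> b c"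
    if "a < b" "b < c" for a b c
  proof -
    have "pairs_in {a, b, c} = {(a, b), (a, c), (b, c)}"
      using that by (auto simp: pairs_in_def)
    then show ?thesis using that by simp
  qed
  consider "a < b" "b < c" | "a < c" "c < b" | "b < a" "a < c" | "b < c" "c < a" | "c < a" "a < b" | "c < b" "b < a"
    using ne by linarith
  then show ?thesis
  proof cases
    case 1 then show ?thesis by (rule sorted)
  next
    case 2
    have "{a, b, c} = {a, c, b}" by auto
    then show ?thesis using sorted[OF 2] sym[of c b] by simp
  next
    case 3
    have "{a, b, c} = {b, a, c}" by auto
    then show ?thesis using sorted[OF 3] sym[of b a] by simp
  next
    case 4
    have "{a, b, c} = {b, c, a}" by auto
    then show ?thesis using sorted[OF 4] sym[of b a] sym[of c a] by simp
  next
    case 5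
    have "{a, b, c} = {c, a, b}" by auto
    then show ?thesis using sorted[OF 5] sym[of c b] sym[of c a] by simp
  next
    case 6
    have "{a, b, c} = {c, b, a}" by auto
    then show ?thesis using sorted[OF 6] sym[of c b] sym[of c a] sym[of b a] by simp
  qed
qed

lemma tripleE:
  assumes "A \<in> triples n"
  obtains a b c where "A = {a, b, c}" "a \<noteq> b" "a \<noteq> c" "b \<noteq> c" "{a, b, c} \<subseteq> {1..n}"
  using assms by (auto simp: triples_def card_3_iff)

lemma triples_share_two:
  assumes A: "A \<in> triples n" and B: "B \<in> triples n" and AB: "card (A \<inter> B) = 2"
  obtains a b c e where "A = {a, b, c}" "B = {a, b, e}" "distinct [a, b, c, e]" "{a, b, c, e} \<subseteq> {1..n}"
proof -
  have fin: "finite A" "finite B" "card A = 3" "card B = 3" "A \<subseteq> {1..n}" "B \<subseteq> {1..n}"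
    using A B by (auto simp: triples_def intro: card_ge_0_finite)
  obtain a b where ab: "A \<inter> B = {a, b}" "a \<noteq> b" using AB by (auto simp: card_2_iff)
  have "card (A - A \<inter> B) = 1" "card (B - A \<inter> B) = 1"
    using fin AB by (auto simp: card_Diff_subset)
  then obtain c e where c: "A - A \<inter> B = {c}" and e: "B - A \<inter> B = {e}"
    by (auto simp: card_1_singleton_iff)
  have "A = {a, b, c}" "B = {a, b, e}" using ab c e by auto
  moreover have "distinct [a, b, c, e]" using ab c e by auto
  ultimately show ?thesis using fin by (intro that[of a b c e]) auto
qed

text \<open>The vertices \<open>b\<close> and \<open>c\<close> occur in no pair of
  \<open>pairs_in B\<close>, so a triangle on \<open>A\<close> can be integrated out with the other
  triangle held as a weight.\<close>

lemma triple_split: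
  assumes A: "A \<in> triples n" and AB: "card (A \<inter> B) \<le> 1"
  obtains a b c where "A = {a, b, c}" "a \<noteq> b" "a \<noteq> c" "b \<noteq> c" "{a, b, c} \<subseteq> {1..n}" "b \<notin> B" "c \<notin> B"
proof -
  obtain x y z where xyz: "A = {x, y, z}" "x \<noteq> y" "x \<noteq> z" "y \<noteq> z" "{x, y, z} \<subseteq> {1..n}"
    using A by (rule tripleE)
  have two: False if "u \<in> A \<inter> B" "v \<in> A \<inter> B" "u \<noteq> v" for u v
  proof -
    have "card {u, v} \<le> card (A \<inter> B)" using that xyz(1) by (intro card_mono) auto
    then show False using that AB by simp
  qed
  consider "y \<notin> B" "z \<notin> B" | "x \<notin> B" "z \<notin> B" | "x \<notin> B" "y \<notin> B"
    using two[of x y] two[of x z] two[of y z] xyz by auto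
  then show ?thesis
  proof cases
    case 1 then show ?thesis using that[of x y z] xyz by auto
  next
    case 2 then show ?thesis using that[of y x z] xyz by auto
  next
    case 3 then show ?thesis using that[of z x y] xyz by auto
  qed
qed

lemma card_triples_share_two_le:
  "card {(A, B). A \<in> triples n \<and> B \<in> triples n \<and> card (A \<inter> B) = 2} \<le> n ^ 4"
proof -
  let ?P = "{(A, B). A \<in> triples n \<and> B \<in> triples n \<and> card (A \<inter> B) = 2}"
  let ?I = "{1..n} \<times> {1..n} \<times> {1..n} \<times> {1..n}"
  let ?g = "\<lambda>(a, b, c, e). ({a, b, c}, {a, b, e})"
  have "?P \<subseteq> ?g ` ?I"
  proof safe
    fix A B assume AB: "A \<in> triples n" "B \<in> triples n" "card (A \<inter> B) = 2"
    then obtain a b c e where "A = {a, b, c}" "B = {a, b, e}" "{a, b, c, e} \<subseteq> {1..n}"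
      by (rule triples_share_two)
    then show "(A, B) \<in> ?g ` ?I" by (intro image_eqI[of _ _ "(a, b, c, e)"]) auto
  qed
  then have "card ?P \<le> card (?g ` ?I)" by (intro card_mono) auto
  also have "\<dots> \<le> card ?I" by (intro card_image_le) auto
  also have "\<dots> = n ^ 4" by (simp add: power4_eq_xxxx)
  finally show ?thesis .
qed

context sphere_graph
begin

section \<open>First two moments of the signed triangle count\<close>

lemma abs_path2_le_1: "\<bar>path2 x y\<bar> \<le> 1"
  unfolding path2_def using edge_bounds by (intro abs_integral_le abs_mult_le_1) auto

text \<open>What a shared edge contributes: the conditional second moment of its indicator about
  \<open>p\<close>, given the latent points. It is a variance only if
  \<open>prob q x i j = p\<close>.\<close>

definition edge_variance :: "real \<Rightarrow> (nat \<Rightarrow> nat \<Rightarrow> real) \<Rightarrow> nat \<Rightarrow> nat \<Rightarrow> real" where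
  "edge_variance q x i j = prob q x i j * (1 - p)\<^sup>2 + (1 - prob q x i j) * p\<^sup>2"

lemma edge_variance_bounds:
  assumes "0 \<le> q" "q \<le> 1"
  shows "0 \<le> edge_variance q x i j" "edge_variance q x i j \<le> 1"
proof -
  note b = prob_bounds[OF assms, of x i j]
  show "0 \<le> edge_variance q x i j" using b by (simp add: edge_variance_def)
  have "edge_variance q x i j \<le> prob q x i j * 1 + (1 - prob q x i j) * 1"
    unfolding edge_variance_def using b p by (intro add_mono mult_left_mono) (auto simp: abs_square_le_1)
  then show "edge_variance q x i j \<le> 1" by simp
qed

lemma prob_commute: "prob q x i j = prob q x j i"
  by (simp add: prob_def edge_commute)

lemma edge_variance_commute: "edge_variance q x i j = edge_variance q x j i"
  by (simp add: edge_variance_def prob_commute)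

text \<open>Integrating out \<open>c\<close> leaves \<open>path2\<close> between \<open>a\<close>
  and \<open>b\<close>; integrating out \<open>b\<close> then leaves the constant
  \<open>triangle\<close>, whichever unit vector \<open>x a\<close> is. \<open>H\<close> collects
  the factors of a second triangle that avoids \<open>b\<close> and \<open>c\<close>.\<close>

lemma integral_triangle:
  fixes H :: "(nat \<Rightarrow> nat \<Rightarrow> real) \<Rightarrow> real"
  assumes abc: "a \<in> {1..n}" "b \<in> {1..n}" "c \<in> {1..n}" "a \<noteq> b" "a \<noteq> c" "b \<noteq> c"
    and H [measurable]: "H \<in> borel_measurable (latent n)" and H1: "\<And>x. \<bar>H x\<bar> \<le> 1"
    and Hbc: "\<And>x y. H (x(b := y)) = H x" "\<And>x y. H (x(c := y)) = H x"
  shows "(\<integral>x. H x * (edge (x a) (x b) * edge (x a) (x c) * edge (x b) (x c)) \<partial>latent n) = triangle * (\<integral>x. H x \<partial>latent n)"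
proof -
  note [measurable] = measurable_latent_component[OF abc(1)] measurable_latent_component[OF abc(2)] measurable_latent_component[OF abc(3)]
  have "(\<integral>x. H x * (edge (x a) (x b) * edge (x a) (x c) * edge (x b) (x c)) \<partial>latent n) =
      (\<integral>x. (\<integral>y. H x * edge (x a) (x b) * (edge (x a) y * edge y (x b)) \<partial>S) \<partial>latent n)"
    using abc edge_bounds H1
    by (subst latent_resample[OF abc(3), where B = 1])
       (auto intro!: abs_mult_le_1 simp: Hbc edge_commute[of "x b" for x] mult_ac)
  also have "\<dots> = (\<integral>x. H x * edge (x a) (x b) * path2 (x a) (x b) \<partial>latent n)"
    by (simp add: path2_def)
  also have "\<dots> = (\<integral>x. (\<integral>y. H x * (edge (x a) y * path2 (x a) y) \<partial>S) \<partial>latent n)"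
    using abc edge_bounds H1 abs_path2_le_1
    by (subst latent_resample[OF abc(2), where B = 1])
       (auto intro!: abs_mult_le_1 simp: Hbc mult_ac)
  also have "\<dots> = (\<integral>x. triangle * H x \<partial>latent n)"
  proof (rule integral_cong_AE)
    show "AE x in latent n. (\<integral>y. H x * (edge (x a) y * path2 (x a) y) \<partial>S) = triangle * H x"
      using AE_latent_unit_sphere by (rule eventually_mono) (use abc in \<open>simp add: integral_edge_path2\<close>)
  qed measurable
  also have "\<dots> = triangle * (\<integral>x. H x \<partial>latent n)" by simp
  finally show ?thesis .
qed

text \<open>The free vertices \<open>c\<close> and \<open>e\<close> each leave a factor
  \<open>path2\<close> between the ends of the shared edge, and its mean square is of order at most
  1 / d. This is the source of the variance term n^4 q^4 / d.\<close>

lemma integral_two_triangles_sharing_edge_le: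
  assumes q: "0 \<le> q" "q \<le> 1" and dist: "distinct [a, b, c, e]" and sub: "{a, b, c, e} \<subseteq> {1..n}"
  shows "(\<integral>x. edge_variance q x a b * (edge (x a) (x c) * edge (x b) (x c)) * (edge (x a) (x e) * edge (x b) (x e)) \<partial>latent n)
    \<le> 256 / real d"
proof -
  have abce: "a \<in> {1..n}" "b \<in> {1..n}" "c \<in> {1..n}" "e \<in> {1..n}" using sub by auto
  note [measurable] = abce[THEN measurable_latent_component]
  have v1: "\<bar>edge_variance q x i j\<bar> \<le> 1" for x i j using edge_variance_bounds[OF q, of x i j] by simp
  have upd: "edge_variance q (x(k := y)) a b = edge_variance q x a b" if "k \<noteq> a" "k \<noteq> b" for x y k
    using that by (simp add: edge_variance_def prob_def)
  have [measurable]: "(\<lambda>x. edge_variance q x a b) \<in> borel_measurable (latent n)"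
    unfolding edge_variance_def prob_def by measurable
  have sq1: "\<bar>(path2 x y)\<^sup>2\<bar> \<le> 1" for x y using abs_path2_le_1[of x y] by (simp add: abs_square_le_1)
  have "(\<integral>x. edge_variance q x a b * (edge (x a) (x c) * edge (x b) (x c)) * (edge (x a) (x e) * edge (x b) (x e)) \<partial>latent n) =
     (\<integral>x. (\<integral>y. edge_variance q x a b * (edge (x a) (x e) * edge (x b) (x e)) * (edge (x a) y * edge y (x b)) \<partial>S) \<partial>latent n)"
    using dist edge_bounds v1
    by (subst latent_resample[OF abce(3), where B = 1])
       (auto intro!: abs_mult_le_1 simp: upd edge_commute[of "x b" for x] mult_ac)
  also have "\<dots> = (\<integral>x. edge_variance q x a b * (edge (x a) (x e) * edge (x b) (x e)) * path2 (x a) (x b) \<partial>latent n)"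
    by (simp add: path2_def)
  also have "\<dots> = (\<integral>x. (\<integral>y. edge_variance q x a b * path2 (x a) (x b) * (edge (x a) y * edge y (x b)) \<partial>S) \<partial>latent n)"
    using dist edge_bounds v1 abs_path2_le_1
    by (subst latent_resample[OF abce(4), where B = 1])
       (auto intro!: abs_mult_le_1 simp: upd edge_commute[of "x b" for x] mult_ac)
  also have "\<dots> = (\<integral>x. edge_variance q x a b * (path2 (x a) (x b))\<^sup>2 \<partial>latent n)"
    by (simp add: path2_def power2_eq_square mult.assoc)
  also have "\<dots> \<le> (\<integral>x. (path2 (x a) (x b))\<^sup>2 \<partial>latent n)"
  proof (rule integral_mono)
    show "integrable (latent n) (\<lambda>x. edge_variance q x a b * (path2 (x a) (x b))\<^sup>2)"
      using v1 sq1 by (intro integrable_latent[where B = 1] abs_mult_le_1) auto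
    show "integrable (latent n) (\<lambda>x. (path2 (x a) (x b))\<^sup>2)"
      using sq1 by (intro integrable_latent[where B = 1]) auto
    show "edge_variance q x a b * (path2 (x a) (x b))\<^sup>2 \<le> (path2 (x a) (x b))\<^sup>2" for x
      using edge_variance_bounds[OF q, of x a b] by (simp add: mult_left_le_one_le)
  qed
  also have "\<dots> = (\<integral>x. (\<integral>y. (path2 (x a) y)\<^sup>2 \<partial>S) \<partial>latent n)"
    using dist sq1 by (subst latent_resample[OF abce(2), where B = 1]) auto
  also have "\<dots> \<le> (\<integral>x. 256 / real d \<partial>latent n)"
  proof (rule integral_mono_AE)
    show "AE x in latent n. (\<integral>y. (path2 (x a) y)\<^sup>2 \<partial>S) \<le> 256 / real d"
      using AE_latent_unit_sphere by (rule eventually_mono) (use abce in \<open>simp add: integral_path2_square_le\<close>)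
    show "integrable (latent n) (\<lambda>x. \<integral>y. (path2 (x a) y)\<^sup>2 \<partial>S)"
      using sq1 by (intro integrable_latent[where B = 1] abs_integral_le) auto
  qed auto
  also have "\<dots> = 256 / real d" by (simp add: latent.prob_space)
  finally show ?thesis .
qed

definition graph_expectation :: "nat \<Rightarrow> real \<Rightarrow> ((nat \<times> nat) set \<Rightarrow> real) \<Rightarrow> real" where
  "graph_expectation n q f = (\<Sum>F\<in>Pow (vertex_pairs n). graph_prob n q F * f F)"

lemma graph_expectation_sum:
  "graph_expectation n q (\<lambda>F. \<Sum>i\<in>I. f i F) = (\<Sum>i\<in>I. graph_expectation n q (f i))"
  unfolding graph_expectation_def sum_distrib_left by (rule sum.swap)

lemma graph_expectation_prod:
  assumes q: "0 \<le> q" "q \<le> 1"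
  shows "graph_expectation n q (\<lambda>F. \<Prod>e\<in>vertex_pairs n. h e (e \<in> F)) =
    (\<integral>x. (\<Prod>e\<in>vertex_pairs n. prob q x (fst e) (snd e) * h e True + (1 - prob q x (fst e) (snd e)) * h e False) \<partial>latent n)"
proof -
  have "graph_expectation n q (\<lambda>F. \<Prod>e\<in>vertex_pairs n. h e (e \<in> F)) =
      (\<Sum>F\<in>Pow (vertex_pairs n). \<integral>x. graph_weight (vertex_pairs n) (prob q x) F * (\<Prod>e\<in>vertex_pairs n. h e (e \<in> F)) \<partial>latent n)"
    by (simp add: graph_expectation_def graph_prob_def)
  also have "\<dots> = (\<integral>x. (\<Sum>F\<in>Pow (vertex_pairs n). graph_weight (vertex_pairs n) (prob q x) F * (\<Prod>e\<in>vertex_pairs n. h e (e \<in> F))) \<partial>latent n)"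
    using integrable_graph_weight[OF q]
    by (intro Bochner_Integration.integral_sum[symmetric] integrable_mult_left) auto
  finally show ?thesis by (simp add: sum_graph_weight_prod finite_vertex_pairs)
qed

lemma prod_restrict:
  fixes g :: "'a \<Rightarrow> real"
  assumes "finite V" "T \<subseteq> V"
  shows "(\<Prod>e\<in>V. if e \<in> T then g e else 1) = prod g T"
  using assms by (simp add: prod.If_cases Int_absorb1)

text \<open>Given the latent points the indicators are independent, and each centred one has mean
  \<open>q * edge\<close>.\<close>

lemma expectation_triangle:
  assumes q: "0 \<le> q" "q \<le> 1" and A: "A \<in> triples n"
  shows "graph_expectation n q (\<lambda>F. \<Prod>e\<in>pairs_in A. of_bool (e \<in> F) - p) = q ^ 3 * triangle"
proof -
  let ?V = "vertex_pairs n"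
  note V = finite_vertex_pairs[of n] and T = pairs_in_subset[OF A]
  obtain a b c where abc: "A = {a, b, c}" "a \<noteq> b" "a \<noteq> c" "b \<noteq> c" "{a, b, c} \<subseteq> {1..n}"
    using A by (rule tripleE)
  have "graph_expectation n q (\<lambda>F. \<Prod>e\<in>pairs_in A. of_bool (e \<in> F) - p) =
      graph_expectation n q (\<lambda>F. \<Prod>e\<in>?V. if e \<in> pairs_in A then of_bool (e \<in> F) - p else 1)"
    by (simp add: prod_restrict[OF V T])
  also have "\<dots> = (\<integral>x. (\<Prod>e\<in>?V. prob q x (fst e) (snd e) * (if e \<in> pairs_in A then of_bool True - p else 1)
      + (1 - prob q x (fst e) (snd e)) * (if e \<in> pairs_in A then of_bool False - p else 1)) \<partial>latent n)"
    by (rule graph_expectation_prod[OF q, where h = "\<lambda>e b. if e \<in> pairs_in A then of_bool b - p else 1"])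
  also have "\<dots> = (\<integral>x. (\<Prod>e\<in>?V. if e \<in> pairs_in A then q * edge (x (fst e)) (x (snd e)) else 1) \<partial>latent n)"
    by (intro Bochner_Integration.integral_cong refl prod.cong) (auto simp: prob_def algebra_simps)
  also have "\<dots> = (\<integral>x. q ^ 3 * (1 * (edge (x a) (x b) * edge (x a) (x c) * edge (x b) (x c))) \<partial>latent n)"
  proof (intro Bochner_Integration.integral_cong refl)
    fix x
    have "(\<Prod>e\<in>?V. if e \<in> pairs_in A then q * edge (x (fst e)) (x (snd e)) else 1) =
        q * edge (x a) (x b) * (q * edge (x a) (x c)) * (q * edge (x b) (x c))"
      unfolding prod_restrict[OF V T] unfolding abc(1)
      by (rule prod_pairs_in[where \<phi> = "\<lambda>i j. q * edge (x i) (x j)"])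
        (use abc in \<open>auto simp: edge_commute[of "x i" "x j" for i j]\<close>)
    then show "(\<Prod>e\<in>?V. if e \<in> pairs_in A then q * edge (x (fst e)) (x (snd e)) else 1) =
        q ^ 3 * (1 * (edge (x a) (x b) * edge (x a) (x c) * edge (x b) (x c)))"
      by (simp add: power3_eq_cube)
  qed
  also have "\<dots> = q ^ 3 * triangle"
    using integral_triangle[of a n b c "\<lambda>_. 1"] abc by (simp add: latent.prob_space)
  finally show ?thesis .
qed

text \<open>A shared pair occurs in both products but has only one indicator: its second moment is
  booked under \<open>A\<close>, and its factor under \<open>B\<close> becomes 1.\<close>

lemma expectation_two_triangles:
  assumes q: "0 \<le> q" "q \<le> 1" and A: "A \<in> triples n" and B: "B \<in> triples n"
  shows "graph_expectation n q (\<lambda>F. (\<Prod>e\<in>pairs_in A. of_bool (e \<in> F) - p) * (\<Prod>e\<in>pairs_in B. of_bool (e \<in> F) - p)) =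
    (\<integral>x. (\<Prod>e\<in>pairs_in A. (\<lambda>i j. if i \<in> B \<and> j \<in> B then edge_variance q x i j else q * edge (x i) (x j)) (fst e) (snd e)) *
        (\<Prod>e\<in>pairs_in B. (\<lambda>i j. if i \<in> A \<and> j \<in> A then 1 else q * edge (x i) (x j)) (fst e) (snd e)) \<partial>latent n)"
proof -
  let ?V = "vertex_pairs n" and ?c = "\<lambda>b. of_bool b - p"
  note V = finite_vertex_pairs[of n] and TA = pairs_in_subset[OF A] and TB = pairs_in_subset[OF B]
  let ?h = "\<lambda>e b. (if e \<in> pairs_in A then of_bool b - p else 1) * (if e \<in> pairs_in B then of_bool b - p else 1)"
  have "graph_expectation n q (\<lambda>F. (\<Prod>e\<in>pairs_in A. of_bool (e \<in> F) - p) * (\<Prod>e\<in>pairs_in B. of_bool (e \<in> F) - p)) =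
      graph_expectation n q (\<lambda>F. \<Prod>e\<in>?V. ?h e (e \<in> F))"
    by (simp add: prod_restrict[OF V TA] prod_restrict[OF V TB] prod.distrib)
  also have "\<dots> = (\<integral>x. (\<Prod>e\<in>?V. prob q x (fst e) (snd e) * ?h e True + (1 - prob q x (fst e) (snd e)) * ?h e False) \<partial>latent n)"
    by (rule graph_expectation_prod[OF q])
  also have "\<dots> = (\<integral>x. (\<Prod>e\<in>?V.
      (if e \<in> pairs_in A then (\<lambda>i j. if i \<in> B \<and> j \<in> B then edge_variance q x i j else q * edge (x i) (x j)) (fst e) (snd e) else 1) *
      (if e \<in> pairs_in B then (\<lambda>i j. if i \<in> A \<and> j \<in> A then 1 else q * edge (x i) (x j)) (fst e) (snd e) else 1)) \<partial>latent n)"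
    by (intro Bochner_Integration.integral_cong refl prod.cong)
       (auto simp: pairs_in_def edge_variance_def power2_eq_square prob_def algebra_simps)
  finally show ?thesis
    unfolding prod.distrib prod_restrict[OF V TA] prod_restrict[OF V TB] .
qed

text \<open>The cases are the possible numbers of common vertices. With two or three, the square of
  the mean is simply dropped; with at most one, no pair is shared and the covariance is exactly
  0.\<close>

lemma covariance_triangles_le:
  assumes q: "0 \<le> q" "q \<le> 1" and A: "A \<in> triples n" and B: "B \<in> triples n"
  shows "graph_expectation n q (\<lambda>F. (\<Prod>e\<in>pairs_in A. of_bool (e \<in> F) - p) * (\<Prod>e\<in>pairs_in B. of_bool (e \<in> F) - p))
      - (q ^ 3 * triangle)\<^sup>2 \<le> of_bool (A = B) + of_bool (card (A \<inter> B) = 2) * (256 * q ^ 4 / real d)"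
    (is "?E - ?m \<le> _")
proof -
  have fin: "finite A" "finite B" "card A = 3" "card B = 3"
    using A B by (auto simp: triples_def intro: card_ge_0_finite)
  let ?f = "\<lambda>x i j. if i \<in> B \<and> j \<in> B then edge_variance q x i j else q * edge (x i) (x j)"
  let ?g = "\<lambda>x i j. if i \<in> A \<and> j \<in> A then 1 else q * edge (x i) (x j)"
  have sym: "?f x i j = ?f x j i" "?g x i j = ?g x j i" for x i j
    by (auto simp: edge_variance_commute[of q x i j] edge_commute[of "x i" "x j"])
  note E = expectation_two_triangles[OF q A B]
  have pA: "(\<Prod>e\<in>pairs_in A. ?f x (fst e) (snd e)) = ?f x a b * ?f x a c * ?f x b c"
    if "A = {a, b, c}" "a \<noteq> b" "a \<noteq> c" "b \<noteq> c" for x a b c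
    unfolding that(1) by (rule prod_pairs_in[OF sym(1) that(2-4)])
  have pB: "(\<Prod>e\<in>pairs_in B. ?g x (fst e) (snd e)) = ?g x a b * ?g x a c * ?g x b c"
    if "B = {a, b, c}" "a \<noteq> b" "a \<noteq> c" "b \<noteq> c" for x a b c
    unfolding that(1) by (rule prod_pairs_in[OF sym(2) that(2-4)])
  have "card (A \<inter> B) \<le> 3" using fin card_mono[of A "A \<inter> B"] by auto
  then consider "card (A \<inter> B) = 3" | "card (A \<inter> B) = 2" | "card (A \<inter> B) \<le> 1" by linarith
  then show ?thesis
  proof cases
    case 1
    have "A \<inter> B = A" by (rule card_subset_eq) (use 1 fin in auto)
    moreover have "A \<inter> B = B" by (rule card_subset_eq) (use 1 fin in auto)
    ultimately have AB: "A = B" by simp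
    obtain a b c where abc: "A = {a, b, c}" "a \<noteq> b" "a \<noteq> c" "b \<noteq> c" "{a, b, c} \<subseteq> {1..n}"
      using A by (rule tripleE)
    have "?E = (\<integral>x. ?f x a b * ?f x a c * ?f x b c * (?g x a b * ?g x a c * ?g x b c) \<partial>latent n)"
      unfolding E pA[OF abc(1-4)] pB[OF abc(1)[unfolded AB] abc(2-4)] ..
    also have "\<dots> = (\<integral>x. edge_variance q x a b * edge_variance q x a c * edge_variance q x b c \<partial>latent n)"
      using abc AB by simp
    also have "\<dots> \<le> (\<integral>x. 1 \<partial>latent n)"
    proof (cases "integrable (latent n) (\<lambda>x. edge_variance q x a b * edge_variance q x a c * edge_variance q x b c)")
      case True
      then show ?thesis
        using edge_variance_bounds[OF q] by (intro integral_mono) (auto intro!: mult_le_one)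
    qed (simp add: not_integrable_integral_eq)
    finally have "?E \<le> 1" by (simp add: latent.prob_space)
    then have "?E - ?m \<le> 1" using zero_le_power2[of "q ^ 3 * triangle"] by linarith
    then show ?thesis using AB 1 by simp
  next
    case 2
    then have ne: "A \<noteq> B" using fin by auto
    obtain a b c e where abce: "A = {a, b, c}" "B = {a, b, e}" "distinct [a, b, c, e]" "{a, b, c, e} \<subseteq> {1..n}"
      using A B 2 by (rule triples_share_two)
    have ne': "a \<noteq> b" "a \<noteq> c" "b \<noteq> c" "a \<noteq> e" "b \<noteq> e" using abce(3) by auto
    have "?E = (\<integral>x. ?f x a b * ?f x a c * ?f x b c * (?g x a b * ?g x a e * ?g x b e) \<partial>latent n)"
      unfolding E pA[OF abce(1) ne'(1-3)] pB[OF abce(2) ne'(1,4,5)] ..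
    also have "\<dots> = q ^ 4 * (\<integral>x. edge_variance q x a b * (edge (x a) (x c) * edge (x b) (x c)) * (edge (x a) (x e) * edge (x b) (x e)) \<partial>latent n)"
      unfolding integral_mult_right_zero[symmetric] using abce
      by (intro Bochner_Integration.integral_cong refl) (auto simp: power4_eq_xxxx mult_ac)
    also have "\<dots> \<le> q ^ 4 * (256 / real d)"
      using q abce by (intro mult_left_mono integral_two_triangles_sharing_edge_le) auto
    finally have "?E - ?m \<le> 256 * q ^ 4 / real d"
      using zero_le_power2[of "q ^ 3 * triangle"] by (simp only: times_divide_eq_right mult.commute[of "q ^ 4"])
    then show ?thesis using ne 2 by simp
  next
    case 3
    obtain a b c where abc: "A = {a, b, c}" "a \<noteq> b" "a \<noteq> c" "b \<noteq> c" "{a, b, c} \<subseteq> {1..n}" "b \<notin> B" "c \<notin> B"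
      using A 3 by (rule triple_split)
    have "card (B \<inter> A) \<le> 1" using 3 by (simp add: Int_commute)
    with B obtain a' b' c' where abc': "B = {a', b', c'}" "a' \<noteq> b'" "a' \<noteq> c'" "b' \<noteq> c'" "{a', b', c'} \<subseteq> {1..n}" "b' \<notin> A" "c' \<notin> A"
      by (rule triple_split)
    let ?H = "\<lambda>x. edge (x a) (x b) * edge (x a) (x c) * edge (x b) (x c)"
    have fA: "(\<Prod>e\<in>pairs_in A. ?f x (fst e) (snd e)) = q ^ 3 * ?H x" for x
    proof -
      have "(\<Prod>e\<in>pairs_in A. ?f x (fst e) (snd e)) = ?f x a b * ?f x a c * ?f x b c"
        by (rule pA[OF abc(1-4)])
      also have "\<dots> = q ^ 3 * ?H x" using abc(6,7) by (simp add: power3_eq_cube)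
      finally show ?thesis .
    qed
    have gB: "(\<Prod>e\<in>pairs_in B. ?g x (fst e) (snd e)) = q ^ 3 * (edge (x a') (x b') * edge (x a') (x c') * edge (x b') (x c'))" for x
    proof -
      have "(\<Prod>e\<in>pairs_in B. ?g x (fst e) (snd e)) = ?g x a' b' * ?g x a' c' * ?g x b' c'"
        by (rule pB[OF abc'(1-4)])
      also have "\<dots> = q ^ 3 * (edge (x a') (x b') * edge (x a') (x c') * edge (x b') (x c'))"
        using abc'(6,7) by (simp add: power3_eq_cube)
      finally show ?thesis .
    qed
    have "a \<in> {1..n}" "b \<in> {1..n}" "c \<in> {1..n}" using abc(5) by auto
    note [measurable] = this[THEN measurable_latent_component]
    have "?E = (\<integral>x. q ^ 6 * (?H x * (edge (x a') (x b') * edge (x a') (x c') * edge (x b') (x c'))) \<partial>latent n)"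
      unfolding E fA gB by (simp add: mult_ac power_add[symmetric, of q 3 3, simplified])
    \<comment> \<open>The triangle on \<open>B\<close> is integrated out through \<open>b'\<close>
      and \<open>c'\<close>, which lie outside \<open>A\<close>; the triangle on \<open>A\<close>
      serves as the weight.\<close>
    also have "\<dots> = q ^ 6 * (triangle * (\<integral>x. ?H x \<partial>latent n))"
      using abc' abc(1) edge_bounds
      by (subst integral_mult_right_zero, subst integral_triangle) (auto intro!: abs_mult_le_1)
    also have "(\<integral>x. ?H x \<partial>latent n) = triangle"
      using integral_triangle[of a n b c "\<lambda>_. 1"] abc by (simp add: latent.prob_space)
    also have "q ^ 6 * (triangle * triangle) = ?m"
      by (simp add: power2_eq_square mult_ac power_add[symmetric, of q 3 3, simplified])
    finally have "?E - ?m = 0" by simp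
    moreover have "A \<noteq> B" using 3 fin by auto
    ultimately show ?thesis using 3 by simp
  qed
qed


lemma expectation_signed_triangles:
  assumes q: "0 \<le> q" "q \<le> 1"
  shows "graph_expectation n q (signed_triangles n p) = real (card (triples n)) * (q ^ 3 * triangle)"
proof -
  have "graph_expectation n q (signed_triangles n p) =
      (\<Sum>A\<in>triples n. graph_expectation n q (\<lambda>F. \<Prod>e\<in>pairs_in A. of_bool (e \<in> F) - p))"
    unfolding signed_triangles_def by (rule graph_expectation_sum)
  then show ?thesis by (simp add: expectation_triangle[OF q])
qed

lemma variance_signed_triangles_le:
  fixes n :: nat and q :: real
  assumes q: "0 \<le> q" "q \<le> 1"
  defines "m \<equiv> real (card (triples n)) * (q ^ 3 * triangle)"
  shows "graph_expectation n q (\<lambda>F. (signed_triangles n p F - m)\<^sup>2) \<le> real n ^ 3 + 256 * real n ^ 4 * q ^ 4 / real d"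
proof -
  let ?T = "triples n" and ?\<tau> = "signed_triangles n p"
  let ?E2 = "\<lambda>A B. graph_expectation n q (\<lambda>F. (\<Prod>e\<in>pairs_in A. of_bool (e \<in> F) - p) * (\<Prod>e\<in>pairs_in B. of_bool (e \<in> F) - p))"
  let ?\<mu> = "q ^ 3 * triangle"
  note finT = finite_triples[of n]
  have "graph_expectation n q (\<lambda>F. (?\<tau> F - m)\<^sup>2) =
      graph_expectation n q (\<lambda>F. (?\<tau> F)\<^sup>2) - 2 * m * graph_expectation n q ?\<tau> + m\<^sup>2 * (\<Sum>F\<in>Pow (vertex_pairs n). graph_prob n q F)"
    unfolding graph_expectation_def sum_distrib_left sum_subtractf[symmetric] sum.distrib[symmetric]
    by (intro sum.cong) (simp_all add: power2_diff algebra_simps)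
  also have "\<dots> = graph_expectation n q (\<lambda>F. (?\<tau> F)\<^sup>2) - m\<^sup>2"
    unfolding expectation_signed_triangles[OF q] sum_graph_prob[OF q] m_def[symmetric]
    by (simp add: power2_eq_square)
  also have "graph_expectation n q (\<lambda>F. (?\<tau> F)\<^sup>2) = (\<Sum>A\<in>?T. \<Sum>B\<in>?T. ?E2 A B)"
    unfolding signed_triangles_def power2_eq_square sum_product graph_expectation_sum ..
  also have "m\<^sup>2 = (\<Sum>A\<in>?T. \<Sum>B\<in>?T. ?\<mu>\<^sup>2)"
    by (simp add: m_def power2_eq_square mult_ac)
  also have "(\<Sum>A\<in>?T. \<Sum>B\<in>?T. ?E2 A B) - (\<Sum>A\<in>?T. \<Sum>B\<in>?T. ?\<mu>\<^sup>2) = (\<Sum>A\<in>?T. \<Sum>B\<in>?T. ?E2 A B - ?\<mu>\<^sup>2)"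
    by (simp only: sum_subtractf)
  also have "\<dots> \<le> (\<Sum>A\<in>?T. \<Sum>B\<in>?T. of_bool (A = B) + of_bool (card (A \<inter> B) = 2) * (256 * q ^ 4 / real d))"
    by (intro sum_mono covariance_triangles_le q)
  also have "\<dots> = (\<Sum>A\<in>?T. \<Sum>B\<in>?T. of_bool (A = B)) + (\<Sum>A\<in>?T. \<Sum>B\<in>?T. of_bool (card (A \<inter> B) = 2)) * (256 * q ^ 4 / real d)"
    by (simp only: sum.distrib sum_distrib_right)
  also have "(\<Sum>A\<in>?T. \<Sum>B\<in>?T. of_bool (A = B) :: real) = real (card ?T)"
    using finT by (simp add: of_bool_def)
  also have "(\<Sum>A\<in>?T. \<Sum>B\<in>?T. of_bool (card (A \<inter> B) = 2) :: real) =
      real (card {(A, B). A \<in> ?T \<and> B \<in> ?T \<and> card (A \<inter> B) = 2})"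
  proof -
    have "{(A, B). A \<in> ?T \<and> B \<in> ?T \<and> card (A \<inter> B) = 2} = (?T \<times> ?T) \<inter> {z. card (fst z \<inter> snd z) = 2}" by auto
    then show ?thesis
      unfolding sum.cartesian_product using finT by (simp add: of_bool_def case_prod_beta sum.If_cases)
  qed
  also have "real (card ?T) + real (card {(A, B). A \<in> ?T \<and> B \<in> ?T \<and> card (A \<inter> B) = 2}) * (256 * q ^ 4 / real d)
      \<le> real (n ^ 3) + real (n ^ 4) * (256 * q ^ 4 / real d)"
    using q by (intro add_mono mult_right_mono of_nat_mono card_triples_le card_triples_share_two_le) auto
  also have "\<dots> = real n ^ 3 + 256 * real n ^ 4 * q ^ 4 / real d" by simp
  finally show ?thesis .
qed

section \<open>Separation by Chebyshev's inequality\<close>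

lemma graph_prob_Chebyshev:
  assumes q: "0 \<le> q" "q \<le> 1" and r: "r > 0" and Q: "\<And>F. Q F \<Longrightarrow> r \<le> \<bar>f F - m\<bar>"
  shows "(\<Sum>F | F \<subseteq> vertex_pairs n \<and> Q F. graph_prob n q F) \<le> graph_expectation n q (\<lambda>F. (f F - m)\<^sup>2) / r\<^sup>2"
proof -
  have "(\<Sum>F | F \<subseteq> vertex_pairs n \<and> Q F. graph_prob n q F) \<le>
      (\<Sum>F | F \<subseteq> vertex_pairs n \<and> Q F. graph_prob n q F * ((f F - m)\<^sup>2 / r\<^sup>2))"
  proof (rule sum_mono)
    fix F assume "F \<in> {F. F \<subseteq> vertex_pairs n \<and> Q F}"
    then have "r\<^sup>2 \<le> \<bar>f F - m\<bar>\<^sup>2" using Q r by (intro power_mono) auto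
    then have "1 \<le> (f F - m)\<^sup>2 / r\<^sup>2" using r by simp
    then have "graph_prob n q F * 1 \<le> graph_prob n q F * ((f F - m)\<^sup>2 / r\<^sup>2)"
      by (intro mult_left_mono graph_prob_nonneg q)
    then show "graph_prob n q F \<le> graph_prob n q F * ((f F - m)\<^sup>2 / r\<^sup>2)" by simp
  qed
  also have "\<dots> \<le> (\<Sum>F\<in>Pow (vertex_pairs n). graph_prob n q F * ((f F - m)\<^sup>2 / r\<^sup>2))"
    using graph_prob_nonneg[OF q] by (intro sum_mono2) (auto simp: finite_vertex_pairs)
  also have "\<dots> = graph_expectation n q (\<lambda>F. (f F - m)\<^sup>2) / r\<^sup>2"
    by (simp add: graph_expectation_def sum_divide_distrib)
  finally show ?thesis .
qed

text \<open>Both laws are tested on the event that the count is at least half its mean in the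
  geometric graph. Either error is a deviation by at least \<open>m / 2\<close> from the respective
  mean, \<open>m\<close> or 0.\<close>

lemma total_variation_ge:
  assumes q: "0 < q" "q \<le> 1" and n: "n \<ge> 3"
  shows "1 - 11664 * 2 ^ 60 / min_prob ^ 8 * (real d / (real n ^ 3 * q ^ 6) + 128 / (real n * q)\<^sup>2)
    \<le> total_variation (erdos_renyi n p) (geometric_graph n p d q)"
proof -
  let ?V = "vertex_pairs n" and ?\<tau> = "signed_triangles n p"
  define c where "c = min_prob ^ 4 / 2 ^ 30"
  have c: "c > 0" using min_prob by (simp add: c_def)
  define m where "m = real (card (triples n)) * (q ^ 3 * triangle)"
  \<comment> \<open>A lower bound for \<open>m\<close>, from (n / 3)^3 \<le> n choose 3 and
    \<open>triangle_ge\<close>.\<close>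
  define l where "l = real n ^ 3 / 27 * (q ^ 3 * (c / sqrt (real d)))"
  have l: "l > 0" using n q c d by (simp add: l_def)
  have ml: "l \<le> m"
  proof -
    have "(real n / real 3) ^ 3 \<le> real (n choose 3)"
      using n binomial_ge_n_over_k_pow_k[of 3 n, where 'a = real] by simp
    then have "real n ^ 3 / 27 \<le> real (card (triples n))"
      by (simp add: card_triples power_divide)
    moreover have "c / sqrt (real d) \<le> triangle"
      using triangle_ge by (simp add: c_def)
    ultimately show ?thesis
      unfolding l_def m_def using q c d by (intro mult_mono) auto
  qed
  then have m: "m > 0" using l by linarith
  define G where "G = {F. F \<subseteq> ?V \<and> m / 2 \<le> ?\<tau> F}"
  define A where "A = edge_sets ` G"
  have G: "{F. F \<subseteq> ?V \<and> edge_sets F \<in> A} = G"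
    using inj_on_edge_sets[of n] unfolding A_def G_def by (auto dest: inj_onD)
  have q01: "0 \<le> q" "q \<le> 1" using q by auto
  have "(\<Sum>F | F \<subseteq> ?V \<and> \<not> m / 2 \<le> ?\<tau> F. graph_prob n q F) \<le>
      graph_expectation n q (\<lambda>F. (?\<tau> F - m)\<^sup>2) / (m / 2)\<^sup>2"
    using m by (intro graph_prob_Chebyshev q01) auto
  also have "\<dots> \<le> (real n ^ 3 + 256 * real n ^ 4 * q ^ 4 / real d) / (m / 2)\<^sup>2"
    unfolding m_def by (intro divide_right_mono variance_signed_triangles_le q01) auto
  finally have bad: "(\<Sum>F | F \<subseteq> ?V \<and> \<not> m / 2 \<le> ?\<tau> F. graph_prob n q F) \<le>
      (real n ^ 3 + 256 * real n ^ 4 * q ^ 4 / real d) / (m / 2)\<^sup>2" .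
  have "(\<Sum>F | F \<subseteq> ?V \<and> m / 2 \<le> ?\<tau> F. graph_prob n 0 F) \<le>
      graph_expectation n 0 (\<lambda>F. (?\<tau> F - 0)\<^sup>2) / (m / 2)\<^sup>2"
    using m by (intro graph_prob_Chebyshev) auto
  also have "\<dots> \<le> real n ^ 3 / (m / 2)\<^sup>2"
    using variance_signed_triangles_le[of 0 n] by (intro divide_right_mono) auto
  finally have null: "(\<Sum>F\<in>G. graph_prob n 0 F) \<le> real n ^ 3 / (m / 2)\<^sup>2" by (simp add: G_def)
  have "1 = (\<Sum>F\<in>G. graph_prob n q F) + (\<Sum>F | F \<subseteq> ?V \<and> \<not> m / 2 \<le> ?\<tau> F. graph_prob n q F)"
  proof -
    have "Pow ?V = G \<union> {F. F \<subseteq> ?V \<and> \<not> m / 2 \<le> ?\<tau> F}" by (auto simp: G_def)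
    moreover have "(\<Sum>F\<in>G \<union> {F. F \<subseteq> ?V \<and> \<not> m / 2 \<le> ?\<tau> F}. graph_prob n q F) =
        (\<Sum>F\<in>G. graph_prob n q F) + (\<Sum>F | F \<subseteq> ?V \<and> \<not> m / 2 \<le> ?\<tau> F. graph_prob n q F)"
      unfolding G_def by (intro sum.union_disjoint finite_subgraphs) auto
    ultimately show ?thesis using sum_graph_prob[OF q01, of n] by simp
  qed
  moreover have "measure (geometric_graph n p d q) A - measure (erdos_renyi n p) A \<le>
      total_variation (erdos_renyi n p) (geometric_graph n p d q)"
    using total_variation_bounds(1)[of n A q] by linarith
  ultimately have "1 - (real n ^ 3 + 256 * real n ^ 4 * q ^ 4 / real d) / (m / 2)\<^sup>2 - real n ^ 3 / (m / 2)\<^sup>2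
      \<le> total_variation (erdos_renyi n p) (geometric_graph n p d q)"
    using bad null by (simp add: measure_geometric_graph[OF q01] measure_erdos_renyi G)
  moreover have "(real n ^ 3 + 256 * real n ^ 4 * q ^ 4 / real d) / (m / 2)\<^sup>2 + real n ^ 3 / (m / 2)\<^sup>2 =
      (2 * real n ^ 3 + 256 * real n ^ 4 * q ^ 4 / real d) / (m / 2)\<^sup>2"
    by (simp add: add_divide_distrib[symmetric])
  moreover have "\<dots> \<le> (2 * real n ^ 3 + 256 * real n ^ 4 * q ^ 4 / real d) / (l / 2)\<^sup>2"
    using l ml q by (intro divide_left_mono power_mono mult_pos_pos) auto
  moreover have "\<dots> = 5832 / c\<^sup>2 * (real d / (real n ^ 3 * q ^ 6) + 128 / (real n * q)\<^sup>2)"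
  proof -
    define N where "N = real n"
    define D where "D = real d"
    have N: "N > 0" "D > 0" using n d by (auto simp: N_def D_def)
    \<comment> \<open>Here 2916 = 4 * 27^2; twice this number is the constant 5832 that multiplies
      the final bound.\<close>
    have l2: "(l / 2)\<^sup>2 = N ^ 6 * q ^ 6 * c\<^sup>2 / (2916 * D)"
      using d by (simp add: l_def N_def D_def power_divide power_mult_distrib power_mult[symmetric])
    have "(2 * N ^ 3 + 256 * N ^ 4 * q ^ 4 / D) / (N ^ 6 * q ^ 6 * c\<^sup>2 / (2916 * D)) =
        5832 / c\<^sup>2 * (D / (N ^ 3 * q ^ 6) + 128 / (N * q)\<^sup>2)"
      using N q c by (simp add: divide_simps) (simp add: algebra_simps eval_nat_numeral)
    then show ?thesis unfolding l2 N_def D_def .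
  qed
  moreover have "5832 / c\<^sup>2 \<le> 11664 * 2 ^ 60 / min_prob ^ 8"
    using min_prob by (simp add: c_def power_divide power_mult[symmetric] divide_simps)
  then have "5832 / c\<^sup>2 * (real d / (real n ^ 3 * q ^ 6) + 128 / (real n * q)\<^sup>2) \<le>
      11664 * 2 ^ 60 / min_prob ^ 8 * (real d / (real n ^ 3 * q ^ 6) + 128 / (real n * q)\<^sup>2)"
    using q by (intro mult_right_mono) auto
  ultimately show ?thesis by linarith
qed

end

subsection \<open>The chain rule for the relative entropy\<close>

definition new_pairs :: "nat \<Rightarrow> nat set \<Rightarrow> (nat \<times> nat) set" where
  "new_pairs n T = (\<lambda>i. (i, Suc n)) ` T"

lemma finite_new_pairs: "finite T \<Longrightarrow> finite (new_pairs n T)"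
  by (simp add: new_pairs_def)

lemma vertex_pairs_Suc: "vertex_pairs (Suc n) = vertex_pairs n \<union> new_pairs n {1..n}"
  by (auto simp: vertex_pairs_def new_pairs_def)

lemma vertex_pairs_disjoint_new_pairs: "vertex_pairs n \<inter> new_pairs n T = {}"
  by (auto simp: vertex_pairs_def new_pairs_def)

text \<open>The decomposition behind the chain rule: \<open>T\<close> is the neighbourhood of the
  new vertex \<open>Suc n\<close> among the old ones.\<close>

lemma sum_Pow_vertex_pairs_Suc:
  fixes f :: "(nat \<times> nat) set \<Rightarrow> real"
  shows "(\<Sum>F\<in>Pow (vertex_pairs (Suc n)). f F) = (\<Sum>F\<in>Pow (vertex_pairs n). \<Sum>T\<in>Pow {1..n}. f (F \<union> new_pairs n T))"
proof -
  let ?h = "\<lambda>(F, T). F \<union> new_pairs n T"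
  have "bij_betw ?h (Pow (vertex_pairs n) \<times> Pow {1..n}) (Pow (vertex_pairs (Suc n)))"
    unfolding bij_betw_def
  proof
    have inj: "inj (\<lambda>i :: nat. (i, Suc n))" by (auto simp: inj_on_def)
    show "inj_on ?h (Pow (vertex_pairs n) \<times> Pow {1..n})"
    proof (rule inj_onI, clarify)
      fix F T F' T'
      assume *: "F \<subseteq> vertex_pairs n" "F' \<subseteq> vertex_pairs n" "F \<union> new_pairs n T = F' \<union> new_pairs n T'"
      have "F = F'" "new_pairs n T = new_pairs n T'"
        using * vertex_pairs_disjoint_new_pairs[of n T] vertex_pairs_disjoint_new_pairs[of n T'] by blast+
      then show "F = F' \<and> T = T'" using inj by (simp add: new_pairs_def inj_image_eq_iff)
    qed
    show "?h ` (Pow (vertex_pairs n) \<times> Pow {1..n}) = Pow (vertex_pairs (Suc n))"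
    proof (intro equalityI subsetI)
      fix F assume F: "F \<in> Pow (vertex_pairs (Suc n))"
      let ?T = "{i \<in> {1..n}. (i, Suc n) \<in> F}"
      have "F = ?h (F \<inter> vertex_pairs n, ?T)"
        using F by (auto simp: vertex_pairs_Suc new_pairs_def)
      then show "F \<in> ?h ` (Pow (vertex_pairs n) \<times> Pow {1..n})"
        by (intro image_eqI[of _ _ "(F \<inter> vertex_pairs n, ?T)"]) auto
    qed (auto simp: vertex_pairs_Suc new_pairs_def)
  qed
  then have "(\<Sum>F\<in>Pow (vertex_pairs (Suc n)). f F) = (\<Sum>z\<in>Pow (vertex_pairs n) \<times> Pow {1..n}. f (?h z))"
    by (rule sum.reindex_bij_betw[symmetric])
  then show ?thesis by (simp add: sum.cartesian_product case_prod_beta)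
qed

context sphere_graph
begin

definition row_weight :: "nat \<Rightarrow> real \<Rightarrow> (nat \<Rightarrow> nat \<Rightarrow> real) \<Rightarrow> (nat \<Rightarrow> real) \<Rightarrow> nat set \<Rightarrow> real" where
  "row_weight n q x y T = (\<Prod>i\<in>{1..n}. if i \<in> T then p + q * edge (x i) y else 1 - (p + q * edge (x i) y))"

lemma graph_weight_Suc:
  assumes F: "F \<subseteq> vertex_pairs n"
  shows "graph_weight (vertex_pairs (Suc n)) (prob q (x(Suc n := y))) (F \<union> new_pairs n T) =
    graph_weight (vertex_pairs n) (prob q x) F * row_weight n q x y T"
proof -
  have mem: "e \<in> F \<union> new_pairs n T \<longleftrightarrow> e \<in> F" "fst e \<noteq> Suc n" "snd e \<noteq> Suc n" if "e \<in> vertex_pairs n" for e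
    using that by (auto simp: vertex_pairs_def new_pairs_def)
  have "graph_weight (vertex_pairs (Suc n)) (prob q (x(Suc n := y))) (F \<union> new_pairs n T) =
    graph_weight (vertex_pairs n) (prob q (x(Suc n := y))) (F \<union> new_pairs n T) *
    graph_weight (new_pairs n {1..n}) (prob q (x(Suc n := y))) (F \<union> new_pairs n T)"
    unfolding vertex_pairs_Suc graph_weight_def
    by (rule prod.union_disjoint)
       (auto simp: finite_vertex_pairs finite_new_pairs vertex_pairs_disjoint_new_pairs)
  also have "graph_weight (vertex_pairs n) (prob q (x(Suc n := y))) (F \<union> new_pairs n T) =
      graph_weight (vertex_pairs n) (prob q x) F"
    unfolding graph_weight_def by (intro prod.cong refl) (simp add: mem prob_def del: Un_iff)
  also have "graph_weight (new_pairs n {1..n}) (prob q (x(Suc n := y))) (F \<union> new_pairs n T) = row_weight n q x y T"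
  proof -
    have "(i, Suc n) \<in> F \<union> new_pairs n T \<longleftrightarrow> i \<in> T" for i
      using F by (auto simp: vertex_pairs_def new_pairs_def)
    then show ?thesis
      unfolding graph_weight_def row_weight_def new_pairs_def[of n "{1..n}"]
      by (subst prod.reindex) (auto simp: inj_on_def prob_def intro!: prod.cong)
  qed
  finally show ?thesis .
qed

lemma edge_prob_bounds:
  assumes "0 \<le> q" "q \<le> 1"
  shows "0 \<le> p + q * edge u v" "p + q * edge u v \<le> 1"
  using prob_bounds[OF assms, of "\<lambda>i. if i = 0 then u else v" 0 1] by (simp_all add: prob_def)

lemma row_weight_bounds:
  assumes "0 \<le> q" "q \<le> 1"
  shows "0 \<le> row_weight n q x y T" "row_weight n q x y T \<le> 1" "\<bar>row_weight n q x y T\<bar> \<le> 1"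
proof -
  have b: "0 \<le> (if i \<in> T then p + q * edge (x i) y else 1 - (p + q * edge (x i) y)) \<and>
      (if i \<in> T then p + q * edge (x i) y else 1 - (p + q * edge (x i) y)) \<le> 1" for i
    using edge_prob_bounds[OF assms, of "x i" y] by simp
  show *: "0 \<le> row_weight n q x y T"
    unfolding row_weight_def using b by (intro prod_nonneg) blast
  show **: "row_weight n q x y T \<le> 1"
    unfolding row_weight_def using b by (intro prod_le_1) blast
  show "\<bar>row_weight n q x y T\<bar> \<le> 1" using * ** by simp
qed

lemma measurable_row_weight [measurable]:
  assumes [measurable]: "\<And>i. i \<in> {1..n} \<Longrightarrow> (\<lambda>z. f z i) \<in> M \<rightarrow>\<^sub>M E" "g \<in> M \<rightarrow>\<^sub>M E"
  shows "(\<lambda>z. row_weight n q (f z) (g z) T) \<in> borel_measurable M"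
  unfolding row_weight_def
proof (rule borel_measurable_prod)
  fix i assume "i \<in> {1..n}"
  then have "(\<lambda>z. edge (f z i) (g z)) \<in> borel_measurable M" by (intro measurable_edge assms)
  then show "(\<lambda>z. if i \<in> T then p + q * edge (f z i) (g z) else 1 - (p + q * edge (f z i) (g z))) \<in> borel_measurable M"
    by simp
qed

text \<open>The conditional law of the new vertex's neighbourhood given the earlier latent points,
  with the new point averaged out.\<close>

definition row_prob :: "nat \<Rightarrow> real \<Rightarrow> (nat \<Rightarrow> nat \<Rightarrow> real) \<Rightarrow> nat set \<Rightarrow> real" where
  "row_prob n q x T = (\<integral>y. row_weight n q x y T \<partial>S)"

lemma measurable_latent_fst [measurable]:
  "i \<in> {1..n} \<Longrightarrow> (\<lambda>z. fst z i) \<in> latent n \<Otimes>\<^sub>M M \<rightarrow>\<^sub>M E"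
  by (rule measurable_compose[OF measurable_fst measurable_latent_component])

lemma measurable_row_prob [measurable]: "(\<lambda>x. row_prob n q x T) \<in> borel_measurable (latent n)"
  unfolding row_prob_def
  by (rule S.borel_measurable_lebesgue_integral) (simp add: case_prod_beta')

lemma row_prob_bounds:
  assumes "0 \<le> q" "q \<le> 1"
  shows "0 \<le> row_prob n q x T" "\<bar>row_prob n q x T\<bar> \<le> 1"
proof -
  show "0 \<le> row_prob n q x T"
    unfolding row_prob_def using row_weight_bounds(1)[OF assms] by (intro integral_nonneg_AE AE_I2)
  show "\<bar>row_prob n q x T\<bar> \<le> 1"
    unfolding row_prob_def using row_weight_bounds(3)[OF assms] by (rule abs_integral_le)
qed

lemma graph_prob_Suc:
  assumes q: "0 \<le> q" "q \<le> 1" and F: "F \<subseteq> vertex_pairs n"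
  shows "graph_prob (Suc n) q (F \<union> new_pairs n T) =
    (\<integral>x. graph_weight (vertex_pairs n) (prob q x) F * row_prob n q x T \<partial>latent n)"
proof -
  interpret product_sigma_finite "\<lambda>_ :: nat. S" by standard
  have ins: "insert (Suc n) {1..n} = {1..Suc n}" by auto
  have L: "latent (Suc n) = PiM (insert (Suc n) {1..n}) (\<lambda>_. S)" unfolding latent_points_def ins ..
  have "graph_prob (Suc n) q (F \<union> new_pairs n T) =
      (\<integral>x. (\<integral>y. graph_weight (vertex_pairs (Suc n)) (prob q (x(Suc n := y))) (F \<union> new_pairs n T) \<partial>S) \<partial>PiM {1..n} (\<lambda>_. S))"
    unfolding graph_prob_def L
    by (rule product_integral_insert) (use integrable_graph_weight[OF q, of "Suc n"] in \<open>auto simp: L\<close>)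
  then show ?thesis by (simp add: graph_weight_Suc[OF F] row_prob_def latent_points_def)
qed

lemma sum_row_weight: "(\<Sum>T\<in>Pow {1..n}. row_weight n q x y T) = 1"
proof -
  have "(\<Sum>T\<in>Pow {1..n}. row_weight n q x y T) =
      (\<Sum>T\<in>Pow {1..n}. (\<Prod>i\<in>T. p + q * edge (x i) y) * (\<Prod>i\<in>{1..n} - T. 1 - (p + q * edge (x i) y)))"
    unfolding row_weight_def by (intro sum.cong refl prod_if_mem) auto
  also have "\<dots> = (\<Prod>i\<in>{1..n}. (p + q * edge (x i) y) + (1 - (p + q * edge (x i) y)))"
    by (rule prod_add[symmetric]) simp
  finally show ?thesis by simp
qed

lemma integrable_row_weight:
  assumes q: "0 \<le> q" "q \<le> 1" and x: "x \<in> space (latent n)"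
  shows "integrable S (\<lambda>y. row_weight n q x y T)"
proof -
  have "x i \<in> space E" if "i \<in> {1..n}" for i
    using measurable_space[OF measurable_latent_component[OF that] x] .
  then have "(\<lambda>y. row_weight n q x y T) \<in> borel_measurable E"
    by (intro measurable_row_weight) auto
  then show ?thesis using row_weight_bounds(3)[OF q] by (intro integrable_bounded) auto
qed

lemma sum_row_prob:
  assumes q: "0 \<le> q" "q \<le> 1" and x: "x \<in> space (latent n)"
  shows "(\<Sum>T\<in>Pow {1..n}. row_prob n q x T) = 1"
proof -
  have "(\<Sum>T\<in>Pow {1..n}. row_prob n q x T) = (\<integral>y. (\<Sum>T\<in>Pow {1..n}. row_weight n q x y T) \<partial>S)"
    unfolding row_prob_def by (rule Bochner_Integration.integral_sum[symmetric]) (rule integrable_row_weight[OF q x])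
  then show ?thesis unfolding sum_row_weight by (simp add: S.prob_space)
qed

definition row_null :: "nat \<Rightarrow> nat set \<Rightarrow> real" where
  "row_null n T = (\<Prod>i\<in>{1..n}. if i \<in> T then p else 1 - p)"

lemma row_null_pos: "row_null n T > 0"
  unfolding row_null_def using p by (intro prod_pos) auto

lemma graph_prob_0_pos: "graph_prob n 0 F > 0"
  unfolding graph_prob_0 graph_weight_def using p by (intro prod_pos) auto

lemma graph_prob_0_Suc:
  assumes F: "F \<subseteq> vertex_pairs n"
  shows "graph_prob (Suc n) 0 (F \<union> new_pairs n T) = graph_prob n 0 F * row_null n T"
proof -
  have "row_weight n 0 x y T = row_null n T" for x y
    unfolding row_weight_def row_null_def by (intro prod.cong) auto
  then have "row_prob n 0 x T = row_null n T" for x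
    by (simp add: row_prob_def S.prob_space)
  then show ?thesis by (simp add: graph_prob_Suc[OF _ _ F]) (simp add: graph_prob_def)
qed

lemma integrable_graph_weight_row_prob:
  assumes q: "0 \<le> q" "q \<le> 1"
  shows "integrable (latent n) (\<lambda>x. graph_weight (vertex_pairs n) (prob q x) F * row_prob n q x T ^ k)"
proof (rule integrable_latent[where B = 1])
  fix x
  show "\<bar>graph_weight (vertex_pairs n) (prob q x) F * row_prob n q x T ^ k\<bar> \<le> 1"
  proof (rule abs_mult_le_1)
    show "\<bar>graph_weight (vertex_pairs n) (prob q x) F\<bar> \<le> 1"
      using graph_weight_bounds[of "vertex_pairs n" "prob q x" F] prob_bounds[OF q] by simp
    show "\<bar>row_prob n q x T ^ k\<bar> \<le> 1"
      unfolding power_abs using row_prob_bounds(2)[OF q] by (intro power_le_one) auto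
  qed
qed measurable

lemma sum_graph_prob_Suc:
  assumes q: "0 \<le> q" "q \<le> 1" and F: "F \<subseteq> vertex_pairs n"
  shows "(\<Sum>T\<in>Pow {1..n}. graph_prob (Suc n) q (F \<union> new_pairs n T)) = graph_prob n q F"
proof -
  have "(\<Sum>T\<in>Pow {1..n}. graph_prob (Suc n) q (F \<union> new_pairs n T)) =
      (\<integral>x. (\<Sum>T\<in>Pow {1..n}. graph_weight (vertex_pairs n) (prob q x) F * row_prob n q x T) \<partial>latent n)"
    using integrable_graph_weight_row_prob[OF q, of n F _ 1]
    by (simp add: graph_prob_Suc[OF q F])
  also have "\<dots> = graph_prob n q F"
    unfolding graph_prob_def sum_distrib_left[symmetric]
    by (intro Bochner_Integration.integral_cong refl) (simp add: sum_row_prob[OF q] del: One_nat_def)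
  finally show ?thesis .
qed

text \<open>Cauchy--Schwarz for the measure with density \<open>graph_weight\<close>.\<close>
lemma graph_prob_Suc_square_le:
  assumes q: "0 \<le> q" "q \<le> 1" and F: "F \<subseteq> vertex_pairs n"
  shows "(graph_prob (Suc n) q (F \<union> new_pairs n T))\<^sup>2 / graph_prob n q F \<le>
    (\<integral>x. graph_weight (vertex_pairs n) (prob q x) F * (row_prob n q x T)\<^sup>2 \<partial>latent n)"
proof (cases "graph_prob n q F = 0")
  case True
  have "0 \<le> (\<integral>x. graph_weight (vertex_pairs n) (prob q x) F * (row_prob n q x T)\<^sup>2 \<partial>latent n)"
    using graph_weight_bounds(1)[of "vertex_pairs n" "prob q _" F] prob_bounds[OF q]
    by (intro integral_nonneg_AE AE_I2 mult_nonneg_nonneg) auto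
  then show ?thesis using True by simp
next
  case False
  let ?W = "\<lambda>x. graph_weight (vertex_pairs n) (prob q x) F" and ?B = "\<lambda>x. row_prob n q x T"
  define P where "P = graph_prob n q F"
  define P' where "P' = graph_prob (Suc n) q (F \<union> new_pairs n T)"
  define c where "c = P' / P"
  have P: "P > 0" using False graph_prob_nonneg[OF q, of n F] by (simp add: P_def)
  have iW: "integrable (latent n) ?W" by (rule integrable_graph_weight[OF q])
  have iWB: "integrable (latent n) (\<lambda>x. ?W x * ?B x)"
    using integrable_graph_weight_row_prob[OF q, of n F T 1] by simp
  have iWB2: "integrable (latent n) (\<lambda>x. ?W x * (?B x)\<^sup>2)"
    by (rule integrable_graph_weight_row_prob[OF q])
  have "0 \<le> (\<integral>x. ?W x * (?B x - c)\<^sup>2 \<partial>latent n)"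
    using graph_weight_bounds(1)[of "vertex_pairs n" "prob q _" F] prob_bounds[OF q]
    by (intro integral_nonneg_AE AE_I2 mult_nonneg_nonneg) auto
  also have "(\<lambda>x. ?W x * (?B x - c)\<^sup>2) = (\<lambda>x. ?W x * (?B x)\<^sup>2 - 2 * c * (?W x * ?B x) + c\<^sup>2 * ?W x)"
    by (simp add: power2_diff algebra_simps)
  also have "(\<integral>x. ?W x * (?B x)\<^sup>2 - 2 * c * (?W x * ?B x) + c\<^sup>2 * ?W x \<partial>latent n) =
      (\<integral>x. ?W x * (?B x)\<^sup>2 \<partial>latent n) - 2 * c * P' + c\<^sup>2 * P"
    using iW iWB iWB2 by (simp add: P_def P'_def graph_prob_def[of n] graph_prob_Suc[OF q F])
  also have "c\<^sup>2 * P = c * P'" using P by (simp add: c_def power2_eq_square)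
  finally have "c * P' \<le> (\<integral>x. ?W x * (?B x)\<^sup>2 \<partial>latent n)" by linarith
  then show ?thesis by (simp add: c_def power2_eq_square P_def P'_def)
qed

section \<open>The \<chi>-square divergence of a new row\<close>

lemma Fubini_latent:
  fixes f :: "(nat \<Rightarrow> nat \<Rightarrow> real) \<Rightarrow> (nat \<Rightarrow> real) \<Rightarrow> real"
  assumes [measurable]: "(\<lambda>(x, y). f x y) \<in> borel_measurable (latent n \<Otimes>\<^sub>M S)" and B: "\<And>x y. \<bar>f x y\<bar> \<le> B"
  shows "(\<integral>x. (\<integral>y. f x y \<partial>S) \<partial>latent n) = (\<integral>y. (\<integral>x. f x y \<partial>latent n) \<partial>S)"
proof -
  interpret LS: pair_prob_space "latent n" S ..
  have "integrable (latent n \<Otimes>\<^sub>M S) (\<lambda>(x, y). f x y)"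
    using B by (intro LS.P.integrable_const_bound[of _ B]) auto
  then show ?thesis by (rule LS.Fubini_integral[symmetric])
qed

text \<open>Two copies \<open>y\<close> and \<open>y'\<close> of the new point appear because an
  averaged likelihood is going to be squared. The sum factorises, and for one pair (p + a) (p + b) /
  p + (1 - p - a) (1 - p - b) / (1 - p) = 1 + a b / (p (1 - p)).\<close>

lemma sum_row_weight_square:
  shows "(\<Sum>T\<in>Pow {1..n}. row_weight n q x y T * row_weight n q x y' T / row_null n T) =
    (\<Prod>i\<in>{1..n}. 1 + q\<^sup>2 / (p * (1 - p)) * (edge y (x i) * edge (x i) y'))"
proof -
  let ?w = "\<lambda>i. p + q * edge (x i) y" and ?w' = "\<lambda>i. p + q * edge (x i) y'"
  have "row_weight n q x y T * row_weight n q x y' T / row_null n T =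
      (\<Prod>i\<in>T. ?w i * ?w' i / p) * (\<Prod>i\<in>{1..n} - T. (1 - ?w i) * (1 - ?w' i) / (1 - p))"
    if "T \<in> Pow {1..n}" for T
  proof -
    have "row_weight n q x y T * row_weight n q x y' T / row_null n T =
        (\<Prod>i\<in>{1..n}. if i \<in> T then ?w i * ?w' i / p else (1 - ?w i) * (1 - ?w' i) / (1 - p))"
      unfolding row_weight_def row_null_def prod.distrib[symmetric] prod_dividef[symmetric]
      by (intro prod.cong) auto
    then show ?thesis using that by (simp add: prod_if_mem)
  qed
  then have "(\<Sum>T\<in>Pow {1..n}. row_weight n q x y T * row_weight n q x y' T / row_null n T) =
      (\<Prod>i\<in>{1..n}. ?w i * ?w' i / p + (1 - ?w i) * (1 - ?w' i) / (1 - p))"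
    by (simp add: prod_add)
  also have "\<dots> = (\<Prod>i\<in>{1..n}. 1 + q\<^sup>2 / (p * (1 - p)) * (edge y (x i) * edge (x i) y'))"
  proof (intro prod.cong refl)
    fix i
    have "(p + a) * (p + b) / p + (1 - (p + a)) * (1 - (p + b)) / (1 - p) = 1 + a * b / (p * (1 - p))" for a b
      using p by (simp add: divide_simps) (simp add: algebra_simps)
    from this[of "q * edge (x i) y" "q * edge (x i) y'"]
    show "?w i * ?w' i / p + (1 - ?w i) * (1 - ?w' i) / (1 - p) = 1 + q\<^sup>2 / (p * (1 - p)) * (edge y (x i) * edge (x i) y')"
      by (simp add: edge_commute[of y] power2_eq_square mult_ac)
  qed
  finally show ?thesis .
qed

text \<open>The square of \<open>row_prob\<close> is a double integral over two independent copies
  of the new point. Once these are fixed, the earlier points are independent and each contributes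
  the same factor, hence the n-th power.\<close>

lemma integral_sum_row_prob_square:
  assumes q: "0 \<le> q" "q \<le> 1"
  shows "(\<integral>x. (\<Sum>T\<in>Pow {1..n}. (row_prob n q x T)\<^sup>2 / row_null n T) \<partial>latent n) =
    (\<integral>y. (\<integral>y'. (1 + q\<^sup>2 / (p * (1 - p)) * path2 y y') ^ n \<partial>S) \<partial>S)"
proof -
  define r where "r = q\<^sup>2 / (p * (1 - p))"
  have r: "r \<ge> 0" using p by (simp add: r_def)
  let ?f = "\<lambda>x y y'. \<Prod>i\<in>{1..n}. 1 + r * (edge y (x i) * edge (x i) y')"
  have term_bound: "\<bar>1 + r * (edge y (x i) * edge (x i) y')\<bar> \<le> 1 + r" for x y y' and i :: nat
  proof -
    have "r * \<bar>edge y (x i) * edge (x i) y'\<bar> \<le> r * 1"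
      using r edge_bounds by (intro mult_left_mono abs_mult_le_1) auto
    moreover have "\<bar>r * (edge y (x i) * edge (x i) y')\<bar> = r * \<bar>edge y (x i) * edge (x i) y'\<bar>"
      using r by (simp add: abs_mult)
    ultimately show ?thesis by linarith
  qed
  have f_bound: "\<bar>?f x y y'\<bar> \<le> (1 + r) ^ n" for x y y'
  proof -
    have "\<bar>?f x y y'\<bar> = (\<Prod>i\<in>{1..n}. \<bar>1 + r * (edge y (x i) * edge (x i) y')\<bar>)" by (rule abs_prod)
    also have "\<dots> \<le> (\<Prod>i\<in>{1..n}. 1 + r)"
      using term_bound by (intro prod_mono) auto
    finally show ?thesis by simp
  qed
  have "(\<integral>x. (\<Sum>T\<in>Pow {1..n}. (row_prob n q x T)\<^sup>2 / row_null n T) \<partial>latent n) =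
      (\<integral>x. (\<integral>y. (\<integral>y'. ?f x y y' \<partial>S) \<partial>S) \<partial>latent n)"
  proof (intro Bochner_Integration.integral_cong refl)
    fix x assume x: "x \<in> space (latent n)"
    note i = integrable_row_weight[OF q x]
    let ?g = "\<lambda>T y y'. row_weight n q x y T * row_weight n q x y' T / row_null n T"
    have "(\<Sum>T\<in>Pow {1..n}. (row_prob n q x T)\<^sup>2 / row_null n T) = (\<Sum>T\<in>Pow {1..n}. \<integral>y. (\<integral>y'. ?g T y y' \<partial>S) \<partial>S)"
      by (intro sum.cong refl) (simp add: row_prob_def power2_eq_square)
    also have "\<dots> = (\<integral>y. (\<Sum>T\<in>Pow {1..n}. \<integral>y'. ?g T y y' \<partial>S) \<partial>S)"
      by (rule Bochner_Integration.integral_sum[symmetric]) (use i in simp)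
    also have "\<dots> = (\<integral>y. (\<integral>y'. (\<Sum>T\<in>Pow {1..n}. ?g T y y') \<partial>S) \<partial>S)"
      by (intro Bochner_Integration.integral_cong refl Bochner_Integration.integral_sum[symmetric]) (use i in simp)
    finally show "(\<Sum>T\<in>Pow {1..n}. (row_prob n q x T)\<^sup>2 / row_null n T) = (\<integral>y. (\<integral>y'. ?f x y y' \<partial>S) \<partial>S)"
      by (simp only: sum_row_weight_square r_def)
  qed
  also have "\<dots> = (\<integral>y. (\<integral>x. (\<integral>y'. ?f x y y' \<partial>S) \<partial>latent n) \<partial>S)"
  proof (rule Fubini_latent)
    note SE = measurable_cong_sets[OF refl sets_sphere_uniform]
    have m1: "(\<lambda>w. fst (fst w) i) \<in> (latent n \<Otimes>\<^sub>M S) \<Otimes>\<^sub>M S \<rightarrow>\<^sub>M E" if "i \<in> {1..n}" for i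
      using that by (intro measurable_compose[OF measurable_fst measurable_latent_fst])
    have "(\<lambda>w. snd (fst w)) \<in> (latent n \<Otimes>\<^sub>M S) \<Otimes>\<^sub>M S \<rightarrow>\<^sub>M S"
      by (rule measurable_compose[OF measurable_fst measurable_snd])
    then have m2: "(\<lambda>w. snd (fst w)) \<in> (latent n \<Otimes>\<^sub>M S) \<Otimes>\<^sub>M S \<rightarrow>\<^sub>M E"
      unfolding SE .
    have "snd \<in> (latent n \<Otimes>\<^sub>M S) \<Otimes>\<^sub>M S \<rightarrow>\<^sub>M S"
      by (rule measurable_snd)
    then have m3: "snd \<in> (latent n \<Otimes>\<^sub>M S) \<Otimes>\<^sub>M S \<rightarrow>\<^sub>M E"
      unfolding SE .
    have "(\<lambda>w. ?f (fst (fst w)) (snd (fst w)) (snd w)) \<in> borel_measurable ((latent n \<Otimes>\<^sub>M S) \<Otimes>\<^sub>M S)"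
      by (intro borel_measurable_prod borel_measurable_add borel_measurable_times borel_measurable_const
          measurable_edge m1 m2 m3)
    then show "(\<lambda>(x, y). \<integral>y'. ?f x y y' \<partial>S) \<in> borel_measurable (latent n \<Otimes>\<^sub>M S)"
      unfolding case_prod_beta by (intro S.borel_measurable_lebesgue_integral) (simp add: case_prod_beta')
    show "\<bar>\<integral>y'. ?f x y y' \<partial>S\<bar> \<le> (1 + r) ^ n" for x y
      using f_bound by (rule abs_integral_le)
  qed
  also have "\<dots> = (\<integral>y. (\<integral>y'. (\<integral>x. ?f x y y' \<partial>latent n) \<partial>S) \<partial>S)"
  proof (intro Bochner_Integration.integral_cong refl Fubini_latent)
    fix y assume y: "y \<in> space S"
    then have y' [measurable]: "y \<in> space E" by (simp add: space_sphere_uniform)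
    show "(\<lambda>(x, y'). ?f x y y') \<in> borel_measurable (latent n \<Otimes>\<^sub>M S)"
      unfolding case_prod_beta
    proof (intro borel_measurable_prod borel_measurable_add borel_measurable_times borel_measurable_const measurable_edge)
      fix i assume "i \<in> {1..n}"
      then show "(\<lambda>w. fst w i) \<in> latent n \<Otimes>\<^sub>M S \<rightarrow>\<^sub>M E" by (rule measurable_latent_fst)
    qed measurable
  qed (rule f_bound)
  also have "\<dots> = (\<integral>y. (\<integral>y'. (1 + r * path2 y y') ^ n \<partial>S) \<partial>S)"
  proof (intro Bochner_Integration.integral_cong refl)
    fix y y' assume "y \<in> space S" "y' \<in> space S"
    then have [measurable]: "y \<in> space E" "y' \<in> space E" by (simp_all add: space_sphere_uniform)
    interpret product_sigma_finite "\<lambda>_ :: nat. S" by standard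
    have i: "integrable S (\<lambda>z. edge y z * edge z y')" by (rule integrable_edge_edge) measurable
    have "(\<integral>x. ?f x y y' \<partial>latent n) = (\<Prod>i\<in>{1..n}. \<integral>z. 1 + r * (edge y z * edge z y') \<partial>S)"
      unfolding latent_points_def
      by (rule product_integral_prod) (use i in auto)
    also have "\<dots> = (1 + r * path2 y y') ^ n"
      using i by (simp add: path2_def S.prob_space)
    finally show "(\<integral>x. ?f x y y' \<partial>latent n) = (1 + r * path2 y y') ^ n" .
  qed
  finally show ?thesis by (simp add: r_def)
qed

text \<open>The relative entropy of the geometric graph with respect to the Erdos-Renyi graph. A
  graph of probability 0 contributes 0 through the outer factor.\<close>

definition entropy :: "nat \<Rightarrow> real \<Rightarrow> real" where
  "entropy n q = (\<Sum>F\<in>Pow (vertex_pairs n). graph_prob n q F * ln (graph_prob n q F / graph_prob n 0 F))"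

text \<open>The chain rule for the conditional law P' / P of the new row given \<open>F\<close>; by
  ln t \<le> t - 1, its relative entropy to \<open>row_null\<close> is at most its \<chi>-square
  divergence. Conditioning on the latent points instead of \<open>F\<close> can only increase the
  divergence, and the sum over \<open>F\<close> then removes the graph weights.\<close>

lemma entropy_Suc_le:
  assumes q: "0 \<le> q" "q \<le> 1"
  shows "entropy (Suc n) q \<le> entropy n q + (\<integral>y. (\<integral>y'. (1 + q\<^sup>2 / (p * (1 - p)) * path2 y y') ^ n \<partial>S) \<partial>S) - 1"
proof -
  let ?P = "graph_prob n q" and ?Q = "graph_prob n 0" and ?V = "vertex_pairs n"
  let ?P' = "\<lambda>F T. graph_prob (Suc n) q (F \<union> new_pairs n T)"
  have step: "?P' F T * ln (?P' F T / (?Q F * row_null n T)) \<le>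
      ?P' F T * ln (?P F / ?Q F) + (?P' F T)\<^sup>2 / ?P F / row_null n T - ?P' F T"
    if F: "F \<in> Pow ?V" and T: "T \<in> Pow {1..n}" for F T
  proof (cases "?P' F T = 0")
    case False
    then have P': "?P' F T > 0" using graph_prob_nonneg[OF q, of "Suc n" "F \<union> new_pairs n T"] by linarith
    \<comment> \<open>P' is one of the non-negative terms that add up to P, so P' > 0 entails P > 0
      and the quotients are genuine.\<close>
    have "?P' F T \<le> (\<Sum>T\<in>Pow {1..n}. ?P' F T)"
      using T graph_prob_nonneg[OF q] by (intro member_le_sum) auto
    also have "\<dots> = ?P F" using F by (intro sum_graph_prob_Suc[OF q]) auto
    finally have P: "?P F > 0" using P' by linarith
    note Q = graph_prob_0_pos[of n F] row_null_pos[of n T]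
    have "ln (?P' F T / (?Q F * row_null n T)) = ln (?P F / ?Q F * (?P' F T / (?P F * row_null n T)))"
      using P by simp
    also have "\<dots> = ln (?P F / ?Q F) + ln (?P' F T / (?P F * row_null n T))"
      using P P' Q by (intro ln_mult_pos) auto
    also have "ln (?P' F T / (?P F * row_null n T)) \<le> ?P' F T / (?P F * row_null n T) - 1"
      using P P' Q by (intro ln_le_minus_one) auto
    finally have "?P' F T * ln (?P' F T / (?Q F * row_null n T)) \<le>
        ?P' F T * (ln (?P F / ?Q F) + (?P' F T / (?P F * row_null n T) - 1))"
      using P' by (intro mult_left_mono) auto
    then show ?thesis by (simp add: algebra_simps power2_eq_square)
  qed simp
  have W1: "(\<Sum>F\<in>Pow ?V. \<Sum>T\<in>Pow {1..n}. (?P' F T)\<^sup>2 / ?P F / row_null n T) \<le>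
      (\<integral>x. (\<Sum>T\<in>Pow {1..n}. (row_prob n q x T)\<^sup>2 / row_null n T) \<partial>latent n)"
  proof -
    let ?W = "\<lambda>x F. graph_weight ?V (prob q x) F"
    have "(\<Sum>F\<in>Pow ?V. \<Sum>T\<in>Pow {1..n}. (?P' F T)\<^sup>2 / ?P F / row_null n T) \<le>
        (\<Sum>F\<in>Pow ?V. \<Sum>T\<in>Pow {1..n}. (\<integral>x. ?W x F * (row_prob n q x T)\<^sup>2 \<partial>latent n) / row_null n T)"
      using row_null_pos[of n] by (intro sum_mono divide_right_mono graph_prob_Suc_square_le q) (auto intro: less_imp_le)
    also have "\<dots> = (\<integral>x. (\<Sum>F\<in>Pow ?V. \<Sum>T\<in>Pow {1..n}. ?W x F * (row_prob n q x T)\<^sup>2 / row_null n T) \<partial>latent n)"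
      using integrable_graph_weight_row_prob[OF q, of n _ _ 2] by simp
    also have "\<dots> = (\<integral>x. (\<Sum>T\<in>Pow {1..n}. (row_prob n q x T)\<^sup>2 / row_null n T) \<partial>latent n)"
    proof (intro Bochner_Integration.integral_cong refl)
      fix x
      have "(\<Sum>F\<in>Pow ?V. \<Sum>T\<in>Pow {1..n}. ?W x F * (row_prob n q x T)\<^sup>2 / row_null n T) =
          (\<Sum>F\<in>Pow ?V. ?W x F) * (\<Sum>T\<in>Pow {1..n}. (row_prob n q x T)\<^sup>2 / row_null n T)"
        by (simp add: sum_product)
      then show "(\<Sum>F\<in>Pow ?V. \<Sum>T\<in>Pow {1..n}. ?W x F * (row_prob n q x T)\<^sup>2 / row_null n T) =
          (\<Sum>T\<in>Pow {1..n}. (row_prob n q x T)\<^sup>2 / row_null n T)"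
        by (simp add: sum_graph_weight finite_vertex_pairs)
    qed
    finally show ?thesis .
  qed
  have "entropy (Suc n) q = (\<Sum>F\<in>Pow ?V. \<Sum>T\<in>Pow {1..n}. ?P' F T * ln (?P' F T / (?Q F * row_null n T)))"
    unfolding entropy_def sum_Pow_vertex_pairs_Suc by (intro sum.cong refl) (simp add: graph_prob_0_Suc)
  also have "\<dots> \<le> (\<Sum>F\<in>Pow ?V. \<Sum>T\<in>Pow {1..n}. ?P' F T * ln (?P F / ?Q F) + (?P' F T)\<^sup>2 / ?P F / row_null n T - ?P' F T)"
    by (intro sum_mono step)
  also have "\<dots> = (\<Sum>F\<in>Pow ?V. (\<Sum>T\<in>Pow {1..n}. ?P' F T) * ln (?P F / ?Q F)) +
      (\<Sum>F\<in>Pow ?V. \<Sum>T\<in>Pow {1..n}. (?P' F T)\<^sup>2 / ?P F / row_null n T) - (\<Sum>F\<in>Pow ?V. \<Sum>T\<in>Pow {1..n}. ?P' F T)"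
    by (simp only: sum.distrib sum_subtractf sum_distrib_right)
  also have "(\<Sum>F\<in>Pow ?V. (\<Sum>T\<in>Pow {1..n}. ?P' F T) * ln (?P F / ?Q F)) = entropy n q"
    unfolding entropy_def by (intro sum.cong refl) (simp add: sum_graph_prob_Suc[OF q] del: One_nat_def)
  also have "(\<Sum>F\<in>Pow ?V. \<Sum>T\<in>Pow {1..n}. ?P' F T) = 1"
    unfolding sum_graph_prob[OF q, of n, symmetric] by (intro sum.cong refl) (simp add: sum_graph_prob_Suc[OF q] del: One_nat_def)
  finally show ?thesis using W1 unfolding integral_sum_row_prob_square[OF q] by linarith
qed

text \<open>Every step is charged with the bound C for rows of length n, so n steps cost at most n
  C. The hypothesis makes the row estimate available for all k \<le> n.\<close>

lemma entropy_le:
  assumes q: "0 \<le> q" "q \<le> 1" and n: "8 * real n * (q\<^sup>2 / (p * (1 - p))) \<le> sqrt (real d)"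
  shows "entropy n q \<le> 256 * exp 4 * real n ^ 3 * q ^ 4 / ((p * (1 - p))\<^sup>2 * real d)"
proof -
  define r where "r = q\<^sup>2 / (p * (1 - p))"
  have r: "r \<ge> 0" "r * (p * (1 - p)) \<le> 1"
    using p q by (simp_all add: r_def abs_square_le_1)
  define C where "C = 256 * exp 4 * (real n)\<^sup>2 * r\<^sup>2 / real d"
  have "entropy k q \<le> real k * C" if "k \<le> n" for k
    using that
  proof (induction k)
    case 0
    have "vertex_pairs 0 = {}" by (auto simp: vertex_pairs_def)
    then show ?case by (simp add: entropy_def graph_prob_def graph_weight_def latent.prob_space)
  next
    case (Suc k)
    have kn: "8 * real k * r \<le> sqrt (real d)"
    proof -
      have "8 * real k * r \<le> 8 * real n * r" using Suc.prems r by (intro mult_right_mono) auto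
      then show ?thesis using n by (simp add: r_def)
    qed
    have bd: "(\<integral>z. (1 + r * path2 y z) ^ k \<partial>S) \<le> 1 + C" if y: "y \<in> unit_sphere d" for y
    proof -
      have "(\<integral>z. (1 + r * path2 y z) ^ k \<partial>S) \<le> 1 + 256 * exp 4 * (real k)\<^sup>2 * r\<^sup>2 / real d"
        by (rule integral_path2_power_le[OF y r kn])
      also have "\<dots> \<le> 1 + C"
        unfolding C_def using Suc.prems by (intro add_left_mono divide_right_mono mult_right_mono mult_left_mono power_mono) auto
      finally show ?thesis .
    qed
    have "(\<integral>y. (\<integral>z. (1 + r * path2 y z) ^ k \<partial>S) \<partial>S) \<le> (\<integral>y. 1 + C \<partial>S)"
    proof (cases "integrable S (\<lambda>y. \<integral>z. (1 + r * path2 y z) ^ k \<partial>S)")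
      case True
      then show ?thesis by (intro integral_sphere_mono[OF d1] bd) auto
    next
      case False
      have "C \<ge> 0" by (simp add: C_def)
      then show ?thesis using False by (simp add: not_integrable_integral_eq S.prob_space)
    qed
    then have "entropy (Suc k) q \<le> entropy k q + C"
      using entropy_Suc_le[OF q, of k] by (simp add: r_def S.prob_space)
    then show ?case using Suc by (simp add: distrib_right)
  qed
  from this[of n] have "entropy n q \<le> real n * C" by simp
  also have "real n * C = 256 * exp 4 * real n ^ 3 * q ^ 4 / ((p * (1 - p))\<^sup>2 * real d)"
    by (simp add: C_def r_def power_divide power_mult[symmetric] power2_eq_square[of "real n"] power3_eq_cube mult_ac)
  finally show ?thesis .
qed

text \<open>Pinsker's inequality up to a constant, by way of the Hellinger distance.\<close>
lemma total_variation_square_le: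
  assumes q: "0 \<le> q" "q \<le> 1"
  shows "(total_variation (erdos_renyi n p) (geometric_graph n p d q))\<^sup>2 \<le> 4 * entropy n q"
proof -
  let ?P = "graph_prob n q" and ?Q = "graph_prob n 0" and ?V = "Pow (vertex_pairs n)"
  have P: "?P F \<ge> 0" for F by (rule graph_prob_nonneg[OF q])
  have Q: "?Q F > 0" for F by (rule graph_prob_0_pos)
  have sums: "(\<Sum>F\<in>?V. ?P F) = 1" "(\<Sum>F\<in>?V. ?Q F) = 1"
    using sum_graph_prob[OF q] sum_graph_prob[of 0] by auto
  have H: "(\<Sum>F\<in>?V. (sqrt (?P F) - sqrt (?Q F))\<^sup>2) \<le> entropy n q"
  proof -
    have "(sqrt (?P F) - sqrt (?Q F))\<^sup>2 \<le> ?P F * ln (?P F / ?Q F) - ?P F + ?Q F" for F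
    proof (cases "?P F = 0")
      case True
      then show ?thesis using Q[of F] by simp
    next
      case False
      then have Pp: "?P F > 0" using P[of F] by linarith
      \<comment> \<open>Applying ln t \<le> t - 1 to the square root of Q / P, and not to Q / P
        itself, is what produces the squared Hellinger distance.\<close>
      have "ln (sqrt (?Q F / ?P F)) \<le> sqrt (?Q F / ?P F) - 1"
        using Pp Q[of F] by (intro ln_le_minus_one) simp
      moreover have "ln (sqrt (?Q F / ?P F)) = - ln (?P F / ?Q F) / 2"
        using Pp Q[of F] by (simp add: ln_sqrt ln_div)
      ultimately have "2 - 2 * sqrt (?Q F / ?P F) \<le> ln (?P F / ?Q F)" by simp
      then have "?P F * (2 - 2 * sqrt (?Q F / ?P F)) \<le> ?P F * ln (?P F / ?Q F)"
        using Pp by (intro mult_left_mono) auto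
      moreover have "?P F * sqrt (?Q F / ?P F) = sqrt (?P F) * sqrt (?Q F)"
      proof -
        have "?P F = sqrt (?P F) * sqrt (?P F)" using Pp by simp
        then show ?thesis using Pp by (simp add: real_sqrt_divide field_simps)
      qed
      ultimately have "2 * ?P F - 2 * (sqrt (?P F) * sqrt (?Q F)) \<le> ?P F * ln (?P F / ?Q F)"
        by (simp add: right_diff_distrib)
      then show ?thesis using Pp Q[of F] by (simp add: power2_diff)
    qed
    then have "(\<Sum>F\<in>?V. (sqrt (?P F) - sqrt (?Q F))\<^sup>2) \<le> (\<Sum>F\<in>?V. ?P F * ln (?P F / ?Q F) - ?P F + ?Q F)"
      by (rule sum_mono)
    also have "\<dots> = entropy n q"
      by (simp add: sum.distrib sum_subtractf entropy_def sums)
    finally show ?thesis .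
  qed
  have H': "(\<Sum>F\<in>?V. (sqrt (?P F) + sqrt (?Q F))\<^sup>2) \<le> 4"
  proof -
    have "(sqrt (?P F) + sqrt (?Q F))\<^sup>2 \<le> 2 * ?P F + 2 * ?Q F" for F
      using sum_squares_bound[of "sqrt (?P F)" "sqrt (?Q F)"] P[of F] Q[of F]
      by (simp add: power2_sum)
    then have "(\<Sum>F\<in>?V. (sqrt (?P F) + sqrt (?Q F))\<^sup>2) \<le> (\<Sum>F\<in>?V. 2 * ?P F + 2 * ?Q F)"
      by (rule sum_mono)
    also have "\<dots> = 4" by (simp add: sum.distrib sum_distrib_left[symmetric] sums)
    finally show ?thesis .
  qed
  have tv0: "0 \<le> total_variation (erdos_renyi n p) (geometric_graph n p d q)"
    using total_variation_bounds(1)[of n "{}" q] by simp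
  have "(total_variation (erdos_renyi n p) (geometric_graph n p d q))\<^sup>2 \<le> (\<Sum>F\<in>?V. \<bar>?P F - ?Q F\<bar>)\<^sup>2"
    by (intro power_mono total_variation_le q tv0)
  also have "(\<Sum>F\<in>?V. \<bar>?P F - ?Q F\<bar>) = (\<Sum>F\<in>?V. \<bar>sqrt (?P F) - sqrt (?Q F)\<bar> * (sqrt (?P F) + sqrt (?Q F)))"
  proof (intro sum.cong refl)
    fix F
    have "?P F - ?Q F = (sqrt (?P F) - sqrt (?Q F)) * (sqrt (?P F) + sqrt (?Q F))"
      using P[of F] Q[of F] by (simp add: algebra_simps less_imp_le)
    then show "\<bar>?P F - ?Q F\<bar> = \<bar>sqrt (?P F) - sqrt (?Q F)\<bar> * (sqrt (?P F) + sqrt (?Q F))"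
      using P[of F] Q[of F] by (simp only: abs_mult) (simp add: less_imp_le)
  qed
  also have "\<dots>\<^sup>2 \<le> (\<Sum>F\<in>?V. \<bar>sqrt (?P F) - sqrt (?Q F)\<bar>\<^sup>2) * (\<Sum>F\<in>?V. (sqrt (?P F) + sqrt (?Q F))\<^sup>2)"
    by (rule Cauchy_Schwarz_ineq_sum)
  also have "\<dots> \<le> entropy n q * 4"
    using H H' order_trans[OF sum_nonneg H] by (intro mult_mono) (auto intro!: sum_nonneg)
  finally show ?thesis by simp
qed

end

subsection \<open>The limit statements\<close>

lemma total_variation_tendsto_0:
  fixes p :: real and d :: "nat \<Rightarrow> nat" and q :: "nat \<Rightarrow> real"
  assumes p01: "0 < p" "p < 1" and d2: "\<And>n. d n \<ge> 2" and q01: "\<And>n. 0 \<le> q n \<and> q n \<le> 1"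
    and lim: "(\<lambda>n. real n ^ 3 * q n ^ 4 / real (d n)) \<longlonglongrightarrow> 0"
  shows "(\<lambda>n. total_variation (erdos_renyi n p) (geometric_graph n p (d n) (q n))) \<longlonglongrightarrow> 0"
proof -
  let ?a = "\<lambda>n. real n ^ 3 * q n ^ 4 / real (d n)"
  let ?tv = "\<lambda>n. total_variation (erdos_renyi n p) (geometric_graph n p (d n) (q n))"
  define \<rho> where "\<rho> = p * (1 - p)"
  have \<rho>: "\<rho> > 0" using p01 by (simp add: \<rho>_def)
  have sg: "sphere_graph (d n) p" for n using p01 d2 by unfold_locales auto
  have tv0: "0 \<le> ?tv n" for n
    using sphere_graph.total_variation_bounds(1)[OF sg[of n], where n = n and A = "{}" and q = "q n"] by simp
  have "\<forall>\<^sub>F n in sequentially. ?a n < (\<rho> / 8)\<^sup>2"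
    using \<rho> by (intro order_tendstoD(2)[OF lim]) auto
  then have ub: "\<forall>\<^sub>F n in sequentially. (?tv n)\<^sup>2 \<le> 1024 * exp 4 / \<rho>\<^sup>2 * ?a n"
  proof (rule eventually_mono)
    fix n assume n: "?a n < (\<rho> / 8)\<^sup>2"
    interpret sphere_graph "d n" p by (rule sg)
    have d0: "real (d n) > 0" using d2[of n] by simp
    \<comment> \<open>The condition of \<open>entropy_le\<close> only involves n^2 q^4 / d, which is
      dominated by the sequence assumed to vanish.\<close>
    have "real n ^ 2 \<le> real n ^ 3" by (cases "n = 0") (auto intro!: power_increasing)
    then have "real n ^ 2 * q n ^ 4 / real (d n) \<le> ?a n"
      by (intro divide_right_mono mult_right_mono) auto
    then have "real n ^ 2 * q n ^ 4 / real (d n) \<le> (\<rho> / 8)\<^sup>2" using n by linarith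
    then have "(8 * real n * ((q n)\<^sup>2 / \<rho>))\<^sup>2 \<le> real (d n)"
      using d0 \<rho> by (simp add: power_mult_distrib power_divide power_mult[symmetric] field_simps)
    then have "8 * real n * ((q n)\<^sup>2 / (p * (1 - p))) \<le> sqrt (real (d n))"
      unfolding \<rho>_def by (rule real_le_rsqrt)
    then have "entropy n (q n) \<le> 256 * exp 4 * real n ^ 3 * q n ^ 4 / (\<rho>\<^sup>2 * real (d n))"
      unfolding \<rho>_def using q01 by (intro entropy_le) auto
    then have "(?tv n)\<^sup>2 \<le> 4 * (256 * exp 4 * real n ^ 3 * q n ^ 4 / (\<rho>\<^sup>2 * real (d n)))"
      using total_variation_square_le[of "q n" n] q01[of n] by linarith
    then show "(?tv n)\<^sup>2 \<le> 1024 * exp 4 / \<rho>\<^sup>2 * ?a n" by simp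
  qed
  have upper: "(\<lambda>n. 1024 * exp 4 / \<rho>\<^sup>2 * ?a n) \<longlonglongrightarrow> 0"
    by (rule tendsto_mult_right_zero[OF lim])
  have "\<forall>\<^sub>F n in sequentially. 0 \<le> (?tv n)\<^sup>2" by simp
  then have "(\<lambda>n. (?tv n)\<^sup>2) \<longlonglongrightarrow> 0"
    by (rule tendsto_sandwich[OF _ ub tendsto_const upper])
  then have "(\<lambda>n. sqrt ((?tv n)\<^sup>2)) \<longlonglongrightarrow> sqrt 0" by (rule tendsto_real_sqrt)
  then show ?thesis using tv0 by simp
qed

lemma total_variation_tendsto_1:
  fixes p :: real and d :: "nat \<Rightarrow> nat" and q :: "nat \<Rightarrow> real"
  assumes p01: "0 < p" "p < 1" and d2: "\<And>n. d n \<ge> 2" and q01: "\<And>n. 0 \<le> q n \<and> q n \<le> 1"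
    and lim: "filterlim (\<lambda>n. real n ^ 3 * q n ^ 6 / real (d n)) at_top sequentially"
  shows "(\<lambda>n. total_variation (erdos_renyi n p) (geometric_graph n p (d n) (q n))) \<longlonglongrightarrow> 1"
proof -
  let ?a = "\<lambda>n. real n ^ 3 * q n ^ 6 / real (d n)"
  let ?tv = "\<lambda>n. total_variation (erdos_renyi n p) (geometric_graph n p (d n) (q n))"
  have sg: "sphere_graph (d n) p" for n using p01 d2 by unfold_locales auto
  \<comment> \<open>Since d \<ge> 1 and q \<le> 1, the diverging sequence is at most (n q)^3; this
    takes care of the error term 1 / (n q)^2.\<close>
  have nq: "filterlim (\<lambda>n. real n * q n) at_top sequentially"
    unfolding filterlim_at_top
  proof
    fix Z :: real
    have "\<forall>\<^sub>F n in sequentially. \<bar>Z\<bar> ^ 3 \<le> ?a n"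
      using lim unfolding filterlim_at_top by blast
    then show "\<forall>\<^sub>F n in sequentially. Z \<le> real n * q n"
    proof (rule eventually_mono)
      fix n assume Z: "\<bar>Z\<bar> ^ 3 \<le> ?a n"
      have "?a n \<le> real n ^ 3 * q n ^ 6 / 1"
        using d2[of n] q01[of n] by (intro divide_left_mono) auto
      also have "\<dots> \<le> real n ^ 3 * q n ^ 3"
        using q01[of n] by (simp, intro mult_left_mono power_decreasing) auto
      finally have "\<bar>Z\<bar> ^ 3 \<le> (real n * q n) ^ 3" using Z by (simp add: power_mult_distrib)
      then have "\<bar>Z\<bar> \<le> real n * q n"
        by (rule power_le_imp_le_base[where n = 2, unfolded Suc_eq_plus1, simplified]) (use q01[of n] in auto)
      then show "Z \<le> real n * q n" by linarith
    qed
  qed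
  define C where "C = 11664 * 2 ^ 60 / (min p (1 - p)) ^ 8"
  have lb: "\<forall>\<^sub>F n in sequentially. 1 - C * (1 / ?a n + 128 / (real n * q n)\<^sup>2) \<le> ?tv n"
    using eventually_ge_at_top[of 3] filterlim_at_top_dense[THEN iffD1, OF nq, rule_format, of 0]
  proof eventually_elim
    case (elim n)
    interpret sphere_graph "d n" p by (rule sg)
    have "q n \<noteq> 0" using elim(2) by auto
    then have "0 < q n" "q n \<le> 1" using q01[of n] by auto
    from total_variation_ge[OF this elim(1)] show ?case
      by (simp add: C_def min_prob_def)
  qed
  have lower: "(\<lambda>n. 1 - C * (1 / ?a n + 128 / (real n * q n)\<^sup>2)) \<longlonglongrightarrow> 1"
  proof -
    have "(\<lambda>n. 1 / ?a n) \<longlonglongrightarrow> 0"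
      by (rule tendsto_divide_0[OF tendsto_const filterlim_at_top_imp_at_infinity[OF lim]])
    moreover have "(\<lambda>n. 128 / (real n * q n)\<^sup>2) \<longlonglongrightarrow> 0"
      by (rule tendsto_divide_0[OF tendsto_const filterlim_at_top_imp_at_infinity[OF filterlim_pow_at_top[OF _ nq]]]) simp
    ultimately have "(\<lambda>n. 1 - C * (1 / ?a n + 128 / (real n * q n)\<^sup>2)) \<longlonglongrightarrow> 1 - C * (0 + 0)"
      by (intro tendsto_diff tendsto_const tendsto_mult tendsto_add)
    then show ?thesis by simp
  qed
  have ub: "\<forall>\<^sub>F n in sequentially. ?tv n \<le> 1"
    by (rule always_eventually) (use sphere_graph.total_variation_bounds(2)[OF sg] in blast)
  show ?thesis
    by (rule tendsto_sandwich[OF lb ub lower tendsto_const])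
qed

theorem theorem1p1:
  fixes p :: real and d :: "nat \<Rightarrow> nat" and q :: "nat \<Rightarrow> real"
  assumes "0 < p" and "p < 1"
    and "\<And>n. d n \<ge> 2"
    and "\<And>n. 0 \<le> q n \<and> q n \<le> 1"
  shows "((\<lambda>n. real n * q n) \<longlonglongrightarrow> 0 \<or> (\<lambda>n. real n ^ 3 * q n ^ 2 / real (d n)) \<longlonglongrightarrow> 0
            \<longrightarrow> (\<lambda>n. total_variation (erdos_renyi n p) (geometric_graph n p (d n) (q n))) \<longlonglongrightarrow> 0)
       \<and> (filterlim (\<lambda>n. real n ^ 3 * q n ^ 6 / real (d n)) at_top sequentially
            \<longrightarrow> (\<lambda>n. total_variation (erdos_renyi n p) (geometric_graph n p (d n) (q n))) \<longlonglongrightarrow> 1)"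
proof (intro conjI impI)
  let ?a = "\<lambda>n. real n ^ 3 * q n ^ 4 / real (d n)"
  have a0: "0 \<le> ?a n" for n using assms(4)[of n] by simp
  assume "(\<lambda>n. real n * q n) \<longlonglongrightarrow> 0 \<or> (\<lambda>n. real n ^ 3 * q n ^ 2 / real (d n)) \<longlonglongrightarrow> 0"
  then have "?a \<longlonglongrightarrow> 0"
  proof
    assume "(\<lambda>n. real n * q n) \<longlonglongrightarrow> 0"
    then have "(\<lambda>n. (real n * q n) ^ 3) \<longlonglongrightarrow> 0 ^ 3" by (rule tendsto_power)
    then have upper: "(\<lambda>n. (real n * q n) ^ 3) \<longlonglongrightarrow> 0" by simp
    have le: "?a n \<le> (real n * q n) ^ 3" for n
    proof -
      have "?a n \<le> real n ^ 3 * q n ^ 4 / 1"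
        using assms(3)[of n] assms(4)[of n] by (intro divide_left_mono) auto
      also have "\<dots> \<le> real n ^ 3 * q n ^ 3"
        using assms(4)[of n] by (simp, intro mult_left_mono power_decreasing) auto
      finally show ?thesis by (simp add: power_mult_distrib)
    qed
    show ?thesis
      by (rule tendsto_sandwich[OF _ _ tendsto_const upper]) (use a0 le in simp_all)
  next
    assume upper: "(\<lambda>n. real n ^ 3 * q n ^ 2 / real (d n)) \<longlonglongrightarrow> 0"
    have le: "?a n \<le> real n ^ 3 * q n ^ 2 / real (d n)" for n
      using assms(4)[of n] by (intro divide_right_mono mult_left_mono power_decreasing) auto
    show ?thesis
      by (rule tendsto_sandwich[OF _ _ tendsto_const upper]) (use a0 le in simp_all)
  qed
  with assms show "(\<lambda>n. total_variation (erdos_renyi n p) (geometric_graph n p (d n) (q n))) \<longlonglongrightarrow> 0"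
    by (rule total_variation_tendsto_0)
next
  assume "filterlim (\<lambda>n. real n ^ 3 * q n ^ 6 / real (d n)) at_top sequentially"
  with assms show "(\<lambda>n. total_variation (erdos_renyi n p) (geometric_graph n p (d n) (q n))) \<longlonglongrightarrow> 1"
    by (rule total_variation_tendsto_1)
qed

end
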